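(* Let $H$ be a separable complex Hilbert space, let $T \in B(H)$ be a quasidiagonal operator and let $P_1 \leq P_2 \leq \cdots$ be any filtration of $H$ which asymptotically commutes with $T$, i.e. $\|[P_n,T]\| \to 0$. Then the following statements hold: (1) The sequence $(P_nTP_n)$ is stable if and only if $T$ is invertible. (2) The sequence $(P_nTP_n)$ is applicable if and only if $T$ is invertible. (3) The sequence $(P_nTP_n)$ is stably regularizable if and only if $T$ is Moore-Penrose invertible (equivalently, the range of $T$ is closed). (4) Assume that $T$ has closed range, let $\varepsilon > 0$ be strictly smaller than $\inf\{\lambda > 0 : \lambda^2 \in \sigma(T^*T)\}$, let $y \in H$ and let $x \in H$ be the least square solution of the equation $Tx = y$. If $y_n = P_n y$ and $x_n \in P_nH$ is the least square solution of the $\varepsilon$-regularized equation $(P_nTP_n)_{\varepsilon} x_n = y_n$, then $\|x_n - x\| \to 0$ as $n \to \infty$.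
   Context: A filtration of $H$ is a sequence of finite rank orthogonal projections $P_n = P_n^* = P_n^2$ with $P_nH \subset P_{n+1}H$ for all $n$ and $\|P_n v - v\| \to 0$ for all $v \in H$. $[P,T] = PT - TP$. An operator $T \in B(H)$ is quasidiagonal if there exist finite rank orthogonal projections $Q_n$ with $\|Q_n v - v\| \to 0$ for all $v \in H$ and $\|[T,Q_n]\| \to 0$. Throughout, $P_nTP_n$ is regarded as an operator on the finite dimensional space $P_nH$ (i.e. as a matrix), and inverses, Moore-Penrose inverses etc. of it are taken there. The sequence $(P_nTP_n)$ is applicable if there is an integer $n_0$ such that for every $y \in H$ and every $n \geq n_0$ there is a unique solution $x_n \in P_nH$ of $P_nTP_n x_n = P_n y$ and, moreover, the $x_n$ converge in norm to a solution $x$ of $Tx = y$. It is stable if there is $n_0$ such that $P_nTP_n$ is invertible for all $n \geq n_0$ and $\sup_{n \geq n_0}\|(P_nTP_n)^{-1}\| < \infty$. An operator $T$ is Moore-Penrose invertible if there is a (necessarily unique) bounded operator $T^+$, its Moore-Penrose inverse, with $TT^+T = T$, $T^+TT^+ = T^+$, $(TT^+)^* = TT^+$ and $(T^+T)^* = T^+T$. The least square solution of $Tx=y$ is $x = T^+y$, i.e. the vector of smallest norm among those minimizing $u \mapsto \|Tu - y\|$. For a matrix $S \in M_k(\mathbb{C})$ with singular value decomposition $S = UDV$ ($U,V$ unitary, $D = \mathrm{diag}(\lambda_1,\ldots,\lambda_k)$ with $0 \le \lambda_1 \leq \cdots \leq \lambda_k$ the singular values of $S$) and $\varepsilon > 0$,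 the $\varepsilon$-regularization of $S$ is $S_{\varepsilon} = U D_{\varepsilon} V$, where $D_{\varepsilon}$ is obtained from $D$ by replacing every $\lambda_j \leq \varepsilon$ by $0$. The sequence $(P_nTP_n)$ is stably regularizable if there is $\varepsilon > 0$ such that $\|(P_nTP_n)_{\varepsilon} - P_nTP_n\| \to 0$ and $\sup_n \|(P_nTP_n)_{\varepsilon}^+\| < \infty$. The infimum of the empty set is $+\infty$. *)

theory Defs
  imports "HOL-Analysis.Analysis"
begin

section \<open>Complex Hilbert spaces\<close>

text \<open>
  The inner product is antilinear in the first and linear in the second argument. The last axiom
  says that the norm (with respect to which the space is complete, by \<^class>\<open>banach\<close>) is the one
  induced by the inner product; it includes positive definiteness.
\<close>

class complex_hilbert = banach +
  fixes scaleC :: "complex \<Rightarrow> 'a \<Rightarrow> 'a"  (infixr "*\<^sub>C" 75)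
    and cinner :: "'a \<Rightarrow> 'a \<Rightarrow> complex"
  assumes scaleC_add_right: "a *\<^sub>C (x + y) = a *\<^sub>C x + a *\<^sub>C y"
    and scaleC_add_left: "(a + b) *\<^sub>C x = a *\<^sub>C x + b *\<^sub>C x"
    and scaleC_scaleC: "a *\<^sub>C (b *\<^sub>C x) = (a * b) *\<^sub>C x"
    and scaleC_one: "1 *\<^sub>C x = x"
    and scaleR_scaleC: "r *\<^sub>R x = complex_of_real r *\<^sub>C x"
    and cinner_commute: "cinner x y = cnj (cinner y x)"
    and cinner_add_right: "cinner x (y + z) = cinner x y + cinner x z"
    and cinner_scaleC_right: "cinner x (a *\<^sub>C y) = a * cinner x y"
    and cinner_self: "cinner x x = complex_of_real ((norm x)\<^sup>2)"

global_interpretation complex_vector: vector_space "scaleC :: complex \<Rightarrow> 'a \<Rightarrow> 'a::complex_hilbert"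
  by unfold_locales (simp_all add: scaleC_add_right scaleC_add_left scaleC_scaleC scaleC_one)

instantiation complex :: complex_hilbert
begin

definition scaleC_complex :: "complex \<Rightarrow> complex \<Rightarrow> complex"
  where "scaleC_complex a x = a * x"

definition cinner_complex :: "complex \<Rightarrow> complex \<Rightarrow> complex"
  where "cinner_complex x y = cnj x * y"

instance
proof
  fix a b x y z :: complex and r :: real
  show "a *\<^sub>C (x + y) = a *\<^sub>C x + a *\<^sub>C y" "(a + b) *\<^sub>C x = a *\<^sub>C x + b *\<^sub>C x"
    by (simp_all add: scaleC_complex_def distrib_left distrib_right)
  show "a *\<^sub>C (b *\<^sub>C x) = (a * b) *\<^sub>C x" "1 *\<^sub>C x = x"
    by (simp_all add: scaleC_complex_def mult.assoc)
  show "r *\<^sub>R x = complex_of_real r *\<^sub>C x"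
    by (simp add: scaleC_complex_def scaleR_conv_of_real)
  show "cinner x y = cnj (cinner y x)" "cinner x (y + z) = cinner x y + cinner x z"
    by (simp_all add: cinner_complex_def mult.commute distrib_left)
  show "cinner x (a *\<^sub>C y) = a * cinner x y"
    by (simp add: cinner_complex_def scaleC_complex_def mult.left_commute)
  show "cinner x x = complex_of_real ((norm x)\<^sup>2)"
    unfolding cinner_complex_def by (metis complex_norm_square mult.commute)
qed

end


section \<open>Operators on a closed subspace\<close>

text \<open>
  An operator on a closed subspace \<open>X\<close> of \<open>H\<close> is represented by a function on \<open>H\<close> of which only
  the restriction to \<open>X\<close> matters. For \<open>X = UNIV\<close> one gets the operators on \<open>H\<close>, for
  \<open>X = range (P n)\<close> the operators on \<open>P\<^sub>n H\<close>.
\<close>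

definition bounded_op_on :: "'a::complex_hilbert set \<Rightarrow> ('a \<Rightarrow> 'a) \<Rightarrow> bool" where
  "bounded_op_on X A \<longleftrightarrow>
     (\<forall>x\<in>X. A x \<in> X) \<and>
     (\<forall>x\<in>X. \<forall>y\<in>X. A (x + y) = A x + A y) \<and>
     (\<forall>c. \<forall>x\<in>X. A (c *\<^sub>C x) = c *\<^sub>C A x) \<and>
     (\<exists>K. \<forall>x\<in>X. norm (A x) \<le> norm x * K)"

abbreviation bounded_op :: "('a::complex_hilbert \<Rightarrow> 'a) \<Rightarrow> bool" where
  "bounded_op \<equiv> bounded_op_on UNIV"

text \<open>Operator norm on \<open>X\<close>; for \<open>X = UNIV\<close> this is \<^const>\<open>onorm\<close>.\<close>

definition onorm_on :: "'a::complex_hilbert set \<Rightarrow> ('a \<Rightarrow> 'a) \<Rightarrow> real" where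
  "onorm_on X A = (SUP x\<in>X. norm (A x) / norm x)"

definition invertible_on :: "'a::complex_hilbert set \<Rightarrow> ('a \<Rightarrow> 'a) \<Rightarrow> bool" where
  "invertible_on X A \<longleftrightarrow> (\<exists>B. bounded_op_on X B \<and> (\<forall>x\<in>X. A (B x) = x \<and> B (A x) = x))"

abbreviation invertible_op :: "('a::complex_hilbert \<Rightarrow> 'a) \<Rightarrow> bool" where
  "invertible_op \<equiv> invertible_on UNIV"

definition is_adjoint_on :: "'a::complex_hilbert set \<Rightarrow> ('a \<Rightarrow> 'a) \<Rightarrow> ('a \<Rightarrow> 'a) \<Rightarrow> bool" where
  "is_adjoint_on X A B \<longleftrightarrow>
     (\<forall>x\<in>X. B x \<in> X) \<and> (\<forall>x\<in>X. \<forall>y\<in>X. cinner (A x) y = cinner x (B y))"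

abbreviation selfadjoint_on :: "'a::complex_hilbert set \<Rightarrow> ('a \<Rightarrow> 'a) \<Rightarrow> bool" where
  "selfadjoint_on X A \<equiv> is_adjoint_on X A A"

definition adjoint_op :: "('a::complex_hilbert \<Rightarrow> 'a) \<Rightarrow> 'a \<Rightarrow> 'a" where
  "adjoint_op T = (THE S. is_adjoint_on UNIV T S)"

definition op_spectrum :: "('a::complex_hilbert \<Rightarrow> 'a) \<Rightarrow> complex set" where
  "op_spectrum T = {z. \<not> invertible_op (\<lambda>x. T x - z *\<^sub>C x)}"


section \<open>Moore-Penrose inverses and least square solutions\<close>

definition is_mp_inverse_on :: "'a::complex_hilbert set \<Rightarrow> ('a \<Rightarrow> 'a) \<Rightarrow> ('a \<Rightarrow> 'a) \<Rightarrow> bool" where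
  "is_mp_inverse_on X A B \<longleftrightarrow>
     bounded_op_on X B \<and>
     (\<forall>x\<in>X. A (B (A x)) = A x) \<and>
     (\<forall>x\<in>X. B (A (B x)) = B x) \<and>
     selfadjoint_on X (\<lambda>x. A (B x)) \<and>
     selfadjoint_on X (\<lambda>x. B (A x))"

definition mp_invertible_on :: "'a::complex_hilbert set \<Rightarrow> ('a \<Rightarrow> 'a) \<Rightarrow> bool" where
  "mp_invertible_on X A \<longleftrightarrow> (\<exists>B. is_mp_inverse_on X A B)"

text \<open>
  The Moore-Penrose inverse is unique as an operator on \<open>X\<close>; the choice only concerns the
  irrelevant values outside \<open>X\<close>.
\<close>

definition mp_inverse_on :: "'a::complex_hilbert set \<Rightarrow> ('a \<Rightarrow> 'a) \<Rightarrow> 'a \<Rightarrow> 'a" where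
  "mp_inverse_on X A = (SOME B. is_mp_inverse_on X A B)"

definition least_square_solution_on :: "'a::complex_hilbert set \<Rightarrow> ('a \<Rightarrow> 'a) \<Rightarrow> 'a \<Rightarrow> 'a" where
  "least_square_solution_on X A y = mp_inverse_on X A y"


section \<open>Singular value decomposition and regularization\<close>

text \<open>
  An operator on a \<open>k\<close>-dimensional space \<open>X\<close> becomes a \<open>k \<times> k\<close> matrix through an orthonormal
  basis \<open>e 0, \<dots>, e (k - 1)\<close> of \<open>X\<close>.
\<close>

definition orthonormal_basis_of :: "'a::complex_hilbert set \<Rightarrow> nat \<Rightarrow> (nat \<Rightarrow> 'a) \<Rightarrow> bool" where
  "orthonormal_basis_of X k e \<longleftrightarrow>
     (\<forall>i<k. \<forall>j<k. cinner (e i) (e j) = (if i = j then 1 else 0)) \<and>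
     complex_vector.span (e ` {..<k}) = X"

definition diag_op :: "nat \<Rightarrow> (nat \<Rightarrow> 'a::complex_hilbert) \<Rightarrow> (nat \<Rightarrow> real) \<Rightarrow> 'a \<Rightarrow> 'a" where
  "diag_op k e l x = (\<Sum>j<k. (complex_of_real (l j) * cinner (e j) x) *\<^sub>C e j)"

definition unitary_on :: "'a::complex_hilbert set \<Rightarrow> ('a \<Rightarrow> 'a) \<Rightarrow> bool" where
  "unitary_on X U \<longleftrightarrow>
     bounded_op_on X U \<and>
     (\<exists>W. is_adjoint_on X U W \<and> (\<forall>x\<in>X. U (W x) = x \<and> W (U x) = x))"

definition is_svd_on ::
  "'a::complex_hilbert set \<Rightarrow> ('a \<Rightarrow> 'a) \<Rightarrow> nat \<Rightarrow> (nat \<Rightarrow> 'a) \<Rightarrow>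
    ('a \<Rightarrow> 'a) \<Rightarrow> (nat \<Rightarrow> real) \<Rightarrow> ('a \<Rightarrow> 'a) \<Rightarrow> bool" where
  "is_svd_on X S k e U l V \<longleftrightarrow>
     orthonormal_basis_of X k e \<and> unitary_on X U \<and> unitary_on X V \<and>
     (\<forall>j<k. 0 \<le> l j) \<and> (\<forall>i j. i \<le> j \<and> j < k \<longrightarrow> l i \<le> l j) \<and>
     (\<forall>x\<in>X. S x = U (diag_op k e l (V x)))"

definition is_regularization_on ::
  "'a::complex_hilbert set \<Rightarrow> real \<Rightarrow> ('a \<Rightarrow> 'a) \<Rightarrow> ('a \<Rightarrow> 'a) \<Rightarrow> bool" where
  "is_regularization_on X \<epsilon> S R \<longleftrightarrow>
     (\<exists>k e U l V. is_svd_on X S k e U l V \<and>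
        (\<forall>x\<in>X. R x = U (diag_op k e (\<lambda>j. if l j \<le> \<epsilon> then 0 else l j) (V x))))"

text \<open>
  On \<open>X\<close> the regularization does not depend on the basis or on the singular value
  decomposition, so here, too, the choice only concerns values outside \<open>X\<close>.
\<close>

definition regularization_on :: "'a::complex_hilbert set \<Rightarrow> real \<Rightarrow> ('a \<Rightarrow> 'a) \<Rightarrow> 'a \<Rightarrow> 'a" where
  "regularization_on X \<epsilon> S = (SOME R. is_regularization_on X \<epsilon> S R)"


section \<open>Filtrations, quasidiagonal operators and finite sections\<close>

definition finite_rank_projection :: "('a::complex_hilbert \<Rightarrow> 'a) \<Rightarrow> bool" where
  "finite_rank_projection P \<longleftrightarrow>
     bounded_op P \<and> selfadjoint_on UNIV P \<and> (\<forall>x. P (P x) = P x) \<and>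
     (\<exists>B. finite B \<and> range P = complex_vector.span B)"

definition filtration :: "(nat \<Rightarrow> 'a::complex_hilbert \<Rightarrow> 'a) \<Rightarrow> bool" where
  "filtration P \<longleftrightarrow>
     (\<forall>n. finite_rank_projection (P n)) \<and>
     (\<forall>n. range (P n) \<subseteq> range (P (Suc n))) \<and>
     (\<forall>v. (\<lambda>n. norm (P n v - v)) \<longlonglongrightarrow> 0)"

definition commutator :: "('a::complex_hilbert \<Rightarrow> 'a) \<Rightarrow> ('a \<Rightarrow> 'a) \<Rightarrow> 'a \<Rightarrow> 'a" where
  "commutator A B x = A (B x) - B (A x)"

definition quasidiagonal :: "('a::complex_hilbert \<Rightarrow> 'a) \<Rightarrow> bool" where
  "quasidiagonal T \<longleftrightarrow>
     bounded_op T \<and>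
     (\<exists>Q. (\<forall>n::nat. finite_rank_projection (Q n)) \<and>
          (\<forall>v. (\<lambda>n. norm (Q n v - v)) \<longlonglongrightarrow> 0) \<and>
          (\<lambda>n. onorm (commutator T (Q n))) \<longlonglongrightarrow> 0)"

text \<open>The operator \<open>P\<^sub>n T P\<^sub>n\<close>, to be used as an operator on \<open>range (P n)\<close>.\<close>

definition finite_section ::
  "(nat \<Rightarrow> 'a::complex_hilbert \<Rightarrow> 'a) \<Rightarrow> ('a \<Rightarrow> 'a) \<Rightarrow> nat \<Rightarrow> 'a \<Rightarrow> 'a" where
  "finite_section P T n x = P n (T (P n x))"

definition applicable :: "(nat \<Rightarrow> 'a::complex_hilbert \<Rightarrow> 'a) \<Rightarrow> ('a \<Rightarrow> 'a) \<Rightarrow> bool" where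
  "applicable P T \<longleftrightarrow>
     (\<exists>n0. \<forall>y.
        (\<forall>n\<ge>n0. \<exists>!u. u \<in> range (P n) \<and> finite_section P T n u = P n y) \<and>
        (\<exists>x. T x = y \<and>
           (\<lambda>n. THE u. u \<in> range (P n) \<and> finite_section P T n u = P n y) \<longlonglongrightarrow> x))"

definition stable_seq :: "(nat \<Rightarrow> 'a::complex_hilbert \<Rightarrow> 'a) \<Rightarrow> ('a \<Rightarrow> 'a) \<Rightarrow> bool" where
  "stable_seq P T \<longleftrightarrow>
     (\<exists>n0. (\<forall>n\<ge>n0. invertible_on (range (P n)) (finite_section P T n)) \<and>
        bdd_above ((\<lambda>n. onorm_on (range (P n))
                          (inv_into (range (P n)) (finite_section P T n))) ` {n0..}))"

definition regularized_section ::
  "(nat \<Rightarrow> 'a::complex_hilbert \<Rightarrow> 'a) \<Rightarrow> ('a \<Rightarrow> 'a) \<Rightarrow> real \<Rightarrow> nat \<Rightarrow> 'a \<Rightarrow> 'a" where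
  "regularized_section P T \<epsilon> n = regularization_on (range (P n)) \<epsilon> (finite_section P T n)"

definition stably_regularizable :: "(nat \<Rightarrow> 'a::complex_hilbert \<Rightarrow> 'a) \<Rightarrow> ('a \<Rightarrow> 'a) \<Rightarrow> bool" where
  "stably_regularizable P T \<longleftrightarrow>
     (\<exists>\<epsilon>>0.
        (\<lambda>n. onorm_on (range (P n))
               (\<lambda>x. regularized_section P T \<epsilon> n x - finite_section P T n x)) \<longlonglongrightarrow> 0 \<and>
        bdd_above (range (\<lambda>n. onorm_on (range (P n))
                                 (mp_inverse_on (range (P n)) (regularized_section P T \<epsilon> n)))))"

end

theory Submission
  imports Defs
begin

text \<open>
  Write \<open>S\<close> for the adjoint of \<open>T\<close>. On \<open>P\<^sub>n H\<close> the sections \<open>P\<^sub>n T P\<^sub>n\<close> and \<open>P\<^sub>n S P\<^sub>n\<close> differ from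
  \<open>T\<close> and \<open>S\<close> by at most \<open>\<parallel>[P\<^sub>n, T]\<parallel>\<close>, so lower bounds for \<open>T\<close> and \<open>S\<close> pass to the sections and
  back; this gives the stability criterion. If the method is applicable, then \<open>T\<close> is onto and \<open>S\<close> is
  bounded below, hence so are the sections of \<open>S\<close> and, these being square matrices, those of \<open>T\<close>.

  \<open>T\<close> is Moore-Penrose invertible iff \<open>c \<parallel>S y\<parallel> \<le> \<parallel>T (S y)\<parallel>\<close> for some \<open>c > 0\<close>. A regularized section
  satisfies the analogue with \<open>c = \<epsilon>\<close>, and this survives the limit. Conversely, if \<open>T\<close> is bounded
  below by \<open>d > \<epsilon>\<close> on the complement of its kernel, then a unit singular vector \<open>v\<close> of \<open>P\<^sub>n T P\<^sub>n\<close> for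
  a singular value \<open>s \<le> \<epsilon>\<close> almost satisfies \<open>S (T v) = s\<^sup>2 v\<close>, which forces \<open>s\<^sup>2 = O(\<parallel>[P\<^sub>n, T]\<parallel>)\<close>;
  so the regularization error tends to \<open>0\<close>.
\<close>

section \<open>Complex inner products\<close>

text \<open>Moore-Penrose inversion is not continuous for strong convergence, since small singular
  values may disappear in the limit. This is the obstacle behind the convergence of the regularized
  solutions. The cut at \<epsilon> meets it: every nonzero singular value of a regularized section
  exceeds \<epsilon>, so the Moore-Penrose inverses are bounded by
  \<open>inverse \<epsilon>\<close>. The rest comes from the adjoint side. The adjoints of the
  regularized sections converge strongly to \<open>S\<close>, which places the least square solution
  asymptotically in their ranges and the unsolvable part of \<open>y\<close> asymptotically in their
  kernels. The criterion for Moore-Penrose invertibility speaks of the vectors \<open>S y\<close>,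
  not of the complement of the kernel of \<open>T\<close>, for a similar reason: strong convergence
  gives no direct hold on kernels, but \<open>S y\<close> is a limit of vectors in the ranges of the
  adjoint sections.\<close>

lemma cinner_add_left: "cinner (x + y) z = cinner x z + cinner y (z::'a::complex_hilbert)"
  by (metis cinner_commute cinner_add_right complex_cnj_add)

lemma cinner_scaleC_left: "cinner (a *\<^sub>C x) y = cnj a * cinner x (y::'a::complex_hilbert)"
  by (metis cinner_commute cinner_scaleC_right complex_cnj_mult)

lemma cinner_zero_right [simp]: "cinner x (0::'a::complex_hilbert) = 0"
  by (metis add_cancel_right_right cinner_add_right)

lemma cinner_zero_left [simp]: "cinner (0::'a::complex_hilbert) x = 0"
  by (metis add_cancel_right_right cinner_add_left)

lemma cinner_minus_right [simp]: "cinner x (- y) = - cinner x (y::'a::complex_hilbert)"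
  by (metis add.right_inverse cinner_add_right cinner_zero_right minus_unique)

lemma cinner_minus_left [simp]: "cinner (- x) y = - cinner x (y::'a::complex_hilbert)"
  by (metis add.right_inverse cinner_add_left cinner_zero_left minus_unique)

lemma cinner_diff_right: "cinner x (y - z) = cinner x y - cinner x (z::'a::complex_hilbert)"
  by (metis cinner_add_right cinner_minus_right diff_conv_add_uminus)

lemma cinner_diff_left: "cinner (x - y) z = cinner x z - cinner y (z::'a::complex_hilbert)"
  by (metis cinner_add_left cinner_minus_left diff_conv_add_uminus)

lemma cinner_sum_right: "cinner x (\<Sum>i\<in>I. f i) = (\<Sum>i\<in>I. cinner x (f i :: 'a::complex_hilbert))"
  by (induction I rule: infinite_finite_induct) (auto simp: cinner_add_right)

lemma cinner_sum_left: "cinner (\<Sum>i\<in>I. f i) x = (\<Sum>i\<in>I. cinner (f i :: 'a::complex_hilbert) x)"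
  by (induction I rule: infinite_finite_induct) (auto simp: cinner_add_left)

lemma cinner_eq_0_commute: "cinner x y = 0 \<longleftrightarrow> cinner y (x::'a::complex_hilbert) = 0"
  by (metis cinner_commute complex_cnj_zero_iff)

lemma power2_norm_eq_Re_cinner: "(norm (x::'a::complex_hilbert))\<^sup>2 = Re (cinner x x)"
  by (simp add: cinner_self)

lemma Re_cinner_commute: "Re (cinner x y) = Re (cinner y (x::'a::complex_hilbert))"
  by (subst cinner_commute) simp

lemma norm_scaleC: "norm (c *\<^sub>C x) = cmod c * norm (x::'a::complex_hilbert)"
proof -
  have "complex_of_real ((norm (c *\<^sub>C x))\<^sup>2) = complex_of_real ((cmod c * norm x)\<^sup>2)"
    unfolding cinner_self[symmetric] cinner_scaleC_left cinner_scaleC_right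
    by (simp add: cinner_self power_mult_distrib complex_norm_square mult_ac del: of_real_power)
  then have "(norm (c *\<^sub>C x))\<^sup>2 = (cmod c * norm x)\<^sup>2"
    using of_real_eq_iff by blast
  then show ?thesis
    by simp
qed

lemma norm_add_squared:
  "(norm (x + y))\<^sup>2 = (norm x)\<^sup>2 + 2 * Re (cinner x y) + (norm (y::'a::complex_hilbert))\<^sup>2"
  by (simp add: power2_norm_eq_Re_cinner cinner_add_left cinner_add_right Re_cinner_commute[of y x])

lemma norm_diff_squared:
  "(norm (x - y))\<^sup>2 = (norm x)\<^sup>2 - 2 * Re (cinner x y) + (norm (y::'a::complex_hilbert))\<^sup>2"
  by (simp add: power2_norm_eq_Re_cinner cinner_diff_left cinner_diff_right Re_cinner_commute[of y x])

lemma parallelogram: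
  "(norm (x + y))\<^sup>2 + (norm (x - y))\<^sup>2 = 2 * (norm x)\<^sup>2 + 2 * (norm (y::'a::complex_hilbert))\<^sup>2"
  by (simp add: norm_add_squared norm_diff_squared)

lemma pythagoras:
  "cinner x y = 0 \<Longrightarrow> (norm (x + y))\<^sup>2 = (norm x)\<^sup>2 + (norm (y::'a::complex_hilbert))\<^sup>2"
  by (simp add: norm_add_squared)

text \<open>Pythagoras for the splitting of \<open>x\<close> into its projection onto the line of
  \<open>y\<close> and an orthogonal rest \<open>z\<close>.\<close>

lemma norm_cinner_le: "cmod (cinner x y) \<le> norm x * norm (y::'a::complex_hilbert)"
proof (cases "y = 0")
  case False
  define c where "c = cinner y x / complex_of_real ((norm y)\<^sup>2)"
  define z where "z = x - c *\<^sub>C y"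
  have "cinner y z = 0"
    using False by (simp add: z_def c_def cinner_diff_right cinner_scaleC_right cinner_self)
  then have "cinner z (c *\<^sub>C y) = 0"
    by (simp add: cinner_scaleC_right cinner_eq_0_commute)
  then have "(norm x)\<^sup>2 = (norm z)\<^sup>2 + (norm (c *\<^sub>C y))\<^sup>2"
    using pythagoras[of z "c *\<^sub>C y"] by (simp add: z_def)
  then have "norm (c *\<^sub>C y) \<le> norm x"
    by (metis norm_ge_zero power2_le_imp_le le_add_same_cancel2 zero_le_power2)
  also have "norm (c *\<^sub>C y) = cmod (cinner y x) / norm y"
    using False by (simp add: c_def norm_scaleC norm_divide norm_power power2_eq_square norm_mult)
  finally have "cmod (cinner y x) \<le> norm x * norm y"
    using False by (simp add: divide_simps)
  then show ?thesis
    by (metis cinner_commute complex_mod_cnj)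
qed simp

lemma Re_cinner_le: "Re (cinner x y) \<le> norm x * norm (y::'a::complex_hilbert)"
  using norm_cinner_le[of x y] complex_Re_le_cmod[of "cinner x y"] by linarith

lemma cinner_scaleR_right: "cinner x (r *\<^sub>R y) = r *\<^sub>R cinner x (y::'a::complex_hilbert)"
  by (simp add: scaleR_scaleC[of r y] cinner_scaleC_right scaleR_conv_of_real)

lemma cinner_scaleR_left: "cinner (r *\<^sub>R x) y = r *\<^sub>R cinner x (y::'a::complex_hilbert)"
  by (simp add: scaleR_scaleC[of r x] cinner_scaleC_left scaleR_conv_of_real)

lemma bounded_bilinear_cinner: "bounded_bilinear (cinner :: 'a::complex_hilbert \<Rightarrow> 'a \<Rightarrow> complex)"
proof
  show "\<exists>K. \<forall>a b. norm (cinner a b) \<le> norm a * norm (b::'a) * K"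
    by (rule exI[of _ 1]) (simp add: norm_cinner_le)
qed (simp_all add: cinner_add_left cinner_add_right cinner_scaleR_left cinner_scaleR_right)

lemma bounded_bilinear_scaleC: "bounded_bilinear (scaleC :: complex \<Rightarrow> 'a::complex_hilbert \<Rightarrow> 'a)"
proof
  fix r :: real and a :: complex and b :: 'a
  show "(r *\<^sub>R a) *\<^sub>C b = r *\<^sub>R a *\<^sub>C b" "a *\<^sub>C r *\<^sub>R b = r *\<^sub>R a *\<^sub>C b"
    by (simp_all add: scaleR_scaleC[of r b] scaleR_scaleC[of r "a *\<^sub>C b"] scaleC_scaleC scaleR_conv_of_real mult.commute)
  show "\<exists>K. \<forall>a b. norm (a *\<^sub>C b :: 'a) \<le> norm a * norm b * K"
    by (rule exI[of _ 1]) (simp add: norm_scaleC)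
qed (simp_all add: scaleC_add_left scaleC_add_right)

lemmas continuous_on_cinner = bounded_bilinear.continuous_on[OF bounded_bilinear_cinner]
lemmas continuous_on_scaleC = bounded_bilinear.continuous_on[OF bounded_bilinear_scaleC]

lemma cinner_eqI: "(\<And>z. cinner z x = cinner z (y::'a::complex_hilbert)) \<Longrightarrow> x = y"
  by (metis cinner_diff_right cinner_self diff_self eq_iff_diff_eq_0 norm_eq_zero of_real_eq_0_iff power_eq_0_iff)

section \<open>Bounded operators\<close>

lemma bounded_op_onD:
  assumes "bounded_op_on X A"
  shows "x \<in> X \<Longrightarrow> A x \<in> X" "x \<in> X \<Longrightarrow> y \<in> X \<Longrightarrow> A (x + y) = A x + A y"
    "x \<in> X \<Longrightarrow> A (c *\<^sub>C x) = c *\<^sub>C A x"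
  using assms unfolding bounded_op_on_def by blast+

lemma bounded_op_on_bound:
  assumes "bounded_op_on X A"
  obtains K where "K > 0" "\<And>x. x \<in> X \<Longrightarrow> norm (A x) \<le> K * norm x"
proof -
  obtain K where K: "\<forall>x\<in>X. norm (A x) \<le> norm x * K"
    using assms unfolding bounded_op_on_def by blast
  have "norm (A x) \<le> max K 1 * norm x" if "x \<in> X" for x
    using K[rule_format, OF that] mult_left_mono[of K "max K 1" "norm x"] by (simp add: mult.commute)
  then show thesis
    using that[of "max K 1"] by simp
qed

lemma bounded_op_on_diff:
  assumes "bounded_op_on X A" "complex_vector.subspace X" "x \<in> X" "y \<in> X"
  shows "A (x - y) = A x - A y"
proof -
  have "A (x + (-1) *\<^sub>C y) = A x + (-1) *\<^sub>C A y"
    using assms by (simp only: bounded_op_onD[OF assms(1)] complex_vector.subspace_scale)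
  then show ?thesis
    by simp
qed

lemma bounded_op_imp_bounded_linear:
  assumes "bounded_op (T :: 'a::complex_hilbert \<Rightarrow> 'a)"
  shows "bounded_linear T"
proof -
  obtain K where "\<And>x. norm (T x) \<le> K * norm x"
    using bounded_op_on_bound[OF assms] by (metis UNIV_I)
  then show ?thesis
    using bounded_op_onD[OF assms]
    by (intro bounded_linear_intro[where K = K]) (auto simp: scaleR_scaleC mult.commute)
qed

lemma bounded_opI:
  assumes "\<And>x y. A (x + y) = A x + A y" "\<And>c x. A (c *\<^sub>C x) = c *\<^sub>C A x"
    "\<And>x. norm (A x) \<le> K * norm (x::'a::complex_hilbert)"
  shows "bounded_op A"
  unfolding bounded_op_on_def using assms by (auto simp: mult.commute)

section \<open>Adjoints and the Riesz representation\<close>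

lemma is_adjoint_on_cinner:
  "is_adjoint_on X A B \<Longrightarrow> x \<in> X \<Longrightarrow> y \<in> X \<Longrightarrow> cinner (A x) y = cinner x (B y)"
  by (simp add: is_adjoint_on_def)

lemma is_adjoint_UNIV_sym:
  assumes "is_adjoint_on UNIV T S"
  shows "is_adjoint_on UNIV S T"
  using assms unfolding is_adjoint_on_def by (metis UNIV_I cinner_commute)

lemma is_adjoint_UNIV_D:
  assumes "is_adjoint_on UNIV T S"
  shows "cinner (T x) y = cinner x (S y)" "cinner x (T y) = cinner (S x) y"
  using assms is_adjoint_UNIV_sym[OF assms] unfolding is_adjoint_on_def by auto

lemma is_adjoint_UNIV_unique:
  assumes "is_adjoint_on UNIV T S" "is_adjoint_on UNIV T S'"
  shows "S = S'"
  by (rule ext, rule cinner_eqI) (metis assms is_adjoint_UNIV_D(1))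

lemma adjoint_op_eqI: "is_adjoint_on UNIV T S \<Longrightarrow> adjoint_op T = S"
  unfolding adjoint_op_def by (blast intro: is_adjoint_UNIV_unique)

text \<open>Pairing \<open>T (S y)\<close> with \<open>y\<close> gives the square of
  \<open>norm (S y)\<close>, and one factor cancels.\<close>

lemma adjoint_bound:
  assumes "is_adjoint_on UNIV T S" "\<And>x. norm (T x) \<le> K * norm x" "0 \<le> K"
  shows "norm (S y) \<le> K * norm (y::'a::complex_hilbert)"
proof (cases "S y = 0")
  case False
  have "(norm (S y))\<^sup>2 = Re (cinner (T (S y)) y)"
    by (simp add: power2_norm_eq_Re_cinner is_adjoint_UNIV_D[OF assms(1)])
  also have "\<dots> \<le> (K * norm (S y)) * norm y"
    using Re_cinner_le[of "T (S y)" y] mult_right_mono[OF assms(2)[of "S y"], of "norm y"] by simp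
  finally show ?thesis
    using False by (simp add: power2_eq_square mult_ac)
qed (use assms(3) in simp)

lemma bounded_op_adjoint:
  assumes "bounded_op T" "is_adjoint_on UNIV T S"
  shows "bounded_op (S :: 'a::complex_hilbert \<Rightarrow> 'a)"
proof -
  obtain K where K: "K > 0" "\<And>x. norm (T x) \<le> K * norm x"
    using bounded_op_on_bound[OF assms(1)] by (metis UNIV_I)
  show ?thesis
  proof (rule bounded_opI)
    show "norm (S y) \<le> K * norm y" for y
      by (rule adjoint_bound[OF assms(2)]) (use K in auto)
    show "S (x + y) = S x + S y" for x y
      by (rule cinner_eqI)
        (simp add: is_adjoint_UNIV_D(1)[OF assms(2), symmetric] cinner_add_right)
    show "S (c *\<^sub>C x) = c *\<^sub>C S x" for c x
      by (rule cinner_eqI)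
        (simp add: is_adjoint_UNIV_D(1)[OF assms(2), symmetric] cinner_scaleC_right)
  qed
qed

text \<open>Minimize \<open>J x = \<parallel>x\<parallel>\<^sup>2 - 2 Re (f x)\<close>: minimizing sequences are Cauchy by the
  parallelogram law, and the first variation of \<open>J\<close> at the minimum is the representation of \<open>f\<close>.\<close>

lemma riesz_representation:
  fixes f :: "'a::complex_hilbert \<Rightarrow> complex"
  assumes add: "\<And>x y. f (x + y) = f x + f y" and scale: "\<And>c x. f (c *\<^sub>C x) = c * f x"
    and bound: "\<And>x. cmod (f x) \<le> K * norm x"
  shows "\<exists>z. \<forall>x. f x = cinner z x"
proof -
  define J where "J x = (norm x)\<^sup>2 - 2 * Re (f x)" for x
  have K: "Re (f x) \<le> K * norm x" for x
    using bound[of x] complex_Re_le_cmod[of "f x"] by linarith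
  have J_ge: "- (K\<^sup>2) \<le> J x" for x
    using K[of x] zero_le_power2[of "norm x - K"]
    by (simp add: J_def power2_diff mult.commute)
  have bdd: "bdd_below (range J)"
    by (rule bdd_belowI[of _ "- (K\<^sup>2)"]) (use J_ge in auto)
  define m where "m = Inf (range J)"
  have m_le: "m \<le> J x" for x
    unfolding m_def by (rule cInf_lower) (use bdd in auto)
  have "\<exists>x. J x < m + inverse (real (Suc n))" for n
  proof -
    have "Inf (range J) < m + inverse (real (Suc n))"
      by (simp add: m_def del: of_nat_Suc)
    then show ?thesis
      by (subst (asm) cInf_less_iff) (use bdd in auto)
  qed
  then obtain u where u: "\<And>n. J (u n) < m + inverse (real (Suc n))"
    by metis
  \<comment> \<open>At the midpoint the linear part of \<open>J\<close> is the mean of its values at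
    \<open>x\<close> and \<open>y\<close>, so the parallelogram law alone measures how far
    \<open>J\<close> drops there.\<close>
  have J_par: "(norm (x - y))\<^sup>2 \<le> 2 * J x + 2 * J y - 4 * m" for x y
  proof -
    have "f ((1/2) *\<^sub>C (x + y)) = (f x + f y) / 2"
      by (simp add: add scale)
    moreover have "norm ((1/2) *\<^sub>C (x + y)) = norm (x + y) / 2"
      by (simp add: norm_scaleC)
    ultimately have "4 * J ((1/2) *\<^sub>C (x + y)) = (norm (x + y))\<^sup>2 - 4 * Re (f x + f y)"
      by (simp only: J_def power_divide) (simp add: add_divide_distrib)
    moreover have "(norm (x + y))\<^sup>2 + (norm (x - y))\<^sup>2 = 2 * (norm x)\<^sup>2 + 2 * (norm y)\<^sup>2"
      by (rule parallelogram)
    ultimately show ?thesis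
      using m_le[of "(1/2) *\<^sub>C (x + y)"] by (simp add: J_def)
  qed
  have "Cauchy u"
  proof (rule metric_CauchyI)
    fix e :: real assume e: "e > 0"
    then obtain N where N: "inverse (real (Suc N)) < e\<^sup>2 / 4"
      using reals_Archimedean[of "e\<^sup>2 / 4"] by auto
    have "dist (u i) (u j) < e" if "i \<ge> N" "j \<ge> N" for i j
    proof -
      have "inverse (real (Suc i)) \<le> inverse (real (Suc N))" "inverse (real (Suc j)) \<le> inverse (real (Suc N))"
        using that by (auto intro!: le_imp_inverse_le)
      then have "(norm (u i - u j))\<^sup>2 < e\<^sup>2"
        using J_par[of "u i" "u j"] u[of i] u[of j] N by linarith
      then show ?thesis
        using e by (simp add: dist_norm power_less_imp_less_base)
    qed
    then show "\<exists>M. \<forall>m\<ge>M. \<forall>n\<ge>M. dist (u m) (u n) < e"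
      by blast
  qed
  then obtain z where z: "u \<longlonglongrightarrow> z"
    using Cauchy_convergent convergent_def by blast
  have blf: "bounded_linear f"
    by (rule bounded_linear_intro[where K = K])
      (use bound in \<open>auto simp: add scale scaleR_scaleC[where 'a = 'a] scaleR_conv_of_real mult.commute\<close>)
  have "(\<lambda>n. J (u n)) \<longlonglongrightarrow> J z"
    unfolding J_def by (intro tendsto_intros z bounded_linear.tendsto[OF blf])
  moreover have "(\<lambda>n. m + inverse (real (Suc n))) \<longlonglongrightarrow> m + 0"
    by (intro tendsto_intros LIMSEQ_inverse_real_of_nat)
  ultimately have "J z \<le> m"
    using u by (intro LIMSEQ_le[of "\<lambda>n. J (u n)" "J z" "\<lambda>n. m + inverse (real (Suc n))"])
      (auto intro: less_imp_le)
  then have min: "J z \<le> J x" for x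
    using m_le[of x] by linarith
  have Re_eq: "Re (f x) = Re (cinner z x)" for x
  proof -
    define d where "d = Re (cinner z x) - Re (f x)"
    have "0 \<le> t\<^sup>2 * (norm x)\<^sup>2 + 2 * t * d" for t :: real
    proof -
      have "J (z + complex_of_real t *\<^sub>C x) = J z + t\<^sup>2 * (norm x)\<^sup>2 + 2 * t * d"
        by (simp add: J_def norm_add_squared add scale norm_scaleC power_mult_distrib
            cinner_scaleC_right d_def algebra_simps)
      then show ?thesis
        using min[of "z + complex_of_real t *\<^sub>C x"] by simp
    qed
    then have 1: "0 \<le> t\<^sup>2 * (norm x)\<^sup>2 + 2 * t * d" for t .
    show ?thesis
    proof (cases "x = 0")
      case True
      then show ?thesis
        using scale[of 0 0] by simp
    next
      case False
      \<comment> \<open>This \<open>t\<close> minimizes the quadratic polynomial.\<close>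
      have "0 \<le> (- d / (norm x)\<^sup>2)\<^sup>2 * (norm x)\<^sup>2 + 2 * (- d / (norm x)\<^sup>2) * d"
        by (rule 1)
      also have "\<dots> = - (d\<^sup>2 / (norm x)\<^sup>2)"
        using False by (simp add: field_simps power2_eq_square)
      finally show ?thesis
        using False by (simp add: d_def divide_le_0_iff)
    qed
  qed
  have "f x = cinner z x" for x
  proof (rule complex_eqI)
    show "Re (f x) = Re (cinner z x)"
      by (rule Re_eq)
    \<comment> \<open>Multiplying the argument by \<open>- \<i>\<close> turns the real part into the
      imaginary part.\<close>
    have "Re (f ((- \<i>) *\<^sub>C x)) = Re (cinner z ((- \<i>) *\<^sub>C x))"
      by (rule Re_eq)
    then show "Im (f x) = Im (cinner z x)"
      by (simp only: scale cinner_scaleC_right) simp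
  qed
  then show ?thesis
    by blast
qed

lemma adjoint_exists:
  assumes "bounded_op (T :: 'a::complex_hilbert \<Rightarrow> 'a)"
  shows "\<exists>S. is_adjoint_on UNIV T S"
proof -
  obtain K where K: "K > 0" "\<And>x. norm (T x) \<le> K * norm x"
    using bounded_op_on_bound[OF assms] by (metis UNIV_I)
  have "\<exists>z. \<forall>x. cinner y (T x) = cinner z x" for y
  proof (rule riesz_representation)
    show "cmod (cinner y (T x)) \<le> (norm y * K) * norm x" for x
      using norm_cinner_le[of y "T x"] mult_left_mono[OF K(2)[of x], of "norm y"]
      by (simp add: mult.assoc)
  qed (simp_all add: bounded_op_onD[OF assms] cinner_add_right cinner_scaleC_right)
  then obtain S where "\<And>x y. cinner y (T x) = cinner (S y) x"
    by metis
  then have "\<forall>x y. cinner (T x) y = cinner x (S y)"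
    by (metis cinner_commute)
  then show ?thesis
    unfolding is_adjoint_on_def by blast
qed

section \<open>Moore-Penrose invertibility and closed range\<close>

text \<open>The Moore-Penrose inverse sends \<open>y\<close> to the solution in \<open>closure (range S)\<close> of the normal
  equation \<open>S (T x) = S y\<close>. There \<open>T\<close> is bounded below, so that \<open>x \<mapsto> x - t (S (T x) - S y)\<close> is
  a contraction for small \<open>t\<close>.\<close>

lemma mp_invertible_if_bounded_below:
  assumes T: "bounded_op (T :: 'a::complex_hilbert \<Rightarrow> 'a)" and adj: "is_adjoint_on UNIV T S"
    and c: "c > 0" and below: "\<And>y. c * norm (S y) \<le> norm (T (S y))"
  shows "mp_invertible_on UNIV T"
proof -
  note S = bounded_op_adjoint[OF T adj]
  note A = is_adjoint_UNIV_D[OF adj]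
  note lin = bounded_op_onD(2,3)[OF T, simplified] bounded_op_onD(2,3)[OF S, simplified]
  have diff: "T (x - y) = T x - T y" "S (x - y) = S x - S y" for x y
    using bounded_op_on_diff[OF T] bounded_op_on_diff[OF S] by auto
  interpret T: bounded_linear T
    by (rule bounded_op_imp_bounded_linear[OF T])
  interpret S: bounded_linear S
    by (rule bounded_op_imp_bounded_linear[OF S])
  obtain M where M: "M > 0" "\<And>x. norm (S x) \<le> M * norm x"
    using bounded_op_on_bound[OF S] by (metis UNIV_I)
  define X where "X = closure (range S)"
  have X_S: "S y \<in> X" for y
    unfolding X_def using closure_subset[of "range S"] by blast
  have X_add: "x + y \<in> X" if "x \<in> X" "y \<in> X" for x y
  proof -
    from that obtain f g where fg: "\<And>n. f n \<in> range S" "f \<longlonglongrightarrow> x" "\<And>n. g n \<in> range S" "g \<longlonglongrightarrow> y"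
      unfolding X_def closure_sequential by metis
    have "f n + g n \<in> range S" for n
      by (metis fg(1,3) imageE lin(3) rangeI)
    then show ?thesis
      unfolding X_def closure_sequential using tendsto_add[OF fg(2,4)] by (intro exI conjI) auto
  qed
  have X_scale: "a *\<^sub>C x \<in> X" if "x \<in> X" for a x
  proof -
    from that obtain f where f: "\<And>n. f n \<in> range S" "f \<longlonglongrightarrow> x"
      unfolding X_def closure_sequential by metis
    have "(\<lambda>n. a *\<^sub>C f n) \<longlonglongrightarrow> a *\<^sub>C x"
      by (intro bounded_bilinear.tendsto[OF bounded_bilinear_scaleC] tendsto_const f)
    moreover have "a *\<^sub>C f n \<in> range S" for n
      by (metis f(1) imageE lin(4) rangeI)
    ultimately show ?thesis
      unfolding X_def closure_sequential by (intro exI conjI) auto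
  qed
  have X_diff: "x - y \<in> X" if "x \<in> X" "y \<in> X" for x y
    using X_add[OF that(1) X_scale[OF that(2), of "-1"]] by simp
  have X_below: "c * norm x \<le> norm (T x)" if "x \<in> X" for x
  proof -
    have "closed {x. c * norm x \<le> norm (T x)}"
      by (intro closed_Collect_le continuous_intros T.continuous_on)
    then have "X \<subseteq> {x. c * norm x \<le> norm (T x)}"
      unfolding X_def by (intro closure_minimal) (use below in auto)
    then show ?thesis
      using that by blast
  qed
  have ker: "T x = 0" if "S (T x) = 0" for x
  proof -
    have "cinner (T x) (T x) = 0"
      using that by (simp add: A(1))
    then show ?thesis
      by (simp add: cinner_self)
  qed
  have "\<exists>!x. x \<in> X \<and> S (T x) = S y" for y
  proof -
    \<comment> \<open>With \<open>t * M\<^sup>2 = 1\<close> the second-order term is at most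
      \<open>t * (norm (T u))\<^sup>2\<close>, half of the first-order gain.\<close>
    define t where "t = inverse (M\<^sup>2)"
    \<comment> \<open>On a nonzero \<open>X\<close> one has \<open>c \<le> M\<close>, so the
      difference is nonnegative. \<open>max 0\<close> covers \<open>X = {0}\<close>, where
      \<open>c\<close> is unrestricted.\<close>
    define q where "q = sqrt (max 0 (1 - t * c\<^sup>2))"
    have t: "t > 0" "t * M\<^sup>2 = 1"
      using M by (simp_all add: t_def)
    have q: "0 \<le> q" "q < 1"
      using t c by (simp_all add: q_def)
    have contraction: "norm (u - t *\<^sub>R S (T u)) \<le> q * norm u" if "u \<in> X" for u
    proof -
      have "(norm (u - t *\<^sub>R S (T u)))\<^sup>2
          = (norm u)\<^sup>2 - 2 * t * (norm (T u))\<^sup>2 + t\<^sup>2 * (norm (S (T u)))\<^sup>2"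
        by (simp add: norm_diff_squared cinner_scaleR_right A(1)[symmetric] cinner_self
            power_mult_distrib)
      also have "t\<^sup>2 * (norm (S (T u)))\<^sup>2 \<le> t\<^sup>2 * (M * norm (T u))\<^sup>2"
        using M(2)[of "T u"] by (intro mult_left_mono power_mono) auto
      also have "t\<^sup>2 * (M * norm (T u))\<^sup>2 = t * (t * M\<^sup>2) * (norm (T u))\<^sup>2"
        by (simp add: power2_eq_square mult_ac)
      also have "(norm u)\<^sup>2 - 2 * t * (norm (T u))\<^sup>2 + t * (t * M\<^sup>2) * (norm (T u))\<^sup>2
          = (norm u)\<^sup>2 - t * (norm (T u))\<^sup>2"
        unfolding t(2) by simp
      also have "\<dots> \<le> (norm u)\<^sup>2 - t * (c * norm u)\<^sup>2"
        using X_below[OF that] c t by (intro diff_left_mono mult_left_mono power_mono) auto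
      also have "\<dots> = (1 - t * c\<^sup>2) * (norm u)\<^sup>2"
        by (simp add: power_mult_distrib algebra_simps)
      also have "\<dots> \<le> max 0 (1 - t * c\<^sup>2) * (norm u)\<^sup>2"
        by (intro mult_right_mono) auto
      also have "\<dots> = (q * norm u)\<^sup>2"
        by (simp add: q_def power_mult_distrib)
      finally show ?thesis
        by (rule power2_le_imp_le) (use q in auto)
    qed
    define g where "g x = x - t *\<^sub>R (S (T x) - S y)" for x
    have "\<exists>!x\<in>X. g x = x"
    proof (rule Banach_fix)
      show "complete X"
        by (simp add: X_def complete_eq_closed)
      show "X \<noteq> {}"
        using X_S by blast
      show "g ` X \<subseteq> X"
        using X_S X_scale X_diff by (auto simp: g_def scaleR_scaleC[where 'a = 'a])
      show "dist (g a) (g b) \<le> q * dist a b" if "a \<in> X" "b \<in> X" for a b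
        using contraction[OF X_diff[OF that]]
        by (simp add: g_def dist_norm diff algebra_simps)
    qed (use q in auto)
    then show ?thesis
      using t by (simp add: g_def Ex1_def)
  qed
  then obtain B where B: "\<And>y. B y \<in> X" "\<And>y. S (T (B y)) = S y"
    and B_unique: "\<And>x y. x \<in> X \<Longrightarrow> S (T x) = S y \<Longrightarrow> x = B y"
    by metis
  have TB_norm: "norm (T (B y)) \<le> norm y" for y
  proof (cases "T (B y) = 0")
    case False
    have "(norm (T (B y)))\<^sup>2 = Re (cinner (B y) (S y))"
      by (simp add: power2_norm_eq_Re_cinner A(1) B)
    also have "\<dots> = Re (cinner (T (B y)) y)"
      by (simp add: A(1))
    also have "\<dots> \<le> norm (T (B y)) * norm y"
      by (rule Re_cinner_le)
    finally show ?thesis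
      using False by (simp add: power2_eq_square)
  qed simp
  have B_op: "bounded_op B"
  proof (rule bounded_opI)
    show "B (x + y) = B x + B y" for x y
      by (rule B_unique[symmetric]) (simp_all add: X_add B lin)
    show "B (a *\<^sub>C x) = a *\<^sub>C B x" for a x
      by (rule B_unique[symmetric]) (simp_all add: X_scale B lin)
    show "norm (B y) \<le> inverse c * norm y" for y
      using X_below[OF B(1)[of y]] TB_norm[of y] c by (simp add: field_simps)
  qed
  have TBT: "T (B (T w)) = T w" for w
    using ker[of "B (T w) - w"] by (simp add: diff B)
  have BTB: "B (T (B y)) = B y" for y
    by (rule B_unique[symmetric]) (simp_all add: B)
  have X_ker: "cinner x z = 0" if "x \<in> X" "T z = 0" for x z
  proof -
    have "closed {x. cinner x z = 0}"
      by (intro closed_Collect_eq continuous_on_cinner continuous_intros)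
    then have "X \<subseteq> {x. cinner x z = 0}"
      unfolding X_def by (intro closure_minimal) (use that in \<open>auto simp: A(2)[symmetric]\<close>)
    then show ?thesis
      using that by blast
  qed
  \<comment> \<open>The right-hand side is Hermitian in \<open>y\<close> and \<open>z\<close>, so
    the left-hand side is too, which is self-adjointness. The same argument serves for
    \<open>B (T y)\<close> below.\<close>
  have "cinner (T (B y)) z = cinner (T (B y)) (T (B z))" for y z
    using A(1)[of "B y" "z - T (B z)"] by (simp add: cinner_diff_right diff B)
  then have TB: "cinner (T (B y)) z = cinner y (T (B z))" for y z
    by (metis cinner_commute)
  have "cinner (B (T y)) z = cinner (B (T y)) (B (T z))" for y z
    using X_ker[OF B(1), of "z - B (T z)" "T y"] by (simp add: cinner_diff_right diff TBT)
  then have BT: "cinner (B (T y)) z = cinner y (B (T z))" for y z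
    by (metis cinner_commute)
  have "is_mp_inverse_on UNIV T B"
    unfolding is_mp_inverse_on_def is_adjoint_on_def
    by (auto simp: B_op TBT BTB) (simp_all only: TB BT)
  then show ?thesis
    unfolding mp_invertible_on_def by blast
qed

lemma mp_inverse_UNIV_D:
  assumes "is_mp_inverse_on UNIV T B"
  shows "bounded_op B" "T (B (T x)) = T x" "B (T (B x)) = B x"
    "cinner (T (B x)) y = cinner x (T (B y))" "cinner (B (T x)) y = cinner x (B (T y))"
  using assms unfolding is_mp_inverse_on_def is_adjoint_on_def by auto

text \<open>Writing \<open>S y\<close> as \<open>S (D (S y))\<close> and moving the outer
  \<open>S\<close> across the inner product leaves \<open>T (S y)\<close> paired with
  \<open>D (S y)\<close>, whose norm is at most \<open>K * norm (S y)\<close>. The conclusion is the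
  hypothesis of \<open>mp_invertible_if_bounded_below\<close> for \<open>T\<close>, so Moore-Penrose
  invertibility passes from an operator to its adjoint.\<close>

lemma mp_invertible_imp_adjoint_bounded_below:
  assumes S: "bounded_op (S :: 'a::complex_hilbert \<Rightarrow> 'a)" and adj: "is_adjoint_on UNIV S T"
    and "mp_invertible_on UNIV S"
  obtains c where "c > 0" "\<And>y. c * norm (S y) \<le> norm (T (S y))"
proof -
  obtain D where "is_mp_inverse_on UNIV S D"
    using assms by (auto simp: mp_invertible_on_def)
  note D = mp_inverse_UNIV_D[OF this]
  obtain K where K: "K > 0" "\<And>x. norm (D x) \<le> K * norm x"
    using bounded_op_on_bound[OF D(1)] by (metis UNIV_I)
  have "norm (S y) \<le> K * norm (T (S y))" for y
  proof (cases "S y = 0")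
    case False
    have "(norm (S y))\<^sup>2 = Re (cinner (T (S y)) (D (S y)))"
      by (simp add: power2_norm_eq_Re_cinner is_adjoint_UNIV_D(2)[OF adj, symmetric] D)
    also have "\<dots> \<le> norm (T (S y)) * norm (D (S y))"
      by (rule Re_cinner_le)
    also have "\<dots> \<le> norm (T (S y)) * (K * norm (S y))"
      by (intro mult_left_mono K) auto
    finally show ?thesis
      using False by (simp add: power2_eq_square mult_ac)
  qed (use K in simp)
  then show thesis
    using K(1) by (intro that[of "inverse K"]) (simp_all add: field_simps)
qed

lemma mp_invertible_imp_closed_range:
  assumes T: "bounded_op (T :: 'a::complex_hilbert \<Rightarrow> 'a)" and "mp_invertible_on UNIV T"
  shows "closed (range T)"
proof -
  obtain B where "is_mp_inverse_on UNIV T B"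
    using assms by (auto simp: mp_invertible_on_def)
  note B = mp_inverse_UNIV_D[OF this]
  have "range T = {y. T (B y) = y}"
    using B by (auto simp: image_iff) (metis)
  moreover have "continuous_on UNIV (\<lambda>y. T (B y))"
    by (intro bounded_linear.continuous_on[OF bounded_op_imp_bounded_linear[OF T]]
        bounded_linear.continuous_on[OF bounded_op_imp_bounded_linear[OF B(1)]] continuous_intros)
  ultimately show ?thesis
    by (simp add: closed_Collect_eq)
qed

text \<open>Uniform boundedness for the functionals \<open>cinner y\<close> with \<open>y \<in> range T\<close> and \<open>norm (S y) \<le> 1\<close>:
  at \<open>z = T x\<close> they are bounded by \<open>norm x\<close>.\<close>

lemma closed_range_imp_adjoint_bounded_below:
  assumes T: "bounded_op (T :: 'a::complex_hilbert \<Rightarrow> 'a)" and adj: "is_adjoint_on UNIV T S"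
    and closed: "closed (range T)"
  obtains c where "c > 0" "\<And>x. c * norm (T x) \<le> norm (S (T x))"
proof -
  note A = is_adjoint_UNIV_D[OF adj]
  define Y where "Y = range T"
  have Y_add: "x + y \<in> Y" if "x \<in> Y" "y \<in> Y" for x y
  proof -
    from that obtain a b where "x = T a" "y = T b"
      by (auto simp: Y_def)
    then have "x + y = T (a + b)"
      by (simp add: bounded_op_onD(2)[OF T])
    then show ?thesis
      by (simp add: Y_def)
  qed
  have Y_scale: "a *\<^sub>C x \<in> Y" if "x \<in> Y" for a x
  proof -
    from that obtain b where "x = T b"
      by (auto simp: Y_def)
    then have "a *\<^sub>C x = T (a *\<^sub>C b)"
      by (simp add: bounded_op_onD(3)[OF T])
    then show ?thesis
      by (simp add: Y_def)
  qed
  define C where "C n = {z \<in> Y. \<forall>y\<in>Y. cmod (cinner y z) \<le> real n * norm (S y)}" for n :: nat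
  have C_closed: "closedin (top_of_set Y) (C n)" for n
  proof -
    have "closed (\<Inter>y\<in>Y. {z. cmod (cinner y z) \<le> real n * norm (S y)})"
      by (intro closed_INT ballI closed_Collect_le continuous_intros continuous_on_cinner)
    then show ?thesis
      by (rule closedin_closed[THEN iffD2, OF exI, OF conjI]) (auto simp: C_def)
  qed
  have "T x \<in> C (nat \<lceil>norm x\<rceil>)" for x
  proof -
    have "cmod (cinner y (T x)) \<le> real (nat \<lceil>norm x\<rceil>) * norm (S y)" for y
      using norm_cinner_le[of "S y" x] mult_left_mono[of "norm x" "real (nat \<lceil>norm x\<rceil>)" "norm (S y)"]
      by (simp add: A(2) mult.commute real_nat_ceiling_ge)
    then show ?thesis
      by (auto simp: C_def Y_def)
  qed
  then have "\<Union>(range C) = Y"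
    unfolding C_def Y_def by blast
  then have "top_of_set Y interior_of \<Union>(range C) \<noteq> {}"
    using interior_of_topspace[of "top_of_set Y"] by (simp add: Y_def)
  \<comment> \<open>Closedness of the range enters here: it makes \<open>Y\<close> complete, so that
    Baire's theorem applies inside \<open>Y\<close>.\<close>
  moreover have "completely_metrizable_space (top_of_set Y)"
    using closed unfolding Y_def
    by (simp add: completely_metrizable_space_closedin completely_metrizable_space_euclidean)
  ultimately obtain n where "top_of_set Y interior_of (C n) \<noteq> {}"
    using Baire_category_alt[of "top_of_set Y" "range C"] C_closed by auto
  then obtain z0 U where U: "openin (top_of_set Y) U" "z0 \<in> U" "U \<subseteq> C n"
    by (auto simp: interior_of_def)
  then obtain e where e: "e > 0" "\<And>z. z \<in> Y \<Longrightarrow> dist z z0 < e \<Longrightarrow> z \<in> U"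
    unfolding openin_euclidean_subtopology_iff by metis
  have z0: "z0 \<in> C n" "z0 \<in> Y"
    using U by (auto simp: C_def)
  define r where "r = e / 2"
  have r: "0 < r" "r < e"
    using e by (auto simp: r_def)
  have bound: "r * norm y \<le> 2 * real n * norm (S y)" if "y \<in> Y" for y
  proof (cases "y = 0")
    case False
    \<comment> \<open>\<open>w\<close> is \<open>y\<close> rescaled to length \<open>r\<close>, so
      that its pairing with \<open>y\<close> has modulus \<open>r * norm y\<close> while
      \<open>z0 + w\<close> stays in the ball around \<open>z0\<close>.\<close>
    define w where "w = complex_of_real (r / norm y) *\<^sub>C y"
    have w: "w \<in> Y" "norm w = r"
      using False r that by (simp_all add: w_def Y_scale norm_scaleC del: of_real_divide)
    have "cinner y w = complex_of_real (r * norm y)"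
      using False by (simp add: w_def cinner_scaleC_right cinner_self power2_eq_square)
    then have "r * norm y = cmod (cinner y w)"
      using r by (simp del: of_real_mult)
    also have "cinner y w = cinner y (z0 + w) - cinner y z0"
      by (simp add: cinner_add_right)
    also have "cmod \<dots> \<le> cmod (cinner y (z0 + w)) + cmod (cinner y z0)"
      by (rule norm_triangle_ineq4)
    also have "z0 + w \<in> C n"
      using e(2)[of "z0 + w"] U w r z0 Y_add by (auto simp: dist_norm)
    then have "cmod (cinner y (z0 + w)) + cmod (cinner y z0) \<le> 2 * (real n * norm (S y))"
      using z0 that unfolding C_def by fastforce
    finally show ?thesis
      by (simp add: mult.assoc)
  qed (use r in simp)
  show thesis
  proof
    \<comment> \<open>The summand \<open>1\<close> keeps the denominator positive for
      \<open>n = 0\<close>.\<close>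
    show "r / (2 * real n + 1) > 0"
      using r by simp
    show "r / (2 * real n + 1) * norm (T x) \<le> norm (S (T x))" for x
    proof -
      have "r * norm (T x) \<le> 2 * real n * norm (S (T x))"
        by (rule bound) (simp add: Y_def)
      also have "\<dots> \<le> (2 * real n + 1) * norm (S (T x))"
        by (intro mult_right_mono) auto
      finally show ?thesis
        by (simp add: divide_simps mult_ac add_pos_nonneg)
    qed
  qed
qed

text \<open>For a closed range the Baire argument bounds \<open>S\<close> from below on the range of
  \<open>T\<close>, which is the criterion for \<open>S\<close> and not for \<open>T\<close>. The
  detour through Moore-Penrose invertibility of \<open>S\<close> exchanges the two roles.\<close>

lemma mp_invertible_iff_closed_range:
  assumes T: "bounded_op (T :: 'a::complex_hilbert \<Rightarrow> 'a)"
  shows "mp_invertible_on UNIV T \<longleftrightarrow> closed (range T)"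
proof
  assume closed: "closed (range T)"
  obtain S where adj: "is_adjoint_on UNIV T S"
    using adjoint_exists[OF T] by blast
  note S = bounded_op_adjoint[OF T adj] and adj' = is_adjoint_UNIV_sym[OF adj]
  obtain c where "c > 0" "\<And>x. c * norm (T x) \<le> norm (S (T x))"
    using closed_range_imp_adjoint_bounded_below[OF T adj closed] by blast
  then have "mp_invertible_on UNIV S"
    using mp_invertible_if_bounded_below[OF S adj'] by blast
  then obtain c' where "c' > 0" "\<And>y. c' * norm (S y) \<le> norm (T (S y))"
    using mp_invertible_imp_adjoint_bounded_below[OF S adj'] by blast
  then show "mp_invertible_on UNIV T"
    using mp_invertible_if_bounded_below[OF T adj] by blast
qed (rule mp_invertible_imp_closed_range[OF T])

section \<open>Invertibility as a pair of lower bounds\<close>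

lemma invertible_imp_bounded_below:
  assumes "invertible_op (T :: 'a::complex_hilbert \<Rightarrow> 'a)"
  obtains c where "c > 0" "\<And>x. c * norm x \<le> norm (T x)"
proof -
  obtain B where B: "bounded_op B" "\<And>x. B (T x) = x"
    using assms unfolding invertible_on_def by auto
  obtain K where K: "K > 0" "\<And>x. norm (B x) \<le> K * norm x"
    using bounded_op_on_bound[OF B(1)] by (metis UNIV_I)
  have "norm y \<le> K * norm (T y)" for y
    using K(2)[of "T y"] by (simp add: B)
  then show thesis
    using K(1) by (intro that[of "inverse K"]) (simp_all add: field_simps)
qed

text \<open>The Moore-Penrose inverse \<open>B\<close> is a genuine inverse:
  \<open>B (T x) - x\<close> lies in the kernel of \<open>T\<close> and \<open>T (B y) - y\<close>
  in the kernel of \<open>S\<close>, and the lower bounds make both kernels trivial.\<close>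

lemma invertible_if_bounded_below:
  assumes T: "bounded_op (T :: 'a::complex_hilbert \<Rightarrow> 'a)" and adj: "is_adjoint_on UNIV T S"
    and c: "c > 0" "\<And>x. c * norm x \<le> norm (T x)" "\<And>x. c * norm x \<le> norm (S x)"
  shows "invertible_op T"
proof -
  note A = is_adjoint_UNIV_D[OF adj]
  obtain B where "is_mp_inverse_on UNIV T B"
    using mp_invertible_if_bounded_below[OF T adj c(1) c(2)] by (auto simp: mp_invertible_on_def)
  note B = mp_inverse_UNIV_D[OF this]
  have inj: "x = 0" if "T x = 0 \<or> S x = 0" for x
    using c(2)[of x] c(3)[of x] c(1) that by (auto simp: mult_le_0_iff)
  have "B (T x) - x = 0" for x
    by (rule inj) (simp add: bounded_op_on_diff[OF T] B)
  moreover have "S (T (B y)) = S y" for y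
    by (rule cinner_eqI) (simp add: A(1)[symmetric] B(2) flip: B(4))
  then have "T (B y) - y = 0" for y
    by (intro inj) (simp add: bounded_op_on_diff[OF bounded_op_adjoint[OF T adj]])
  ultimately show ?thesis
    unfolding invertible_on_def using B(1) by auto
qed

section \<open>Orthonormal bases\<close>

lemma orthonormal_basis_ofD:
  assumes "orthonormal_basis_of X k e"
  shows "i < k \<Longrightarrow> j < k \<Longrightarrow> cinner (e i) (e j) = (if i = j then 1 else 0)"
    "complex_vector.span (e ` {..<k}) = X"
    "j < k \<Longrightarrow> e j \<in> X"
    "complex_vector.subspace X"
  using assms complex_vector.span_superset[of "e ` {..<k}"] complex_vector.subspace_span[of "e ` {..<k}"]
  unfolding orthonormal_basis_of_def by auto

lemma norm_orthonormal_basis: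
  assumes "orthonormal_basis_of X k e" "j < k"
  shows "norm (e j) = 1"
proof -
  have "(norm (e j))\<^sup>2 = 1"
    using orthonormal_basis_ofD(1)[OF assms(1) assms(2) assms(2)] by (simp add: power2_norm_eq_Re_cinner)
  then show ?thesis
    by (simp add: power2_eq_1_iff) (use norm_ge_zero[of "e j"] in linarith)
qed

lemma sum_in_subspace:
  assumes "orthonormal_basis_of X k e"
  shows "(\<Sum>j<k. c j *\<^sub>C e j) \<in> X"
  using orthonormal_basis_ofD[OF assms]
  by (intro complex_vector.subspace_sum complex_vector.subspace_scale) auto

lemma cinner_basis_sum:
  assumes "orthonormal_basis_of X k e" "i < k"
  shows "cinner (e i) (\<Sum>j<k. c j *\<^sub>C e j) = c i"
proof -
  have "cinner (e i) (\<Sum>j<k. c j *\<^sub>C e j) = (\<Sum>j<k. if i = j then c j else 0)"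
    unfolding cinner_sum_right cinner_scaleC_right using assms(2)
    by (intro sum.cong) (auto simp: orthonormal_basis_ofD(1)[OF assms(1)])
  then show ?thesis
    using assms(2) by simp
qed

lemma orthonormal_expansion:
  assumes "orthonormal_basis_of X k e" "x \<in> X"
  shows "x = (\<Sum>j<k. cinner (e j) x *\<^sub>C e j)"
proof -
  have "x \<in> complex_vector.span (e ` {..<k})"
    using assms by (simp add: orthonormal_basis_ofD(2))
  then show ?thesis
  proof (induction rule: complex_vector.span_induct)
    case base
    show ?case
      by (auto simp: complex_vector.subspace_def cinner_add_right cinner_scaleC_right
          scaleC_add_left sum.distrib complex_vector.scale_sum_right scaleC_scaleC)
        (metis (no_types, lifting) complex_vector.scale_scale complex_vector.scale_sum_right sum.cong)
  next
    case (step x)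
    then obtain i where i: "i < k" "x = e i"
      by auto
    have "(\<Sum>j<k. cinner (e j) x *\<^sub>C e j) = (\<Sum>j<k. if j = i then e j else 0)"
      using i by (intro sum.cong) (auto simp: orthonormal_basis_ofD(1)[OF assms(1)])
    then show ?case
      using i by simp
  qed
qed

lemma norm_orthonormal_sum:
  assumes "orthonormal_basis_of X k e"
  shows "(norm (\<Sum>j<k. c j *\<^sub>C e j))\<^sup>2 = (\<Sum>j<k. (cmod (c j))\<^sup>2)"
proof -
  have "complex_of_real ((norm (\<Sum>j<k. c j *\<^sub>C e j))\<^sup>2) = (\<Sum>i<k. cnj (c i) * c i)"
    by (simp add: cinner_self[symmetric] cinner_sum_left[of _ _ "\<Sum>j<k. c j *\<^sub>C e j"]
        cinner_scaleC_left cinner_basis_sum[OF assms] del: of_real_power)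
  also have "\<dots> = complex_of_real (\<Sum>j<k. (cmod (c j))\<^sup>2)"
    by (simp add: complex_norm_square mult.commute del: of_real_power)
  finally show ?thesis
    using of_real_eq_iff by blast
qed

lemma parseval:
  assumes "orthonormal_basis_of X k e" "x \<in> X"
  shows "(norm x)\<^sup>2 = (\<Sum>j<k. (cmod (cinner (e j) x))\<^sup>2)"
  using norm_orthonormal_sum[OF assms(1), of "\<lambda>j. cinner (e j) x"]
  by (simp flip: orthonormal_expansion[OF assms])

lemma orthonormal_basis_eqI:
  assumes "orthonormal_basis_of X k e" "x \<in> X" "y \<in> X" "\<And>j. j < k \<Longrightarrow> cinner (e j) x = cinner (e j) y"
  shows "x = y"
  using orthonormal_expansion[OF assms(1,2)] orthonormal_expansion[OF assms(1,3)] assms(4)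
  by (metis (no_types, lifting) lessThan_iff sum.cong)

text \<open>The new vector takes the last index, because in the singular value induction it carries
  the largest value and the values must ascend.\<close>

lemma orthonormal_basis_of_hyperplane_extend:
  assumes X: "complex_vector.subspace X" and v: "v \<in> X" "norm v = 1"
    and f: "orthonormal_basis_of {x \<in> X. cinner v x = 0} m f"
  shows "orthonormal_basis_of X (Suc m) (f(m := v))"
proof -
  define g where "g = f(m := v)"
  have f_mem: "f j \<in> X" "cinner v (f j) = 0" "cinner (f j) v = 0" if "j < m" for j
    using orthonormal_basis_ofD(3)[OF f that] by (auto simp: cinner_eq_0_commute)
  have vv: "cinner v v = 1"
    by (simp add: cinner_self v)
  have g_mem: "g ` {..<Suc m} \<subseteq> X"
    using f_mem v by (auto simp: g_def less_Suc_eq)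
  have "cinner (g i) (g j) = (if i = j then 1 else 0)" if "i < Suc m" "j < Suc m" for i j
    using that f_mem vv orthonormal_basis_ofD(1)[OF f] by (auto simp: g_def less_Suc_eq)
  moreover have "complex_vector.span (g ` {..<Suc m}) = X"
  proof
    show "complex_vector.span (g ` {..<Suc m}) \<subseteq> X"
      using g_mem X by (rule complex_vector.span_minimal)
    show "X \<subseteq> complex_vector.span (g ` {..<Suc m})"
    proof
      fix x assume x: "x \<in> X"
      define w where "w = x - cinner v x *\<^sub>C v"
      have w: "w \<in> {x \<in> X. cinner v x = 0}"
        using x v X by (auto simp: w_def cinner_diff_right cinner_scaleC_right vv
            complex_vector.subspace_diff complex_vector.subspace_scale)
      have "f ` {..<m} \<subseteq> g ` {..<Suc m}"
        by (force simp: g_def)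
      then have "w \<in> complex_vector.span (g ` {..<Suc m})"
        using w orthonormal_basis_ofD(2)[OF f] complex_vector.span_mono by blast
      moreover have "v \<in> g ` {..<Suc m}"
        by (force simp: g_def)
      then have "cinner v x *\<^sub>C v \<in> complex_vector.span (g ` {..<Suc m})"
        by (intro complex_vector.span_scale complex_vector.span_base)
      ultimately have "w + cinner v x *\<^sub>C v \<in> complex_vector.span (g ` {..<Suc m})"
        by (rule complex_vector.span_add)
      then show "x \<in> complex_vector.span (g ` {..<Suc m})"
        by (simp add: w_def)
    qed
  qed
  ultimately show ?thesis
    unfolding orthonormal_basis_of_def g_def by blast
qed

text \<open>Gram-Schmidt: the span of \<open>B\<close> is the hyperplane orthogonal to the
  normalized rest \<open>v\<close> of \<open>b\<close> in the larger span.\<close>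

lemma orthonormal_basis_exists:
  assumes "finite B"
  shows "\<exists>k e. orthonormal_basis_of (complex_vector.span B) k e"
  using assms
proof (induction B)
  case empty
  show ?case
    by (rule exI[of _ 0]) (simp add: orthonormal_basis_of_def)
next
  case (insert b B)
  then obtain k e where e: "orthonormal_basis_of (complex_vector.span B) k e"
    by blast
  define p where "p = (\<Sum>j<k. cinner (e j) b *\<^sub>C e j)"
  define z where "z = b - p"
  have p: "p \<in> complex_vector.span B"
    unfolding p_def by (rule sum_in_subspace[OF e])
  show ?case
  proof (cases "z = 0")
    case True
    then have "complex_vector.span (insert b B) = complex_vector.span B"
      using p by (simp add: z_def complex_vector.span_redundant)
    then show ?thesis
      using e by auto
  next
    case False
    define v where "v = complex_of_real (inverse (norm z)) *\<^sub>C z"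
    have v: "norm v = 1"
      using False by (simp add: v_def norm_scaleC norm_inverse del: of_real_inverse)
    have span: "complex_vector.span (insert b B) = {x. \<exists>c. x - c *\<^sub>C b \<in> complex_vector.span B}"
      by (rule complex_vector.span_insert)
    have z_span: "z \<in> complex_vector.span (insert b B)"
      unfolding z_def
    proof (rule complex_vector.span_diff)
      show "b \<in> complex_vector.span (insert b B)"
        by (rule complex_vector.span_base) simp
      show "p \<in> complex_vector.span (insert b B)"
        using p complex_vector.span_mono[of B "insert b B"] by auto
    qed
    have z_orth: "cinner z x = 0" if "x \<in> complex_vector.span B" for x
    proof -
      have "cinner (e i) z = 0" if "i < k" for i
        using cinner_basis_sum[OF e that] by (simp add: z_def p_def cinner_diff_right)
      then have "cinner z (e i) = 0" if "i < k" for i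
        using that cinner_eq_0_commute by blast
      then have "cinner z (\<Sum>j<k. cinner (e j) x *\<^sub>C e j) = 0"
        by (simp add: cinner_sum_right cinner_scaleC_right)
      then show ?thesis
        using orthonormal_expansion[OF e that] by simp
    qed
    have "x \<in> complex_vector.span B" if x: "x \<in> complex_vector.span (insert b B)" "cinner v x = 0" for x
    proof -
      obtain c where c: "x - c *\<^sub>C b \<in> complex_vector.span B"
        using x(1) unfolding span by blast
      have "x - c *\<^sub>C z = (x - c *\<^sub>C b) + c *\<^sub>C p"
        by (simp add: z_def complex_vector.scale_right_diff_distrib)
      then have xz: "x - c *\<^sub>C z \<in> complex_vector.span B"
        by (simp only:) (intro complex_vector.span_add complex_vector.span_scale c p)
      have "cinner z x = 0"
        using x(2) False by (simp add: v_def cinner_scaleC_left)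
      then have "c * cinner z z = 0"
        using z_orth[OF xz] by (simp add: cinner_diff_right cinner_scaleC_right)
      then have "c = 0"
        using False by (simp add: cinner_self)
      then show ?thesis
        using xz by simp
    qed
    moreover have "x \<in> complex_vector.span (insert b B)" if "x \<in> complex_vector.span B" for x
      using that complex_vector.span_mono[of B "insert b B"] by auto
    ultimately have "{x \<in> complex_vector.span (insert b B). cinner v x = 0} = complex_vector.span B"
      by (auto simp: v_def cinner_scaleC_left z_orth)
    then have "orthonormal_basis_of (complex_vector.span (insert b B)) (Suc k) (e(k := v))"
      using e v z_span
      by (intro orthonormal_basis_of_hyperplane_extend)
        (auto simp: v_def complex_vector.span_scale)
    then show ?thesis
      by blast
  qed
qed

text \<open>By Parseval both lengths equal the sum of all squared moduli of inner products between
  the two bases.\<close>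

lemma orthonormal_basis_card_unique:
  assumes e: "orthonormal_basis_of X k e" and f: "orthonormal_basis_of X m f"
  shows "k = m"
proof -
  have "real k = (\<Sum>i<k. (norm (e i))\<^sup>2)"
    by (simp add: norm_orthonormal_basis[OF e])
  also have "\<dots> = (\<Sum>i<k. \<Sum>j<m. (cmod (cinner (f j) (e i)))\<^sup>2)"
    using orthonormal_basis_ofD(3)[OF e] by (simp add: parseval[OF f])
  also have "\<dots> = (\<Sum>j<m. \<Sum>i<k. (cmod (cinner (e i) (f j)))\<^sup>2)"
    by (subst sum.swap, subst cinner_commute) simp
  also have "\<dots> = (\<Sum>j<m. (norm (f j))\<^sup>2)"
    using orthonormal_basis_ofD(3)[OF f] by (simp add: parseval[OF e])
  also have "\<dots> = real m"
    by (simp add: norm_orthonormal_basis[OF f])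
  finally show ?thesis
    by simp
qed

text \<open>The projections \<open>q (e j)\<close> span the hyperplane, which gives an orthonormal
  basis of some length \<open>m\<close>. Adding \<open>v\<close> yields a basis of \<open>X\<close>,
  and uniqueness of the length forces \<open>m = k\<close>.\<close>

lemma orthonormal_basis_of_hyperplane:
  assumes e: "orthonormal_basis_of X (Suc k) e" and v: "v \<in> X" "norm v = 1"
  obtains f where "orthonormal_basis_of {x \<in> X. cinner v x = 0} k f"
proof -
  note X = orthonormal_basis_ofD(4)[OF e]
  have vv: "cinner v v = 1"
    by (simp add: cinner_self v)
  define q where "q b = b - cinner v b *\<^sub>C v" for b
  have q_mem: "q ` e ` {..<Suc k} \<subseteq> {x \<in> X. cinner v x = 0}"
    using orthonormal_basis_ofD(3)[OF e] v X
    by (auto simp: q_def cinner_diff_right cinner_scaleC_right vv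
            complex_vector.subspace_diff complex_vector.subspace_scale)
  have "complex_vector.span (q ` e ` {..<Suc k}) = {x \<in> X. cinner v x = 0}"
  proof
    have "complex_vector.subspace {x \<in> X. cinner v x = 0}"
      using X by (auto simp: complex_vector.subspace_def cinner_add_right cinner_scaleC_right)
    with q_mem show "complex_vector.span (q ` e ` {..<Suc k}) \<subseteq> {x \<in> X. cinner v x = 0}"
      by (rule complex_vector.span_minimal)
    show "{x \<in> X. cinner v x = 0} \<subseteq> complex_vector.span (q ` e ` {..<Suc k})"
    proof
      fix x assume x: "x \<in> {x \<in> X. cinner v x = 0}"
      define c where "c j = cinner (e j) x" for j
      have xe: "x = (\<Sum>j<Suc k. c j *\<^sub>C e j)"
        using orthonormal_expansion[OF e] x unfolding c_def by blast
      have "(\<Sum>j<Suc k. c j *\<^sub>C q (e j)) = x - cinner v x *\<^sub>C v"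
        unfolding q_def xe
        by (simp add: complex_vector.scale_right_diff_distrib sum_subtractf cinner_sum_right
            cinner_scaleC_right complex_vector.scale_sum_left cinner_add_right scaleC_add_left
            scaleC_scaleC del: sum.lessThan_Suc)
      also have "\<dots> = x"
        using x by simp
      finally have "x = (\<Sum>j<Suc k. c j *\<^sub>C q (e j))" ..
      also have "\<dots> \<in> complex_vector.span (q ` e ` {..<Suc k})"
        by (intro complex_vector.span_sum complex_vector.span_scale complex_vector.span_base) auto
      finally show "x \<in> complex_vector.span (q ` e ` {..<Suc k})" .
    qed
  qed
  then obtain m f where f: "orthonormal_basis_of {x \<in> X. cinner v x = 0} m f"
    using orthonormal_basis_exists[of "q ` e ` {..<Suc k}"] by auto
  have "Suc m = Suc k"
    using orthonormal_basis_card_unique[OF orthonormal_basis_of_hyperplane_extend[OF X v f] e] .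
  then show thesis
    using f that by blast
qed

text \<open>Closed bounded subsets of the ambient space need not be compact, so compactness is drawn
  from the finitely many coordinates: the sphere is a closed part of the image \<open>C k\<close> of
  a polydisc.\<close>

lemma compact_unit_sphere:
  assumes e: "orthonormal_basis_of X k e"
  shows "compact {x \<in> X. norm x = 1}"
proof -
  define C where "C m = {\<Sum>j<m. c j *\<^sub>C e j | c. \<forall>j<m. cmod (c j) \<le> 1}" for m :: nat
  have "compact (C m)" for m
  proof (induction m)
    case 0
    show ?case
      by (simp add: C_def)
  next
    case (Suc m)
    have "C (Suc m) = (\<lambda>(x, a). x + a *\<^sub>C e m) ` (C m \<times> cball 0 1)"
    proof (intro equalityI subsetI)
      fix x assume "x \<in> C (Suc m)"
      then obtain c where "\<forall>j<Suc m. cmod (c j) \<le> 1" "x = (\<Sum>j<m. c j *\<^sub>C e j) + c m *\<^sub>C e m"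
        by (auto simp: C_def)
      then show "x \<in> (\<lambda>(x, a). x + a *\<^sub>C e m) ` (C m \<times> cball 0 1)"
        by (force simp: C_def)
    next
      fix x assume "x \<in> (\<lambda>(x, a). x + a *\<^sub>C e m) ` (C m \<times> cball 0 1)"
      then obtain c a where c: "\<forall>j<m. cmod (c j) \<le> 1" "cmod a \<le> 1"
        "x = (\<Sum>j<m. c j *\<^sub>C e j) + a *\<^sub>C e m"
        by (auto simp: C_def)
      have "x = (\<Sum>j<Suc m. (c(m := a)) j *\<^sub>C e j)" "\<forall>j<Suc m. cmod ((c(m := a)) j) \<le> 1"
        using c by (auto simp: less_Suc_eq)
      then show "x \<in> C (Suc m)"
        unfolding C_def by blast
    qed
    moreover have "continuous_on (C m \<times> cball 0 1) (\<lambda>(x, a). x + a *\<^sub>C e m)"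
      unfolding case_prod_beta
      by (intro continuous_intros continuous_on_scaleC)
    ultimately show ?case
      using Suc by (simp add: compact_continuous_image compact_Times)
  qed
  moreover have "{x \<in> X. norm x = 1} = C k \<inter> {x. norm x = 1}"
  proof (intro equalityI subsetI)
    fix x assume x: "x \<in> {x \<in> X. norm x = 1}"
    have coeff: "cmod (cinner (e j) x) \<le> 1" if "j < k" for j
      using norm_cinner_le[of "e j" x] norm_orthonormal_basis[OF e that] x by simp
    have expansion: "x = (\<Sum>j<k. cinner (e j) x *\<^sub>C e j)"
      using x by (intro orthonormal_expansion[OF e]) simp
    have "x \<in> C k"
      unfolding C_def mem_Collect_eq
      by (intro exI[of _ "\<lambda>j. cinner (e j) x"] conjI expansion allI impI coeff)
    then show "x \<in> C k \<inter> {x. norm x = 1}"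
      using x by simp
  next
    fix x assume "x \<in> C k \<inter> {x. norm x = 1}"
    then show "x \<in> {x \<in> X. norm x = 1}"
      using sum_in_subspace[OF e] by (auto simp: C_def)
  qed
  moreover have "closed {x::'a. norm x = 1}"
    by (intro closed_Collect_eq continuous_intros)
  ultimately show ?thesis
    by (simp add: compact_Int_closed)
qed

section \<open>Singular value decomposition\<close>

lemma linear_on_sum:
  fixes k :: nat
  assumes X: "complex_vector.subspace X"
    and add: "\<And>x y. x \<in> X \<Longrightarrow> y \<in> X \<Longrightarrow> S (x + y) = S x + S y"
    and scale: "\<And>c x. x \<in> X \<Longrightarrow> S (c *\<^sub>C x) = c *\<^sub>C S x"
    and e: "\<And>j. j < k \<Longrightarrow> e j \<in> X"
  shows "S (\<Sum>j<k. c j *\<^sub>C e j) = (\<Sum>j<k. c j *\<^sub>C S (e j) :: 'a::complex_hilbert)"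
proof (insert e, induction k)
  case 0
  show ?case
    using scale[of 0 0] complex_vector.subspace_0[OF X] by simp
next
  case (Suc k)
  have "(\<Sum>j<k. c j *\<^sub>C e j) \<in> X"
    using Suc.prems X by (intro complex_vector.subspace_sum complex_vector.subspace_scale) auto
  then show ?case
    using Suc complex_vector.subspace_scale[OF X] by (simp add: add scale)
qed

text \<open>The induction peels off a unit vector \<open>v\<close> at which \<open>\<lambda>x. norm (S x)\<close> is maximal: by
  maximality \<open>S\<close> maps the orthogonal complement of \<open>v\<close> into that of \<open>S v\<close>.\<close>

lemma singular_vectors_exist:
  fixes S :: "'a::complex_hilbert \<Rightarrow> 'a"
  assumes "orthonormal_basis_of X k e" "orthonormal_basis_of Y k f"
    and "\<And>x. x \<in> X \<Longrightarrow> S x \<in> Y"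
    and "\<And>x y. x \<in> X \<Longrightarrow> y \<in> X \<Longrightarrow> S (x + y) = S x + S y"
    and "\<And>c x. x \<in> X \<Longrightarrow> S (c *\<^sub>C x) = c *\<^sub>C S x"
  shows "\<exists>v u l. orthonormal_basis_of X k v \<and> orthonormal_basis_of Y k u \<and>
    (\<forall>j<k. 0 \<le> l j) \<and> (\<forall>i j. i \<le> j \<and> j < k \<longrightarrow> l i \<le> l j) \<and>
    (\<forall>j<k. S (v j) = complex_of_real (l j) *\<^sub>C u j)"
  using assms
proof (induction k arbitrary: X Y e f)
  case 0
  then show ?case
    by auto
next
  case (Suc k)
  note e = Suc.prems(1) and f = Suc.prems(2) and S = Suc.prems(3-5)
  note X = orthonormal_basis_ofD(4)[OF e] and Y = orthonormal_basis_ofD(4)[OF f]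
  have "continuous_on {x \<in> X. norm x = 1} (\<lambda>x. norm (S x))"
  proof -
    have "S x = (\<Sum>j<Suc k. cinner (e j) x *\<^sub>C S (e j))" if "x \<in> X" for x
    proof -
      have "S (\<Sum>j<Suc k. cinner (e j) x *\<^sub>C e j) = (\<Sum>j<Suc k. cinner (e j) x *\<^sub>C S (e j))"
        by (rule linear_on_sum[OF X]) (use S orthonormal_basis_ofD(3)[OF e] in auto)
      then show ?thesis
        by (simp only: orthonormal_expansion[OF e that, symmetric])
    qed
    then have "continuous_on {x \<in> X. norm x = 1} (\<lambda>x. norm (S x)) \<longleftrightarrow>
        continuous_on {x \<in> X. norm x = 1} (\<lambda>x. norm (\<Sum>j<Suc k. cinner (e j) x *\<^sub>C S (e j)))"
      by (intro continuous_on_cong) auto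
    then show ?thesis
      by (simp only:) (intro continuous_intros continuous_on_scaleC continuous_on_cinner)
  qed
  moreover have "e 0 \<in> {x \<in> X. norm x = 1}"
    using orthonormal_basis_ofD(3)[OF e] norm_orthonormal_basis[OF e] by auto
  ultimately obtain v where v: "v \<in> X" "norm v = 1"
    and max: "\<And>x. x \<in> X \<Longrightarrow> norm x = 1 \<Longrightarrow> norm (S x) \<le> norm (S v)"
    using continuous_attains_sup[OF compact_unit_sphere[OF e], of "\<lambda>x. norm (S x)"] by auto
  define s where "s = norm (S v)"
  have S0: "S 0 = 0"
    using S(3)[of 0 0] complex_vector.subspace_0[OF X] by simp
  have bound: "norm (S x) \<le> s * norm x" if "x \<in> X" for x
  proof (cases "x = 0")
    case False
    have "norm (S (complex_of_real (inverse (norm x)) *\<^sub>C x)) \<le> s"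
      unfolding s_def using False that X
      by (intro max) (auto simp: norm_scaleC norm_inverse complex_vector.subspace_scale)
    then show ?thesis
      using False that
      by (simp add: S(3) norm_scaleC norm_inverse del: of_real_inverse) (simp add: field_simps)
  qed (simp add: S0)
  \<comment> \<open>If \<open>s = 0\<close>, every unit vector of \<open>Y\<close> will do;
    \<open>f 0\<close> exists because the dimension is \<open>Suc k\<close>.\<close>
  define u where "u = (if s = 0 then f 0 else complex_of_real (inverse s) *\<^sub>C S v)"
  have u: "u \<in> Y" "norm u = 1"
    using orthonormal_basis_ofD(3)[OF f] norm_orthonormal_basis[OF f] S(1)[OF v(1)] Y
    by (auto simp: u_def s_def norm_scaleC norm_inverse complex_vector.subspace_scale)
  have Sv: "S v = complex_of_real s *\<^sub>C u"
    by (auto simp: u_def scaleC_scaleC) (simp add: s_def)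
  have orth: "cinner u (S w) = 0" if w: "w \<in> X" "cinner v w = 0" for w
  proof (rule ccontr)
    assume "cinner u (S w) \<noteq> 0"
    moreover from this have "s \<noteq> 0"
      using bound[OF w(1)] by auto
    ultimately have a: "cinner (S v) (S w) \<noteq> 0"
      by (simp add: Sv cinner_scaleC_left)
    define a where "a = cinner (S v) (S w)"
    \<comment> \<open>Moving from \<open>v\<close> in the direction \<open>w\<close> with
      coefficient \<open>t\<close> raises the squared norm of the image by at least
      \<open>2 * r * (cmod a)\<^sup>2\<close>. Maximality allows at most
      \<open>r * (cmod a)\<^sup>2\<close> once
      \<open>r * s\<^sup>2 * (norm w)\<^sup>2 \<le> 1\<close>, which fixes the size of
      \<open>r\<close>.\<close>
    define r where "r = inverse (s\<^sup>2 * (norm w)\<^sup>2 + 1)"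
    define t where "t = complex_of_real r * cnj a"
    have r: "r > 0" "r * (s\<^sup>2 * (norm w)\<^sup>2 + 1) = 1"
      unfolding r_def by (auto simp: add_nonneg_pos intro!: right_inverse left_inverse) 
        (smt (verit) mult_nonneg_nonneg zero_le_power2)
    have "(norm (S (v + t *\<^sub>C w)))\<^sup>2 \<le> (s * norm (v + t *\<^sub>C w))\<^sup>2"
      using X v w by (intro power_mono bound) (auto intro!: complex_vector.subspace_add complex_vector.subspace_scale)
    moreover have "S (v + t *\<^sub>C w) = S v + t *\<^sub>C S w"
      using X v w by (simp add: S complex_vector.subspace_scale)
    moreover have "(norm (v + t *\<^sub>C w))\<^sup>2 = 1 + (cmod t)\<^sup>2 * (norm w)\<^sup>2"
      using pythagoras[of v "t *\<^sub>C w"] w v by (simp add: cinner_scaleC_right norm_scaleC power_mult_distrib)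
    moreover have "(norm (S v + t *\<^sub>C S w))\<^sup>2 = s\<^sup>2 + 2 * Re (t * a) + (cmod t)\<^sup>2 * (norm (S w))\<^sup>2"
      by (simp add: norm_add_squared cinner_scaleC_right norm_scaleC power_mult_distrib a_def s_def)
    moreover have "t * a = complex_of_real (r * (cmod a)\<^sup>2)"
      by (simp add: t_def complex_norm_square mult_ac del: of_real_power)
    then have "Re (t * a) = r * (cmod a)\<^sup>2"
      by (simp only: Re_complex_of_real)
    moreover have "(cmod t)\<^sup>2 = r * (r * (cmod a)\<^sup>2)"
      using r by (simp add: t_def norm_mult power_mult_distrib power2_eq_square)
    ultimately have "2 * (r * (cmod a)\<^sup>2) + r * (r * (cmod a)\<^sup>2) * (norm (S w))\<^sup>2
        \<le> (r * (cmod a)\<^sup>2) * (r * (s\<^sup>2 * (norm w)\<^sup>2))"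
      by (simp add: power_mult_distrib algebra_simps)
    also have "r * (s\<^sup>2 * (norm w)\<^sup>2) \<le> 1"
      using r by (simp add: distrib_left)
    finally have "2 * (r * (cmod a)\<^sup>2) + r * (r * (cmod a)\<^sup>2) * (norm (S w))\<^sup>2 \<le> r * (cmod a)\<^sup>2"
      using r by (simp add: mult_left_mono)
    moreover have "0 \<le> r * (r * (cmod a)\<^sup>2) * (norm (S w))\<^sup>2"
      using r by simp
    moreover have "r * (cmod a)\<^sup>2 > 0"
      using r a by (simp add: a_def)
    ultimately show False
      by linarith
  qed
  obtain e' where e': "orthonormal_basis_of {x \<in> X. cinner v x = 0} k e'"
    using orthonormal_basis_of_hyperplane[OF e v] .
  obtain f' where f': "orthonormal_basis_of {y \<in> Y. cinner u y = 0} k f'"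
    using orthonormal_basis_of_hyperplane[OF f u] .
  \<comment> \<open>The complements of \<open>v\<close> and \<open>u\<close> differ in general,
    which is why the induction runs over two spaces with bases of equal length.\<close>
  have "\<exists>v' u' l. orthonormal_basis_of {x \<in> X. cinner v x = 0} k v' \<and>
      orthonormal_basis_of {y \<in> Y. cinner u y = 0} k u' \<and>
      (\<forall>j<k. 0 \<le> l j) \<and> (\<forall>i j. i \<le> j \<and> j < k \<longrightarrow> l i \<le> l j) \<and>
      (\<forall>j<k. S (v' j) = complex_of_real (l j) *\<^sub>C u' j)"
    by (rule Suc.IH[OF e' f']) (use S orth in auto)
  then obtain v' u' l where H: "orthonormal_basis_of {x \<in> X. cinner v x = 0} k v' \<and>
      orthonormal_basis_of {y \<in> Y. cinner u y = 0} k u' \<and>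
      (\<forall>j<k. 0 \<le> l j) \<and> (\<forall>i j. i \<le> j \<and> j < k \<longrightarrow> l i \<le> l j) \<and>
      (\<forall>j<k. S (v' j) = complex_of_real (l j) *\<^sub>C u' j)"
    by blast
  then have v': "orthonormal_basis_of {x \<in> X. cinner v x = 0} k v'"
    and u': "orthonormal_basis_of {y \<in> Y. cinner u y = 0} k u'"
    and l: "\<And>j. j < k \<Longrightarrow> 0 \<le> l j" "\<And>i j. i \<le> j \<Longrightarrow> j < k \<Longrightarrow> l i \<le> l j"
      "\<And>j. j < k \<Longrightarrow> S (v' j) = complex_of_real (l j) *\<^sub>C u' j"
    by simp_all
  have l_le: "l j \<le> s" if "j < k" for j
  proof -
    have "norm (S (v' j)) \<le> s"
      using bound[of "v' j"] orthonormal_basis_ofD(3)[OF v' that] norm_orthonormal_basis[OF v' that]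
      by simp
    then show ?thesis
      using l(1,3)[OF that] norm_orthonormal_basis[OF u' that] by (simp add: norm_scaleC)
  qed
  have "0 \<le> s"
    by (simp add: s_def)
  then have "\<forall>j<Suc k. 0 \<le> (l(k := s)) j" "\<forall>i j. i \<le> j \<and> j < Suc k \<longrightarrow> (l(k := s)) i \<le> (l(k := s)) j"
    "\<forall>j<Suc k. S ((v'(k := v)) j) = complex_of_real ((l(k := s)) j) *\<^sub>C (u'(k := u)) j"
    using l l_le Sv by (auto simp: less_Suc_eq)
  then show ?case
    using orthonormal_basis_of_hyperplane_extend[OF X v v']
      orthonormal_basis_of_hyperplane_extend[OF Y u u'] by blast
qed

text \<open>Sign and order of \<open>l\<close> are left open, so that one pair of bases serves an
  operator, its truncation and their difference, and with \<open>v\<close> and \<open>u\<close>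
  exchanged also the adjoint and the Moore-Penrose inverse.\<close>

definition singular_system ::
  "'a::complex_hilbert set \<Rightarrow> nat \<Rightarrow> (nat \<Rightarrow> 'a) \<Rightarrow> (nat \<Rightarrow> 'a) \<Rightarrow> (nat \<Rightarrow> real) \<Rightarrow> ('a \<Rightarrow> 'a) \<Rightarrow> bool" where
  "singular_system X k v u l S \<longleftrightarrow>
     orthonormal_basis_of X k v \<and> orthonormal_basis_of X k u \<and>
     (\<forall>x\<in>X. S x = (\<Sum>j<k. (complex_of_real (l j) * cinner (v j) x) *\<^sub>C u j))"

lemma singular_systemD:
  assumes "singular_system X k v u l S"
  shows "orthonormal_basis_of X k v" "orthonormal_basis_of X k u" "complex_vector.subspace X"
    "x \<in> X \<Longrightarrow> S x = (\<Sum>j<k. (complex_of_real (l j) * cinner (v j) x) *\<^sub>C u j)"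
    "x \<in> X \<Longrightarrow> S x \<in> X"
  using assms sum_in_subspace[of X k u] orthonormal_basis_ofD(4)[of X k u]
  unfolding singular_system_def by auto

lemma singular_system_coeff:
  assumes "singular_system X k v u l S" "x \<in> X" "j < k"
  shows "cinner (u j) (S x) = complex_of_real (l j) * cinner (v j) x"
  by (simp only: singular_systemD(4)[OF assms(1,2)] cinner_basis_sum[OF singular_systemD(2)[OF assms(1)] assms(3)])

lemma singular_systemI:
  assumes v: "orthonormal_basis_of X k v" and u: "orthonormal_basis_of X k u"
    and "\<And>x. x \<in> X \<Longrightarrow> S x \<in> X"
    and "\<And>x j. x \<in> X \<Longrightarrow> j < k \<Longrightarrow> cinner (u j) (S x) = complex_of_real (l j) * cinner (v j) x"
  shows "singular_system X k v u l S"
proof -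
  have "S x = (\<Sum>j<k. (complex_of_real (l j) * cinner (v j) x) *\<^sub>C u j)" if "x \<in> X" for x
    using assms(3,4)[OF that]
    by (intro orthonormal_basis_eqI[OF u] sum_in_subspace[OF u]) (auto simp: cinner_basis_sum[OF u])
  then show ?thesis
    using v u by (simp add: singular_system_def)
qed

lemma singular_system_vector:
  assumes S: "singular_system X k v u l S" and j: "j < k"
  shows "S (v j) = complex_of_real (l j) *\<^sub>C u j"
proof -
  note v = singular_systemD(1)[OF S] and u = singular_systemD(2)[OF S]
  show ?thesis
    using orthonormal_basis_ofD(3)[OF v j] orthonormal_basis_ofD(3)[OF u j] j
    by (intro orthonormal_basis_eqI[OF u] singular_systemD(5)[OF S])
      (auto simp: complex_vector.subspace_scale[OF singular_systemD(3)[OF S]] singular_system_coeff[OF S]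
        cinner_scaleC_right orthonormal_basis_ofD(1)[OF v] orthonormal_basis_ofD(1)[OF u])
qed

lemma singular_system_diff:
  assumes S: "singular_system X k v u l S" and R: "singular_system X k v u m R"
  shows "singular_system X k v u (\<lambda>j. l j - m j) (\<lambda>x. S x - R x)"
  by (intro singular_systemI singular_systemD(1,2)[OF S])
    (simp_all add: singular_system_coeff[OF S] singular_system_coeff[OF R] singular_systemD(5)[OF S]
      singular_systemD(5)[OF R] singular_systemD(3)[OF S] complex_vector.subspace_diff
      cinner_diff_right left_diff_distrib)

lemma singular_system_norm:
  assumes "singular_system X k v u l S" "x \<in> X"
  shows "(norm (S x))\<^sup>2 = (\<Sum>j<k. (l j)\<^sup>2 * (cmod (cinner (v j) x))\<^sup>2)"
  using parseval[OF singular_systemD(2)[OF assms(1)] singular_systemD(5)[OF assms]]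
  by (simp add: singular_system_coeff[OF assms] norm_mult power_mult_distrib)

lemma singular_system_norm_le:
  assumes S: "singular_system X k v u l S" "x \<in> X" and M: "\<And>j. j < k \<Longrightarrow> \<bar>l j\<bar> \<le> M" "0 \<le> M"
  shows "norm (S x) \<le> M * norm x"
proof (rule power2_le_imp_le)
  have "(norm (S x))\<^sup>2 \<le> (\<Sum>j<k. M\<^sup>2 * (cmod (cinner (v j) x))\<^sup>2)"
    unfolding singular_system_norm[OF S]
    using M by (intro sum_mono mult_right_mono) (auto simp: abs_le_square_iff[symmetric])
  also have "\<dots> = (M * norm x)\<^sup>2"
    by (simp add: parseval[OF singular_systemD(1)[OF S(1)] S(2)] sum_distrib_left power_mult_distrib)
  finally show "(norm (S x))\<^sup>2 \<le> (M * norm x)\<^sup>2" .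
qed (use M in simp)

text \<open>Only the indices that occur in \<open>x\<close> are constrained, so that vanishing
  values do no harm to vectors orthogonal to the kernel.\<close>

lemma singular_system_norm_ge:
  assumes S: "singular_system X k v u l S" "x \<in> X" and e: "0 \<le> e"
    and l: "\<And>j. j < k \<Longrightarrow> cinner (v j) x \<noteq> 0 \<Longrightarrow> e \<le> l j"
  shows "e * norm x \<le> norm (S x)"
proof (rule power2_le_imp_le)
  have "(e * norm x)\<^sup>2 = (\<Sum>j<k. e\<^sup>2 * (cmod (cinner (v j) x))\<^sup>2)"
    by (simp add: parseval[OF singular_systemD(1)[OF S(1)] S(2)] sum_distrib_left power_mult_distrib)
  also have "\<dots> \<le> (norm (S x))\<^sup>2"
    unfolding singular_system_norm[OF S]
  proof (rule sum_mono)
    fix j assume "j \<in> {..<k}"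
    then show "e\<^sup>2 * (cmod (cinner (v j) x))\<^sup>2 \<le> (l j)\<^sup>2 * (cmod (cinner (v j) x))\<^sup>2"
      using l[of j] e by (cases "cinner (v j) x = 0") (auto intro!: mult_right_mono power_mono)
  qed
  finally show "(e * norm x)\<^sup>2 \<le> (norm (S x))\<^sup>2" .
qed simp

lemma singular_system_bounded_op_on:
  assumes S: "singular_system X k v u l S"
  shows "bounded_op_on X S"
proof -
  note u = singular_systemD(2)[OF S] and X = singular_systemD(3)[OF S] and mem = singular_systemD(5)[OF S]
  have add: "S (x + y) = S x + S y" if "x \<in> X" "y \<in> X" for x y
    using that X
    by (intro orthonormal_basis_eqI[OF u])
      (auto simp: mem complex_vector.subspace_add singular_system_coeff[OF S] cinner_add_right distrib_left)
  have scale: "S (c *\<^sub>C x) = c *\<^sub>C S x" if "x \<in> X" for c x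
    using that X
    by (intro orthonormal_basis_eqI[OF u])
      (auto simp: mem complex_vector.subspace_scale singular_system_coeff[OF S] cinner_scaleC_right)
  define M where "M = (\<Sum>j<k. \<bar>l j\<bar>)"
  have "\<bar>l j\<bar> \<le> M" if "j < k" for j
    using that unfolding M_def by (intro member_le_sum) auto
  then have "norm (S x) \<le> M * norm x" if "x \<in> X" for x
    using that by (intro singular_system_norm_le[OF S]) (auto simp: M_def sum_nonneg)
  then show ?thesis
    unfolding bounded_op_on_def using mem add scale by (auto simp: mult.commute)
qed

lemma singular_system_adjoint:
  assumes "singular_system X k v u l S" "is_adjoint_on X S S'"
  shows "singular_system X k u v l S'"
proof (rule singular_systemI)
  note v = singular_systemD(1)[OF assms(1)] and u = singular_systemD(2)[OF assms(1)]
  show "orthonormal_basis_of X k u" "orthonormal_basis_of X k v"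
    by (rule v u)+
  fix y assume y: "y \<in> X"
  then show "S' y \<in> X"
    using assms(2) by (simp add: is_adjoint_on_def)
  fix j assume j: "j < k"
  note vj = orthonormal_basis_ofD(3)[OF v j]
  have "S (v j) = complex_of_real (l j) *\<^sub>C u j"
    by (rule singular_system_vector[OF assms(1) j])
  moreover have "cinner (v j) (S' y) = cinner (S (v j)) y"
    using assms(2) vj y by (simp add: is_adjoint_on_def)
  ultimately show "cinner (v j) (S' y) = complex_of_real (l j) * cinner (u j) y"
    by (simp add: cinner_scaleC_left)
qed

lemma singular_system_is_adjoint:
  assumes S: "singular_system X k v u l S" and S': "singular_system X k u v l S'"
  shows "is_adjoint_on X S S'"
proof -
  have "cinner (S x) y = cinner x (S' y)" if "x \<in> X" "y \<in> X" for x y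
  proof -
    have "cinner (S x) y = (\<Sum>j<k. cnj (complex_of_real (l j) * cinner (v j) x) * cinner (u j) y)"
      by (subst singular_systemD(4)[OF S that(1)]) (simp add: cinner_sum_left cinner_scaleC_left)
    also have "\<dots> = (\<Sum>j<k. (complex_of_real (l j) * cinner (u j) y) * cinner x (v j))"
      by (intro sum.cong refl) (subst (3) cinner_commute, simp add: mult_ac)
    also have "\<dots> = cinner x (S' y)"
      by (subst singular_systemD(4)[OF S' that(2)]) (simp add: cinner_sum_right cinner_scaleC_right)
    finally show ?thesis .
  qed
  then show ?thesis
    unfolding is_adjoint_on_def using singular_systemD(5)[OF S'] by blast
qed

lemma singular_system_comp:
  assumes S: "singular_system X k v u l S" and R: "singular_system X k u w m R"
  shows "singular_system X k v w (\<lambda>j. m j * l j) (\<lambda>x. R (S x))"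
  by (intro singular_systemI singular_systemD(1)[OF S] singular_systemD(2)[OF R])
    (simp_all add: singular_system_coeff[OF S] singular_system_coeff[OF R]
      singular_systemD(5)[OF S] singular_systemD(5)[OF R])

lemma singular_system_eq:
  assumes S: "singular_system X k v u l S" and R: "singular_system X k v u m R"
    and "\<And>j. j < k \<Longrightarrow> l j = m j" "x \<in> X"
  shows "S x = R x"
  using assms(3,4)
  by (simp add: singular_systemD(4)[OF S] singular_systemD(4)[OF R])

lemma singular_system_diag:
  assumes "orthonormal_basis_of X k v" "orthonormal_basis_of X k u"
  shows "singular_system X k v u l (\<lambda>x. \<Sum>j<k. (complex_of_real (l j) * cinner (v j) x) *\<^sub>C u j)"
  using assms by (simp add: singular_system_def)

lemma singular_system_id:
  assumes "orthonormal_basis_of X k u"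
  shows "singular_system X k u u (\<lambda>j. 1) (\<lambda>x. x)"
  by (rule singular_systemI[OF assms assms]) auto

lemma singular_system_exists:
  assumes e: "orthonormal_basis_of X k e" and S: "bounded_op_on X S"
  obtains v u l where "singular_system X k v u l S" "\<And>j. j < k \<Longrightarrow> 0 \<le> l j"
    "\<And>i j. i \<le> j \<Longrightarrow> j < k \<Longrightarrow> l i \<le> l j"
proof -
  note X = orthonormal_basis_ofD(4)[OF e]
  have "\<exists>v u l. orthonormal_basis_of X k v \<and> orthonormal_basis_of X k u \<and>
    (\<forall>j<k. 0 \<le> l j) \<and> (\<forall>i j. i \<le> j \<and> j < k \<longrightarrow> l i \<le> l j) \<and>
    (\<forall>j<k. S (v j) = complex_of_real (l j) *\<^sub>C u j)"
    by (rule singular_vectors_exist[OF e e]) (use bounded_op_onD[OF S] in auto)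
  then obtain v u l where H: "orthonormal_basis_of X k v \<and> orthonormal_basis_of X k u \<and>
    (\<forall>j<k. 0 \<le> l j) \<and> (\<forall>i j. i \<le> j \<and> j < k \<longrightarrow> l i \<le> l j) \<and>
    (\<forall>j<k. S (v j) = complex_of_real (l j) *\<^sub>C u j)"
    by blast
  then have v: "orthonormal_basis_of X k v"
    by simp
  have "S x = (\<Sum>j<k. (complex_of_real (l j) * cinner (v j) x) *\<^sub>C u j)" if "x \<in> X" for x
  proof -
    have "S x = S (\<Sum>j<k. cinner (v j) x *\<^sub>C v j)"
      using orthonormal_expansion[OF v that] by simp
    also have "\<dots> = (\<Sum>j<k. cinner (v j) x *\<^sub>C S (v j))"
      by (rule linear_on_sum[OF X]) (use bounded_op_onD[OF S] orthonormal_basis_ofD(3)[OF v] in auto)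
    also have "\<dots> = (\<Sum>j<k. (complex_of_real (l j) * cinner (v j) x) *\<^sub>C u j)"
      using H by (intro sum.cong) (auto simp: scaleC_scaleC mult.commute)
    finally show ?thesis .
  qed
  then have "singular_system X k v u l S"
    using H by (simp add: singular_system_def)
  then show thesis
    by (rule that) (use H in auto)
qed

text \<open>A lower bound for \<open>S\<close> alone suffices, without one for the adjoint: it
  excludes the singular value \<open>0\<close>, and the remaining diagonal is inverted
  entrywise.\<close>

lemma invertible_on_if_bounded_below:
  assumes e: "orthonormal_basis_of X k e" and S: "bounded_op_on X S"
    and c: "c > 0" "\<And>x. x \<in> X \<Longrightarrow> c * norm x \<le> norm (S x)"
  shows "invertible_on X S"
proof -
  obtain v u l where sys: "singular_system X k v u l S" and l: "\<And>j. j < k \<Longrightarrow> 0 \<le> l j"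
    using singular_system_exists[OF e S] by metis
  note v = singular_systemD(1)[OF sys] and u = singular_systemD(2)[OF sys]
  have l_nz: "l j \<noteq> 0" if j: "j < k" for j
  proof
    assume "l j = 0"
    then have "S (v j) = 0"
      using j by (simp add: singular_system_vector[OF sys])
    then show False
      using c(2)[OF orthonormal_basis_ofD(3)[OF v j]] c(1) norm_orthonormal_basis[OF v j] by simp
  qed
  define B where "B x = (\<Sum>j<k. (complex_of_real (inverse (l j)) * cinner (u j) x) *\<^sub>C v j)" for x
  have B: "singular_system X k u v (\<lambda>j. inverse (l j)) B"
    unfolding B_def by (rule singular_system_diag[OF u v])
  have "S (B x) = x" "B (S x) = x" if "x \<in> X" for x
    using singular_system_eq[OF singular_system_comp[OF B sys] singular_system_id[OF u] _ that]
      singular_system_eq[OF singular_system_comp[OF sys B] singular_system_id[OF v] _ that] l_nz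
    by auto
  then show ?thesis
    unfolding invertible_on_def using singular_system_bounded_op_on[OF B] by blast
qed

section \<open>Regularization and Moore-Penrose inverses in finite dimension\<close>

lemma unitary_singular_system:
  assumes v: "orthonormal_basis_of X k v" and u: "orthonormal_basis_of X k u"
    and V: "singular_system X k v u (\<lambda>j. 1) V"
  shows "unitary_on X V"
proof -
  define W where "W x = (\<Sum>j<k. (complex_of_real 1 * cinner (u j) x) *\<^sub>C v j)" for x
  have W: "singular_system X k u v (\<lambda>j. 1) W"
    unfolding W_def by (rule singular_system_diag[OF u v])
  have "V (W x) = x" "W (V x) = x" if "x \<in> X" for x
    using singular_system_eq[OF singular_system_comp[OF W V] singular_system_id[OF u] _ that]
      singular_system_eq[OF singular_system_comp[OF V W] singular_system_id[OF v] _ that] by auto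
  then show ?thesis
    unfolding unitary_on_def
    using singular_system_bounded_op_on[OF V] singular_system_is_adjoint[OF V W] by blast
qed

text \<open>To fit two orthonormal bases into the format with a single one, \<open>u\<close> is
  taken as the basis, the left unitary is the identity, and the right unitary sends
  \<open>v j\<close> to \<open>u j\<close>.\<close>

lemma regularization_exists:
  assumes e: "orthonormal_basis_of X k e" and S: "bounded_op_on X S"
  shows "\<exists>R. is_regularization_on X \<epsilon> S R"
proof -
  obtain v u l where sys: "singular_system X k v u l S" and l: "\<And>j. j < k \<Longrightarrow> 0 \<le> l j"
    "\<And>i j. i \<le> j \<Longrightarrow> j < k \<Longrightarrow> l i \<le> l j"
    using singular_system_exists[OF e S] by metis
  note v = singular_systemD(1)[OF sys] and u = singular_systemD(2)[OF sys]
  define V where "V x = (\<Sum>j<k. (complex_of_real 1 * cinner (v j) x) *\<^sub>C u j)" for x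
  have V: "singular_system X k v u (\<lambda>j. 1) V"
    unfolding V_def by (rule singular_system_diag[OF v u])
  have "diag_op k u l (V x) = S x" if "x \<in> X" for x
    using that
    by (auto simp: diag_op_def singular_systemD(4)[OF sys] singular_system_coeff[OF V] intro!: sum.cong)
  then have "is_svd_on X S k u (\<lambda>x. x) l V"
    unfolding is_svd_on_def
    using u l unitary_singular_system[OF v u V] unitary_singular_system[OF u u singular_system_id[OF u]]
    by auto
  then have "is_regularization_on X \<epsilon> S (\<lambda>x. diag_op k u (\<lambda>j. if l j \<le> \<epsilon> then 0 else l j) (V x))"
    unfolding is_regularization_on_def by (intro exI conjI) (assumption, simp)
  then show ?thesis
    by blast
qed

text \<open>\<open>regularization_on\<close> rests on an arbitrary choice of decomposition, so an
  arbitrary one has to be read as a singular system: the left vectors are the images of the basis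
  under \<open>U\<close>, the right ones those under the adjoint of \<open>V\<close>.\<close>

lemma regularization_singular_system:
  assumes "is_regularization_on X \<epsilon> S R"
  obtains k v u l where "singular_system X k v u l S" "\<And>j. j < k \<Longrightarrow> 0 \<le> l j"
    "singular_system X k v u (\<lambda>j. if l j \<le> \<epsilon> then 0 else l j) R"
proof -
  obtain k e U l V where svd: "is_svd_on X S k e U l V"
    and R: "\<And>x. x \<in> X \<Longrightarrow> R x = U (diag_op k e (\<lambda>j. if l j \<le> \<epsilon> then 0 else l j) (V x))"
    using assms unfolding is_regularization_on_def by blast
  from svd have e: "orthonormal_basis_of X k e" and U: "bounded_op_on X U" and V: "bounded_op_on X V"
    and l: "\<And>j. j < k \<Longrightarrow> 0 \<le> l j"
    and S: "\<And>x. x \<in> X \<Longrightarrow> S x = U (diag_op k e l (V x))"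
    by (auto simp: is_svd_on_def unitary_on_def)
  obtain U' where U': "is_adjoint_on X U U'" "\<And>x. x \<in> X \<Longrightarrow> U (U' x) = x" "\<And>x. x \<in> X \<Longrightarrow> U' (U x) = x"
    using svd unfolding is_svd_on_def unitary_on_def by metis
  obtain V' where V': "is_adjoint_on X V V'" "\<And>x. x \<in> X \<Longrightarrow> V (V' x) = x" "\<And>x. x \<in> X \<Longrightarrow> V' (V x) = x"
    using svd unfolding is_svd_on_def unitary_on_def by metis
  note X = orthonormal_basis_ofD(4)[OF e] and e_mem = orthonormal_basis_ofD(3)[OF e]
  have U_lin: "U (\<Sum>j<k. c j *\<^sub>C e j) = (\<Sum>j<k. c j *\<^sub>C U (e j))" for c
    by (rule linear_on_sum[OF X]) (use bounded_op_onD[OF U] e_mem in auto)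
  have V'_mem: "V' x \<in> X" if "x \<in> X" for x
    using V'(1) that by (simp add: is_adjoint_on_def)
  have U'_mem: "U' x \<in> X" if "x \<in> X" for x
    using U'(1) that by (simp add: is_adjoint_on_def)
  have V'_coeff: "cinner (V' x) y = cinner x (V y)" if "x \<in> X" "y \<in> X" for x y
    using V'(1) that unfolding is_adjoint_on_def by (metis cinner_commute)
  define u where "u j = U (e j)" for j
  define v where "v j = V' (e j)" for j
  have u: "orthonormal_basis_of X k u"
    unfolding orthonormal_basis_of_def
  proof (intro conjI allI impI)
    fix i j assume ij: "i < k" "j < k"
    have "cinner (u i) (u j) = cinner (e i) (U' (U (e j)))"
      using U'(1) ij e_mem bounded_op_onD(1)[OF U] by (simp add: u_def is_adjoint_on_def)
    then show "cinner (u i) (u j) = (if i = j then 1 else 0)"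
      using ij by (simp add: U' e_mem orthonormal_basis_ofD(1)[OF e])
  next
    have u_mem: "u ` {..<k} \<subseteq> X"
      using e_mem bounded_op_onD(1)[OF U] by (auto simp: u_def)
    show "complex_vector.span (u ` {..<k}) = X"
    proof
      show "complex_vector.span (u ` {..<k}) \<subseteq> X"
        using u_mem X by (rule complex_vector.span_minimal)
      show "X \<subseteq> complex_vector.span (u ` {..<k})"
      proof
        fix x assume x: "x \<in> X"
        have "x = U (\<Sum>j<k. cinner (e j) (U' x) *\<^sub>C e j)"
          using orthonormal_expansion[OF e U'_mem[OF x]] U'(2)[OF x] by simp
        also have "\<dots> = (\<Sum>j<k. cinner (e j) (U' x) *\<^sub>C u j)"
          by (simp add: U_lin u_def)
        also have "\<dots> \<in> complex_vector.span (u ` {..<k})"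
          by (intro complex_vector.span_sum complex_vector.span_scale complex_vector.span_base) auto
        finally show "x \<in> complex_vector.span (u ` {..<k})" .
      qed
    qed
  qed
  have v: "orthonormal_basis_of X k v"
    unfolding orthonormal_basis_of_def
  proof (intro conjI allI impI)
    fix i j assume ij: "i < k" "j < k"
    have "cinner (v i) (v j) = cinner (e i) (V (V' (e j)))"
      using V'_coeff ij e_mem V'_mem by (simp add: v_def)
    then show "cinner (v i) (v j) = (if i = j then 1 else 0)"
      using ij by (simp add: V' e_mem orthonormal_basis_ofD(1)[OF e])
  next
    have v_mem: "v ` {..<k} \<subseteq> X"
      using e_mem V'_mem by (auto simp: v_def)
    show "complex_vector.span (v ` {..<k}) = X"
    proof
      show "complex_vector.span (v ` {..<k}) \<subseteq> X"
        using v_mem X by (rule complex_vector.span_minimal)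
      show "X \<subseteq> complex_vector.span (v ` {..<k})"
      proof
        fix x assume x: "x \<in> X"
        \<comment> \<open>Linearity is at hand for \<open>V\<close> but not for its inverse
          \<open>V'\<close>, so the expansion is checked after applying \<open>V\<close>.\<close>
        have "V (\<Sum>j<k. cinner (e j) (V x) *\<^sub>C v j) = (\<Sum>j<k. cinner (e j) (V x) *\<^sub>C V (v j))"
          by (rule linear_on_sum[OF X]) (use bounded_op_onD[OF V] v_mem in auto)
        also have "\<dots> = (\<Sum>j<k. cinner (e j) (V x) *\<^sub>C e j)"
          by (simp add: v_def V' e_mem)
        also have "\<dots> = V x"
          using orthonormal_expansion[OF e bounded_op_onD(1)[OF V x]] by simp
        finally have "V' (V (\<Sum>j<k. cinner (e j) (V x) *\<^sub>C v j)) = V' (V x)"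
          by simp
        moreover have "(\<Sum>j<k. cinner (e j) (V x) *\<^sub>C v j) \<in> X"
          using v_mem X by (intro complex_vector.subspace_sum complex_vector.subspace_scale) auto
        ultimately have "x = (\<Sum>j<k. cinner (e j) (V x) *\<^sub>C v j)"
          using x by (simp add: V'(3))
        also have "\<dots> \<in> complex_vector.span (v ` {..<k})"
          by (intro complex_vector.span_sum complex_vector.span_scale complex_vector.span_base) auto
        finally show "x \<in> complex_vector.span (v ` {..<k})" .
      qed
    qed
  qed
  have UDV: "U (diag_op k e m (V x)) = (\<Sum>j<k. (complex_of_real (m j) * cinner (v j) x) *\<^sub>C u j)"
    if "x \<in> X" for m x
    unfolding diag_op_def U_lin u_def v_def using that by (intro sum.cong) (auto simp: V'_coeff e_mem)
  show thesis
  proof (rule that)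
    show "singular_system X k v u l S"
      unfolding singular_system_def using u v S UDV by auto
    show "singular_system X k v u (\<lambda>j. if l j \<le> \<epsilon> then 0 else l j) R"
      unfolding singular_system_def using u v R UDV by auto
  qed (rule l)
qed

lemma mp_inverse_singular_system:
  assumes sys: "singular_system X k v u l S"
  shows "mp_invertible_on X S"
proof -
  note v = singular_systemD(1)[OF sys] and u = singular_systemD(2)[OF sys]
  \<comment> \<open>Since \<open>inverse 0 = 0\<close>, \<open>B\<close> vanishes on the vectors
    \<open>u j\<close> with \<open>l j = 0\<close>, as a Moore-Penrose inverse must.\<close>
  define B where "B x = (\<Sum>j<k. (complex_of_real (inverse (l j)) * cinner (u j) x) *\<^sub>C v j)" for x
  have B: "singular_system X k u v (\<lambda>j. inverse (l j)) B"
    unfolding B_def by (rule singular_system_diag[OF u v])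
  note SB = singular_system_comp[OF B sys] and BS = singular_system_comp[OF sys B]
  have "S (B (S x)) = S x" if "x \<in> X" for x
    by (rule singular_system_eq[OF singular_system_comp[OF sys SB] sys _ that])
      (metis mult_1 mult_zero_right right_inverse)
  moreover have "B (S (B x)) = B x" if "x \<in> X" for x
    by (rule singular_system_eq[OF singular_system_comp[OF B BS] B _ that])
      (metis inverse_zero left_inverse mult_1 mult_zero_right)
  ultimately show ?thesis
    unfolding mp_invertible_on_def is_mp_inverse_on_def
    using singular_system_bounded_op_on[OF B] singular_system_is_adjoint[OF SB SB]
      singular_system_is_adjoint[OF BS BS] by blast
qed

lemma is_mp_inverse_onD:
  assumes "is_mp_inverse_on X S B" "x \<in> X"
  shows "S (B (S x)) = S x" "B (S (B x)) = B x" "S (B x) \<in> X" "B (S x) \<in> X" "B x \<in> X"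
    "y \<in> X \<Longrightarrow> cinner (S (B x)) y = cinner x (S (B y))"
    "y \<in> X \<Longrightarrow> cinner (B (S x)) y = cinner x (B (S y))"
  using assms unfolding is_mp_inverse_on_def is_adjoint_on_def bounded_op_on_def by blast+

text \<open>The hypothesis holds when \<open>p\<close> is an orthogonal projection of
  \<open>y\<close>. It is applied to \<open>P n\<close> and to the products of an operator with its
  Moore-Penrose inverse.\<close>

lemma projection_norm_le:
  assumes "cinner p p = cinner y p"
  shows "norm p \<le> norm (y::'a::complex_hilbert)"
proof (cases "p = 0")
  case False
  have "(norm p)\<^sup>2 \<le> norm y * norm p"
    using Re_cinner_le[of y p] by (simp add: power2_norm_eq_Re_cinner assms)
  then show ?thesis
    using False by (simp add: power2_eq_square)
qed simp

text \<open>\<open>B y\<close> is orthogonal to the kernel of \<open>S\<close>, so only singular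
  values of size at least \<epsilon> act on it, and \<open>S (B y)\<close> is a projection of
  \<open>y\<close>.\<close>

lemma mp_inverse_norm_le:
  assumes sys: "singular_system X k v u l S" and \<epsilon>: "0 \<le> \<epsilon>"
    and l: "\<And>j. j < k \<Longrightarrow> l j \<noteq> 0 \<Longrightarrow> \<epsilon> \<le> l j"
    and B: "is_mp_inverse_on X S B" and y: "y \<in> X"
  shows "\<epsilon> * norm (B y) \<le> norm y"
proof -
  note v = singular_systemD(1)[OF sys] and B' = is_mp_inverse_onD[OF B]
  have orth: "cinner (v j) (B y) = 0" if "j < k" "l j = 0" for j
  proof -
    note vj = orthonormal_basis_ofD(3)[OF v that(1)]
    have "S (v j) = 0"
      using that by (simp add: singular_system_vector[OF sys])
    moreover have "B 0 = 0"
      using B bounded_op_onD(3)[of X B 0 0] complex_vector.subspace_0[OF singular_systemD(3)[OF sys]]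
      by (simp add: is_mp_inverse_on_def)
    ultimately show ?thesis
      using B'(7)[OF vj, of "B y"] B' y by simp
  qed
  have "\<epsilon> * norm (B y) \<le> norm (S (B y))"
    by (rule singular_system_norm_ge[OF sys B'(5)[OF y] \<epsilon>]) (use l orth in blast)
  also have "\<dots> \<le> norm y"
    using B'(6)[OF y B'(3)[OF y]] by (intro projection_norm_le) (simp add: B'(2)[OF y])
  finally show ?thesis .
qed

text \<open>The adjoint multiplies the \<open>j\<close>-th coordinate by \<open>l j\<close>, so
  \<open>S' y\<close> has no component where \<open>l j\<close> vanishes.\<close>

lemma singular_system_adjoint_bounded_below:
  assumes sys: "singular_system X k v u l S" and adj: "is_adjoint_on X S S'" and \<epsilon>: "0 \<le> \<epsilon>"
    and l: "\<And>j. j < k \<Longrightarrow> l j \<noteq> 0 \<Longrightarrow> \<epsilon> \<le> l j" and y: "y \<in> X"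
  shows "\<epsilon> * norm (S' y) \<le> norm (S (S' y))"
proof -
  note sys' = singular_system_adjoint[OF sys adj]
  show ?thesis
    using singular_systemD(5)[OF sys' y] l
    by (intro singular_system_norm_ge[OF sys _ \<epsilon>]) (auto simp: singular_system_coeff[OF sys' y])
qed

section \<open>The gap in the spectrum\<close>

text \<open>The infimum \<open>c\<close> of \<open>\<parallel>T v\<parallel>\<^sup>2\<close> over the unit vectors orthogonal to the kernel of \<open>T\<close> is an approximate
  eigenvalue of \<open>S T\<close>: the form \<open>f v = \<parallel>T v\<parallel>\<^sup>2 - c \<parallel>v\<parallel>\<^sup>2\<close> is nonnegative on the complement of the kernel,
  so a small value \<open>f v\<close> forces its gradient \<open>S (T v) - c v\<close> to be small.\<close>

lemma mp_inverse_bounded_below_spectrum: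
  assumes T: "bounded_op (T :: 'a::complex_hilbert \<Rightarrow> 'a)" and adj: "is_adjoint_on UNIV T S"
    and B: "is_mp_inverse_on UNIV T B"
    and \<epsilon>: "ereal \<epsilon> < Inf {ereal l | l. 0 < l \<and> complex_of_real (l\<^sup>2) \<in> op_spectrum (\<lambda>x. S (T x))}"
  obtains d where "\<epsilon> < d" "\<And>w. d * norm (B (T w)) \<le> norm (T w)"
proof -
  note A = is_adjoint_UNIV_D[OF adj] and B' = mp_inverse_UNIV_D[OF B]
  note S = bounded_op_adjoint[OF T adj]
  interpret T: bounded_linear T
    by (rule bounded_op_imp_bounded_linear[OF T])
  interpret S: bounded_linear S
    by (rule bounded_op_imp_bounded_linear[OF S])
  interpret B: bounded_linear B
    by (rule bounded_op_imp_bounded_linear[OF B'(1)])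
  obtain KB where KB: "KB > 0" "\<And>x. norm (B x) \<le> KB * norm x"
    using bounded_op_on_bound[OF B'(1)] by (metis UNIV_I)
  obtain KT where KT: "KT > 0" "\<And>x. norm (T x) \<le> KT * norm x"
    using bounded_op_on_bound[OF T] by (metis UNIV_I)
  define Q where "Q = {(norm (T v))\<^sup>2 | v. B (T v) = v \<and> norm v = 1}"
  show thesis
  proof (cases "Q = {}")
    \<comment> \<open>No unit vector is orthogonal to the kernel, so \<open>B (T w)\<close> is
      always \<open>0\<close> and any \<open>d\<close> above \<epsilon> will do.\<close>
    case True
    have "B (T w) = 0" for w
    proof (rule ccontr)
      assume nz: "B (T w) \<noteq> 0"
      define v where "v = inverse (norm (B (T w))) *\<^sub>R B (T w)"
      have "B (T v) = v" "norm v = 1"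
        using nz by (simp_all add: v_def T.scaleR B.scaleR B')
      then show False
        using True unfolding Q_def by blast
    qed
    then show thesis
      by (intro that[of "\<epsilon> + 1"]) auto
  next
    case False
    define c where "c = Inf Q"
    have Q_lower: "(1 / KB)\<^sup>2 \<le> q" if "q \<in> Q" for q
    proof -
      from that obtain v where v: "q = (norm (T v))\<^sup>2" "B (T v) = v" "norm v = 1"
        unfolding Q_def by blast
      have "1 \<le> KB * norm (T v)"
        using KB(2)[of "T v"] v by simp
      then show ?thesis
        unfolding v(1) using KB(1) by (intro power_mono) (simp_all add: field_simps)
    qed
    have "bdd_below Q"
      using Q_lower by (rule bdd_belowI)
    then have c_le: "c \<le> q" if "q \<in> Q" for q
      unfolding c_def using that by (intro cInf_lower)
    have "(1 / KB)\<^sup>2 \<le> c"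
      unfolding c_def using Q_lower False by (intro cInf_greatest)
    moreover have "0 < (1 / KB)\<^sup>2"
      using KB(1) by simp
    ultimately have c: "0 < c"
      by linarith
    have below: "c * (norm v)\<^sup>2 \<le> (norm (T v))\<^sup>2" if v: "B (T v) = v" for v
    proof (cases "v = 0")
      case False
      define w where "w = inverse (norm v) *\<^sub>R v"
      have "B (T w) = w" "norm w = 1"
        using False v by (simp_all add: w_def T.scaleR B.scaleR)
      then have "c \<le> (norm (T w))\<^sup>2"
        by (intro c_le) (auto simp: Q_def)
      also have "\<dots> = (norm (T v))\<^sup>2 / (norm v)\<^sup>2"
        using False by (simp add: w_def T.scaleR power_mult_distrib power_divide field_simps)
      finally show ?thesis
        using False by (simp add: field_simps)
    qed simp
    have "complex_of_real c \<in> op_spectrum (\<lambda>x. S (T x))"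
    proof (rule ccontr)
      assume "complex_of_real c \<notin> op_spectrum (\<lambda>x. S (T x))"
      then obtain G where G: "bounded_op G" "\<And>x. G (S (T x) - complex_of_real c *\<^sub>C x) = x"
        unfolding op_spectrum_def invertible_on_def by auto
      obtain KG where KG: "KG > 0" "\<And>x. norm (G x) \<le> KG * norm x"
        using bounded_op_on_bound[OF G(1)] by (metis UNIV_I)
      \<comment> \<open>One gradient step from \<open>v\<close> to \<open>v - t N\<close> lowers the
        form by at least \<open>t * (norm N)\<^sup>2\<close> when \<open>t * KT\<^sup>2 = 1\<close>.
        The form is below \<eta> at \<open>v\<close> and nonnegative after the step, so
        \<open>KG * norm N < 1\<close> by the choice of \<eta>. This contradicts that
        \<open>G\<close> maps \<open>N\<close> to the unit vector \<open>v\<close>.\<close>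
      define t where "t = inverse (KT\<^sup>2)"
      define \<eta> where "\<eta> = t / KG\<^sup>2"
      have t: "t > 0" "t * KT\<^sup>2 = 1"
        using KT by (simp_all add: t_def)
      have \<eta>: "\<eta> > 0"
        using t KG by (simp add: \<eta>_def)
      then have "\<exists>q\<in>Q. q < c + \<eta>"
        using cInf_less_iff[OF False \<open>bdd_below Q\<close>, of "c + \<eta>"] by (simp add: c_def)
      then obtain v where v: "B (T v) = v" "norm v = 1" "(norm (T v))\<^sup>2 < c + \<eta>"
        unfolding Q_def by auto
      define N where "N = S (T v) - c *\<^sub>R v"
      \<comment> \<open>The projection \<open>B T\<close> fixes the range of \<open>S\<close>, so
        the step along \<open>N\<close> stays in the complement of the kernel, where the form is
        nonnegative.\<close>
      have "B (T (S y)) = S y" for y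
        by (rule cinner_eqI) (simp add: B'(5)[symmetric] A(1)[symmetric] B'(2))
      then have "B (T (v - t *\<^sub>R N)) = v - t *\<^sub>R N"
        using v by (simp add: N_def T.diff B.diff T.scaleR B.scaleR)
      then have "c * (norm (v - t *\<^sub>R N))\<^sup>2 \<le> (norm (T v - t *\<^sub>R T N))\<^sup>2"
        using below by (metis T.diff T.scaleR)
      then have "0 \<le> (norm (T v))\<^sup>2 - 2 * t * Re (cinner (T v) (T N)) + t\<^sup>2 * (norm (T N))\<^sup>2
          - c * (1 - 2 * t * Re (cinner v N) + t\<^sup>2 * (norm N)\<^sup>2)"
        by (simp add: norm_diff_squared cinner_scaleR_right power_mult_distrib v mult.assoc)
      also have "\<dots> \<le> (norm (T v))\<^sup>2 - 2 * t * Re (cinner (T v) (T N)) + t\<^sup>2 * (norm (T N))\<^sup>2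
          - c * (1 - 2 * t * Re (cinner v N))"
        using c by (simp add: distrib_left)
      also have "\<dots> = ((norm (T v))\<^sup>2 - c) - 2 * t * (Re (cinner (T v) (T N)) - c * Re (cinner v N))
          + t\<^sup>2 * (norm (T N))\<^sup>2"
        by (simp add: algebra_simps)
      also have "Re (cinner (T v) (T N)) - c * Re (cinner v N) = (norm N)\<^sup>2"
        unfolding power2_norm_eq_Re_cinner
        by (simp add: A(2) N_def[symmetric])
          (simp add: N_def cinner_diff_left cinner_scaleR_left)
      also have "t\<^sup>2 * (norm (T N))\<^sup>2 \<le> t\<^sup>2 * (KT * norm N)\<^sup>2"
        using KT(2)[of N] by (intro mult_left_mono power_mono) auto
      also have "t\<^sup>2 * (KT * norm N)\<^sup>2 = t * (t * KT\<^sup>2) * (norm N)\<^sup>2"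
        by (simp add: power2_eq_square mult_ac)
      finally have "t * (norm N)\<^sup>2 < \<eta>"
        using v(3) unfolding t(2) by simp
      then have "(KG * norm N)\<^sup>2 < 1"
        using t KG by (simp add: \<eta>_def power_mult_distrib field_simps)
      moreover have "1 \<le> KG * norm N"
        using KG(2)[of N] G(2)[of v] v(2) by (simp add: N_def scaleR_scaleC[where 'a = 'a])
      then have "1 \<le> (KG * norm N)\<^sup>2"
        by simp
      ultimately show False
        by simp
    qed
    then have "Inf {ereal l | l. 0 < l \<and> complex_of_real (l\<^sup>2) \<in> op_spectrum (\<lambda>x. S (T x))} \<le> ereal (sqrt c)"
      using c by (intro Inf_lower) (auto intro!: exI[of _ "sqrt c"] simp flip: of_real_power)
    with \<epsilon> have "ereal \<epsilon> < ereal (sqrt c)"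
      by (rule less_le_trans)
    then have "\<epsilon> < sqrt c"
      by simp
    moreover have "sqrt c * norm (B (T w)) \<le> norm (T w)" for w
    proof (rule power2_le_imp_le)
      show "(sqrt c * norm (B (T w)))\<^sup>2 \<le> (norm (T w))\<^sup>2"
        using below[of "B (T w)"] c by (simp add: B' power_mult_distrib)
    qed simp
    ultimately show thesis
      using c by (intro that[of "sqrt c"]) auto
  qed
qed

section \<open>Operator norms on subspaces\<close>

text \<open>Some bound \<open>K\<close> must be known beforehand for the supremum to be meaningful.
  The quotient at \<open>x = 0\<close> is \<open>0\<close> by the convention for division, which
  makes the supremum nonnegative even on the zero space.\<close>

lemma onorm_on_bounds:
  assumes "\<And>x. x \<in> X \<Longrightarrow> norm (A x) \<le> K * norm x" "0 \<in> X"
  shows "\<And>x. x \<in> X \<Longrightarrow> norm (A x) \<le> onorm_on X A * norm x" "0 \<le> onorm_on X A" "0 \<le> K \<Longrightarrow> onorm_on X A \<le> K"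
proof -
  have le: "norm (A x) / norm x \<le> max K 0" if "x \<in> X" for x
  proof (cases "x = 0")
    case False
    have "norm (A x) \<le> max K 0 * norm x"
      using assms(1)[OF that] mult_right_mono[of K "max K 0" "norm x"] by simp
    then show ?thesis
      using False by (simp add: field_simps)
  qed simp
  then have bdd: "bdd_above ((\<lambda>x. norm (A x) / norm x) ` X)"
    by (intro bdd_aboveI[of _ "max K 0"]) auto
  show "0 \<le> onorm_on X A"
    unfolding onorm_on_def using cSUP_upper[OF assms(2) bdd] by simp
  show "onorm_on X A \<le> K" if "0 \<le> K"
    unfolding onorm_on_def using le that assms(2) by (intro cSUP_least) (auto simp: max_def)
  fix x assume x: "x \<in> X"
  show "norm (A x) \<le> onorm_on X A * norm x"
  proof (cases "x = 0")
    case True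
    then show ?thesis
      using assms(1)[OF x] by simp
  next
    case False
    have "norm (A x) / norm x \<le> onorm_on X A"
      unfolding onorm_on_def by (rule cSUP_upper[OF x bdd])
    then show ?thesis
      using False by (simp add: field_simps)
  qed
qed

text \<open>\<open>A' y\<close> is tested against the preimage of \<open>y\<close> under
  \<open>A\<close>, whose norm is at most \<open>norm y / c\<close>.\<close>

lemma adjoint_bounded_below_on:
  assumes inv: "invertible_on X A" and c: "c > 0" "\<And>x. x \<in> X \<Longrightarrow> c * norm x \<le> norm (A x)"
    and adj: "is_adjoint_on X A A'" and y: "y \<in> X"
  shows "c * norm y \<le> norm (A' (y :: 'a::complex_hilbert))"
proof (cases "y = 0")
  case False
  obtain B where B: "B y \<in> X" "A (B y) = y"
    using inv y unfolding invertible_on_def bounded_op_on_def by blast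
  have "c * (norm y)\<^sup>2 = c * Re (cinner (B y) (A' y))"
    using adj B y unfolding is_adjoint_on_def by (metis power2_norm_eq_Re_cinner)
  also have "\<dots> \<le> c * (norm (B y) * norm (A' y))"
    using c by (intro mult_left_mono Re_cinner_le) auto
  also have "\<dots> \<le> norm y * norm (A' y)"
    using c(2)[OF B(1)] B(2) by (metis mult.assoc mult_right_mono norm_ge_zero)
  finally show ?thesis
    using False by (simp add: power2_eq_square)
qed simp

section \<open>Finite sections along an asymptotically commuting filtration\<close>

text \<open>The adjoint \<open>S\<close> and a bound \<delta> are parameters, so that the setting is
  closed under exchanging \<open>T\<close> and \<open>S\<close> with the same \<delta>, and each
  one-sided estimate can be reused for the adjoint.\<close>

locale asymptotically_commuting =
  fixes T S :: "'a::complex_hilbert \<Rightarrow> 'a" and P :: "nat \<Rightarrow> 'a \<Rightarrow> 'a" and \<delta> :: "nat \<Rightarrow> real"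
  assumes T: "bounded_op T" and adj: "is_adjoint_on UNIV T S" and filtration: "filtration P"
    and \<delta>_lim: "\<delta> \<longlonglongrightarrow> 0"
    and commutator_le: "\<And>n x. norm (P n (T x) - T (P n x)) \<le> \<delta> n * norm x"
begin

abbreviation "X n \<equiv> range (P n)"
abbreviation "A n \<equiv> finite_section P T n"
abbreviation "A' n \<equiv> finite_section P S n"

lemma S: "bounded_op S"
  using bounded_op_adjoint[OF T adj] .

lemmas adjD = is_adjoint_UNIV_D[OF adj]

sublocale T: bounded_linear T
  by (rule bounded_op_imp_bounded_linear[OF T])

sublocale S: bounded_linear S
  by (rule bounded_op_imp_bounded_linear[OF S])

lemma P_op: "bounded_op (P n)"
  and P_adj: "cinner (P n x) y = cinner x (P n y)"
  and P_idem: "P n (P n x) = P n x"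
  and P_range: "\<exists>B. finite B \<and> range (P n) = complex_vector.span B"
  using filtration unfolding filtration_def finite_rank_projection_def is_adjoint_on_def by auto

sublocale P: bounded_linear "P n" for n
  by (rule bounded_op_imp_bounded_linear[OF P_op])

lemma P_lim: "(\<lambda>n. P n v) \<longlonglongrightarrow> v"
  using filtration unfolding filtration_def by (simp add: tendsto_norm_zero_iff LIM_zero_iff)

lemma mem_X: "x \<in> X n \<longleftrightarrow> P n x = x"
proof
  show "P n x = x" if "x \<in> X n"
    using that by (auto simp: P_idem)
  show "x \<in> X n" if "P n x = x"
    using rangeI[of "P n" x] that by simp
qed

lemma P_mem: "P n x \<in> X n"
  by simp

lemma zero_mem: "0 \<in> X n"
  by (simp add: mem_X P.zero)

lemma P_norm: "norm (P n x) \<le> norm x"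
  by (rule projection_norm_le) (simp add: P_adj P_idem)

lemma basis_exists: "\<exists>k e. orthonormal_basis_of (X n) k e"
  using P_range[of n] orthonormal_basis_exists by metis

text \<open>The factor \<open>norm x\<close> is needed because the commutator bound says nothing
  about the sign of \<delta> when the space is zero.\<close>

lemma \<delta>_nonneg: "0 \<le> \<delta> n * norm (x::'a)"
  using commutator_le[of n x] norm_ge_zero order_trans by blast

text \<open>The commutator of \<open>P n\<close> with \<open>S\<close> is minus the adjoint of the
  one with \<open>T\<close>, so it obeys the same bound.\<close>

lemma dual: "asymptotically_commuting S T P \<delta>"
proof
  show "norm (P n (S y) - S (P n y)) \<le> \<delta> n * norm y" for n y
  proof (cases "P n (S y) - S (P n y) = 0")
    case False
    define z where "z = P n (S y) - S (P n y)"
    have "(norm z)\<^sup>2 = Re (cinner y (T (P n z) - P n (T z)))"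
      unfolding power2_norm_eq_Re_cinner
      by (subst z_def) (simp add: cinner_diff_left cinner_diff_right adjD(2)[symmetric] P_adj)
    also have "\<dots> \<le> norm y * norm (P n (T z) - T (P n z))"
      using Re_cinner_le[of y "T (P n z) - P n (T z)"] by (simp add: norm_minus_commute)
    also have "\<dots> \<le> norm y * (\<delta> n * norm z)"
      by (intro mult_left_mono commutator_le) auto
    finally show ?thesis
      using False by (simp add: power2_eq_square mult_ac z_def)
  qed (simp add: \<delta>_nonneg)
qed (use S is_adjoint_UNIV_sym[OF adj] filtration \<delta>_lim in auto)

section \<open>Sections as perturbations of the operator\<close>

lemma section_op: "bounded_op_on (X n) (A n)"
proof -
  obtain K where K: "\<And>x. norm (T x) \<le> K * norm x"
    using bounded_op_on_bound[OF T] by (metis UNIV_I)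
  have "norm (A n x) \<le> norm x * K" if "x \<in> X n" for x
    using K[of x] P_norm[of n "T x"] that by (simp add: finite_section_def mem_X mult.commute)
  then have "\<exists>K. \<forall>x\<in>X n. norm (A n x) \<le> norm x * K"
    by blast
  moreover have "A n (c *\<^sub>C x) = c *\<^sub>C A n x" for c x
    by (simp add: finite_section_def bounded_op_onD(3)[OF P_op] bounded_op_onD(3)[OF T])
  ultimately show ?thesis
    unfolding bounded_op_on_def by (simp add: finite_section_def P.add T.add)
qed

lemma section_adj: "is_adjoint_on (X n) (A n) (A' n)"
  by (auto simp: is_adjoint_on_def finite_section_def P_adj adjD)

lemma section_near: "x \<in> X n \<Longrightarrow> norm (A n x - T x) \<le> \<delta> n * norm x"
  using commutator_le[of n x] by (simp add: finite_section_def mem_X)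

lemma section_lim: "(\<lambda>n. A n (P n v)) \<longlonglongrightarrow> T v"
proof -
  have "(\<lambda>n. A n (P n v) - T (P n v)) \<longlonglongrightarrow> 0"
  proof (rule Lim_null_comparison)
    show "\<forall>\<^sub>F n in sequentially. norm (A n (P n v) - T (P n v)) \<le> \<bar>\<delta> n\<bar> * norm v"
    proof (intro always_eventually allI)
      fix n
      have "norm (A n (P n v) - T (P n v)) \<le> \<delta> n * norm (P n v)"
        by (rule section_near) simp
      also have "\<dots> \<le> \<bar>\<delta> n\<bar> * norm v"
        by (intro mult_mono P_norm) auto
      finally show "norm (A n (P n v) - T (P n v)) \<le> \<bar>\<delta> n\<bar> * norm v" .
    qed
    show "(\<lambda>n. \<bar>\<delta> n\<bar> * norm v) \<longlonglongrightarrow> 0"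
      using \<delta>_lim by (auto intro!: tendsto_eq_intros)
  qed
  moreover have "(\<lambda>n. T (P n v)) \<longlonglongrightarrow> T v"
    by (intro T.tendsto P_lim)
  ultimately show ?thesis
    using tendsto_add by fastforce
qed

lemma section_bounded_below:
  assumes c: "c > 0" "\<And>x. c * norm x \<le> norm (T x)"
  shows "\<forall>\<^sub>F n in sequentially. \<forall>x\<in>X n. c / 2 * norm x \<le> norm (A n x)"
proof -
  have "\<forall>\<^sub>F n in sequentially. \<delta> n < c / 2"
    using \<delta>_lim c(1) by (intro order_tendstoD) auto
  then show ?thesis
  proof eventually_elim
    case (elim n)
    show ?case
    proof
      fix x assume x: "x \<in> X n"
      have "norm (T x) \<le> norm (A n x) + norm (A n x - T x)"
        using norm_triangle_sub[of "T x" "A n x"] by (simp add: norm_minus_commute)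
      moreover have "\<delta> n * norm x \<le> c / 2 * norm x"
        using elim by (intro mult_right_mono) auto
      ultimately show "c / 2 * norm x \<le> norm (A n x)"
        using c(2)[of x] section_near[OF x] by (simp add: field_simps)
    qed
  qed
qed

lemma section_bounded_below_limit:
  assumes "\<forall>\<^sub>F n in sequentially. \<forall>x\<in>X n. c * norm x \<le> norm (A n x)"
  shows "c * norm x \<le> norm (T x)"
proof (rule tendsto_le[OF sequentially_bot])
  show "(\<lambda>n. norm (A n (P n x))) \<longlonglongrightarrow> norm (T x)"
    by (intro tendsto_norm section_lim)
  show "(\<lambda>n. c * norm (P n x)) \<longlonglongrightarrow> c * norm x"
    by (intro tendsto_intros P_lim)
  show "\<forall>\<^sub>F n in sequentially. c * norm (P n x) \<le> norm (A n (P n x))"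
    using assms by eventually_elim auto
qed

lemma section_invertible:
  assumes "c > 0" "\<forall>x\<in>X n. c * norm x \<le> norm (A n x)"
  shows "invertible_on (X n) (A n)"
proof -
  obtain k e where "orthonormal_basis_of (X n) k e"
    using basis_exists by metis
  then show ?thesis
    by (rule invertible_on_if_bounded_below[OF _ section_op]) (use assms in auto)
qed

lemma invertible_if_sections_bounded_below:
  assumes c: "c > 0"
    and A: "\<forall>\<^sub>F n in sequentially. \<forall>x\<in>X n. c * norm x \<le> norm (A n x)"
    and A': "\<forall>\<^sub>F n in sequentially. \<forall>x\<in>X n. c * norm x \<le> norm (A' n x)"
  shows "invertible_op T"
  by (rule invertible_if_bounded_below[OF T adj c section_bounded_below_limit[OF A]
        asymptotically_commuting.section_bounded_below_limit[OF dual A']])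

section \<open>Stability and applicability\<close>

lemma stable_iff: "stable_seq P T \<longleftrightarrow> invertible_op T"
proof
  assume "stable_seq P T"
  then obtain n0 where inv: "\<And>n. n \<ge> n0 \<Longrightarrow> invertible_on (X n) (A n)"
    and "bdd_above ((\<lambda>n. onorm_on (X n) (inv_into (X n) (A n))) ` {n0..})"
    unfolding stable_seq_def by blast
  then obtain M where M: "\<And>n. n \<ge> n0 \<Longrightarrow> onorm_on (X n) (inv_into (X n) (A n)) \<le> M"
    unfolding bdd_above_def by force
  \<comment> \<open>\<open>M\<close> may be \<open>0\<close> when the spaces \<open>X n\<close>
    vanish; \<open>max M 1\<close> keeps the reciprocal positive.\<close>
  define c where "c = inverse (max M 1)"
  have c: "c > 0"
    by (simp add: c_def)
  have lower: "c * norm x \<le> norm (A n x)" if n: "n \<ge> n0" and x: "x \<in> X n" for n x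
  proof -
    obtain B where B: "bounded_op_on (X n) B" "\<And>x. x \<in> X n \<Longrightarrow> A n (B x) = x"
      "\<And>x. x \<in> X n \<Longrightarrow> B (A n x) = x"
      using inv[OF n] unfolding invertible_on_def by metis
    have inj: "inj_on (A n) (X n)"
      by (rule inj_on_inverseI[of _ B]) (rule B)
    obtain K where K: "\<And>x. x \<in> X n \<Longrightarrow> norm (B x) \<le> K * norm x"
      using bounded_op_on_bound[OF B(1)] by metis
    have inv_eq: "inv_into (X n) (A n) y = B y" if "y \<in> X n" for y
      by (rule inv_into_f_eq[OF inj]) (use B that bounded_op_onD(1)[OF B(1)] in auto)
    have "norm x = norm (inv_into (X n) (A n) (A n x))"
      using x by (simp add: inv_into_f_f[OF inj])
    also have "\<dots> \<le> onorm_on (X n) (inv_into (X n) (A n)) * norm (A n x)"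
      by (rule onorm_on_bounds(1)[where K = K])
        (use K inv_eq zero_mem bounded_op_onD(1)[OF section_op x] in auto)
    also have "\<dots> \<le> max M 1 * norm (A n x)"
      using M[OF n] by (intro mult_right_mono) auto
    finally show ?thesis
      by (simp add: c_def field_simps)
  qed
  show "invertible_op T"
  proof (rule invertible_if_sections_bounded_below[OF c])
    show "\<forall>\<^sub>F n in sequentially. \<forall>x\<in>X n. c * norm x \<le> norm (A n x)"
      using eventually_ge_at_top[of n0] by eventually_elim (use lower in auto)
    show "\<forall>\<^sub>F n in sequentially. \<forall>x\<in>X n. c * norm x \<le> norm (A' n x)"
      using eventually_ge_at_top[of n0]
    proof eventually_elim
      case (elim n)
      show ?case
        using adjoint_bounded_below_on[OF inv[OF elim] c lower[OF elim] section_adj] by blast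
    qed
  qed
next
  assume "invertible_op T"
  then obtain c where c: "c > 0" "\<And>x. c * norm x \<le> norm (T x)"
    using invertible_imp_bounded_below by metis
  obtain n0 where n0: "\<And>n x. n \<ge> n0 \<Longrightarrow> x \<in> X n \<Longrightarrow> c / 2 * norm x \<le> norm (A n x)"
    using section_bounded_below[OF c] unfolding eventually_sequentially by blast
  have inv: "invertible_on (X n) (A n)" if "n \<ge> n0" for n
    using section_invertible[of "c / 2" n] c n0[OF that] by simp
  have "onorm_on (X n) (inv_into (X n) (A n)) \<le> 2 / c" if n: "n \<ge> n0" for n
  proof (rule onorm_on_bounds(3))
    fix y assume y: "y \<in> X n"
    obtain B where B: "B y \<in> X n" "A n (B y) = y"
      using inv[OF n] y unfolding invertible_on_def bounded_op_on_def by blast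
    then have "y \<in> A n ` X n"
      by (metis imageI)
    then have "inv_into (X n) (A n) y \<in> X n" "A n (inv_into (X n) (A n) y) = y"
      by (auto intro: inv_into_into f_inv_into_f simp del: image_image)
    then show "norm (inv_into (X n) (A n) y) \<le> 2 / c * norm y"
      using n0[OF n, of "inv_into (X n) (A n) y"] c(1) by (simp add: field_simps)
  qed (use c zero_mem in auto)
  then have "bdd_above ((\<lambda>n. onorm_on (X n) (inv_into (X n) (A n))) ` {n0..})"
    by (intro bdd_aboveI[of _ "2 / c"]) auto
  then show "stable_seq P T"
    unfolding stable_seq_def using inv by blast
qed

lemma applicable_iff: "applicable P T \<longleftrightarrow> invertible_op T"
proof
  assume "applicable P T"
  then have surj: "range T = UNIV"
    unfolding applicable_def by (metis surj_def)
  then obtain c where c: "c > 0" "\<And>x. c * norm (T x) \<le> norm (S (T x))"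
    using closed_range_imp_adjoint_bounded_below[OF T adj] by (metis closed_UNIV)
  then have S_below: "c * norm y \<le> norm (S y)" for y
    using surj by (metis surj_def)
  have c2: "c / 2 > 0"
    using c by simp
  note A' = asymptotically_commuting.section_bounded_below[OF dual c(1) S_below]
  show "invertible_op T"
  proof (rule invertible_if_sections_bounded_below[OF c2 _ A'])
    show "\<forall>\<^sub>F n in sequentially. \<forall>x\<in>X n. c / 2 * norm x \<le> norm (A n x)"
      using A'
    proof eventually_elim
      case (elim n)
      note inv = asymptotically_commuting.section_invertible[OF dual c2 elim]
      show ?case
        using adjoint_bounded_below_on[OF inv c2 _ asymptotically_commuting.section_adj[OF dual]] elim
        by blast
    qed
  qed
next
  assume "invertible_op T"
  then obtain c where c: "c > 0" "\<And>x. c * norm x \<le> norm (T x)"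
    using invertible_imp_bounded_below by metis
  obtain G where "\<forall>y\<in>UNIV. T (G y) = y \<and> G (T y) = y"
    using \<open>invertible_op T\<close> unfolding invertible_on_def by blast
  then have G: "T (G y) = y" for y
    by simp
  obtain n0 where n0: "\<And>n x. n \<ge> n0 \<Longrightarrow> x \<in> X n \<Longrightarrow> c / 2 * norm x \<le> norm (A n x)"
    using section_bounded_below[OF c] unfolding eventually_sequentially by blast
  have inv: "invertible_on (X n) (A n)" if "n \<ge> n0" for n
    using section_invertible[of "c / 2" n] c n0[OF that] by simp
  have diff: "A n (x - y) = A n x - A n y" for n x y
    by (simp add: finite_section_def P.diff T.diff)
  have unique: "\<exists>!u. u \<in> X n \<and> A n u = P n y" if n: "n \<ge> n0" for n y
  proof -
    obtain B where B: "bounded_op_on (X n) B" "\<forall>x\<in>X n. A n (B x) = x \<and> B (A n x) = x"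
      using inv[OF n] unfolding invertible_on_def by blast
    show ?thesis
    proof (rule ex1I[of _ "B (P n y)"])
      show "B (P n y) \<in> X n \<and> A n (B (P n y)) = P n y"
        using B bounded_op_onD(1)[OF B(1) P_mem] by blast
      show "u = B (P n y)" if "u \<in> X n \<and> A n u = P n y" for u
        using B that by metis
    qed
  qed
  have lim: "(\<lambda>n. THE u. u \<in> X n \<and> A n u = P n y) \<longlonglongrightarrow> G y" for y
  proof -
    define u where "u n = (THE u. u \<in> X n \<and> A n u = P n y)" for n
    \<comment> \<open>The comparison is with \<open>P n (G y)\<close> and not with
      \<open>G y\<close>, since the lower bound for the sections holds only on
      \<open>X n\<close>.\<close>
    have "(\<lambda>n. u n - P n (G y)) \<longlonglongrightarrow> 0"
    proof (rule Lim_null_comparison)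
      show "\<forall>\<^sub>F n in sequentially. norm (u n - P n (G y)) \<le> 2 / c * norm (P n y - A n (P n (G y)))"
        using eventually_ge_at_top[of n0]
      proof eventually_elim
        case (elim n)
        have u: "u n \<in> X n" "A n (u n) = P n y"
          using theI'[OF unique[OF elim, of y]] by (simp_all add: u_def)
        then have "u n - P n (G y) \<in> X n"
          by (simp add: mem_X P.diff P_idem)
        then show ?case
          using n0[OF elim, of "u n - P n (G y)"] c(1) u(2) by (simp add: diff field_simps)
      qed
      have "(\<lambda>n. P n y - A n (P n (G y))) \<longlonglongrightarrow> 0"
        using tendsto_diff[OF P_lim[of y] section_lim[of "G y"]] by (simp add: G)
      then show "(\<lambda>n. 2 / c * norm (P n y - A n (P n (G y)))) \<longlonglongrightarrow> 0"
        by (intro tendsto_mult_right_zero tendsto_norm_zero)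
    qed
    from tendsto_add[OF this P_lim[of "G y"]] show ?thesis
      by (simp add: u_def)
  qed
  show "applicable P T"
    unfolding applicable_def
  proof (intro exI[of _ n0] allI conjI impI)
    show "\<exists>!u. u \<in> X n \<and> A n u = P n y" if "n0 \<le> n" for n y
      using that by (rule unique)
    show "\<exists>x. T x = y \<and> (\<lambda>n. THE u. u \<in> X n \<and> A n u = P n y) \<longlonglongrightarrow> x" for y
      by (intro exI[of _ "G y"] conjI G lim)
  qed
qed

section \<open>Regularized sections and their limits\<close>

abbreviation "R \<epsilon> n \<equiv> regularized_section P T \<epsilon> n"

lemma regularized_section_singular_system:
  obtains k v u l where "singular_system (X n) k v u l (A n)" "\<And>j. j < k \<Longrightarrow> 0 \<le> l j"
    "singular_system (X n) k v u (\<lambda>j. if l j \<le> \<epsilon> then 0 else l j) (R \<epsilon> n)"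
proof -
  obtain k e where e: "orthonormal_basis_of (X n) k e"
    using basis_exists by metis
  have "\<exists>R. is_regularization_on (X n) \<epsilon> (A n) R"
    by (rule regularization_exists[OF e section_op])
  then have "is_regularization_on (X n) \<epsilon> (A n) (R \<epsilon> n)"
    unfolding regularized_section_def regularization_on_def by (rule someI_ex)
  then show thesis
    by (rule regularization_singular_system) (rule that)
qed

lemma regularized_section_mp_inverse:
  "is_mp_inverse_on (X n) (R \<epsilon> n) (mp_inverse_on (X n) (R \<epsilon> n))"
proof -
  obtain k v u l where "singular_system (X n) k v u (\<lambda>j. if l j \<le> \<epsilon> then 0 else l j) (R \<epsilon> n)"
    by (rule regularized_section_singular_system[where n = n and \<epsilon> = \<epsilon>]) (rule that; assumption)
  then have "mp_invertible_on (X n) (R \<epsilon> n)"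
    by (rule mp_inverse_singular_system)
  then show ?thesis
    unfolding mp_inverse_on_def mp_invertible_on_def by (rule someI_ex)
qed

lemma regularized_section_mp_inverse_norm_le:
  assumes "0 < \<epsilon>" "y \<in> X n"
  shows "norm (mp_inverse_on (X n) (R \<epsilon> n) y) \<le> inverse \<epsilon> * norm y"
proof -
  obtain k v u l where "singular_system (X n) k v u (\<lambda>j. if l j \<le> \<epsilon> then 0 else l j) (R \<epsilon> n)"
    by (rule regularized_section_singular_system[where n = n and \<epsilon> = \<epsilon>]) (rule that; assumption)
  then have "\<epsilon> * norm (mp_inverse_on (X n) (R \<epsilon> n) y) \<le> norm y"
    by (rule mp_inverse_norm_le[OF _ _ _ regularized_section_mp_inverse]) (use assms in auto)
  then show ?thesis
    using assms(1) by (simp add: field_simps)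
qed

text \<open>If \<open>A' (A v) = s\<^sup>2 v\<close>, then \<open>S (T v) - s\<^sup>2 v\<close> is small. Testing it against the components of \<open>v\<close> in the
  kernel of \<open>T\<close> and in its complement, where \<open>S T \<ge> d\<^sup>2 > s\<^sup>2\<close>, shows that \<open>s\<close> is small.\<close>

lemma small_singular_value:
  assumes B: "is_mp_inverse_on UNIV T B" and d: "\<And>w. d * norm (B (T w)) \<le> norm (T w)"
    and \<epsilon>: "0 < \<epsilon>" "\<epsilon> < d" and K: "\<And>x. norm (S x) \<le> K * norm x"
    and sys: "singular_system (X n) k v u l (A n)" and j: "j < k" "0 \<le> l j" "l j \<le> \<epsilon>"
  shows "(l j)\<^sup>2 \<le> (K + \<epsilon>) * (1 + \<epsilon>\<^sup>2 / (d\<^sup>2 - \<epsilon>\<^sup>2)) * \<delta> n"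
proof -
  note B' = mp_inverse_UNIV_D[OF B]
  interpret B: bounded_linear B
    by (rule bounded_op_imp_bounded_linear[OF B'(1)])
  interpret dual: asymptotically_commuting S T P \<delta>
    by (rule dual)
  define s where "s = l j"
  define x where "x = v j"
  have s: "0 \<le> s" "s \<le> \<epsilon>"
    using j by (simp_all add: s_def)
  have K0: "0 \<le> K"
  proof -
    have x1: "norm (v j) = 1"
      by (rule norm_orthonormal_basis[OF singular_systemD(1)[OF sys] j(1)])
    show ?thesis
      using order_trans[OF norm_ge_zero K[of "v j"]] x1 by simp
  qed
  have x: "x \<in> X n" "norm x = 1"
    using orthonormal_basis_ofD(3)[OF singular_systemD(1)[OF sys] j(1)]
      norm_orthonormal_basis[OF singular_systemD(1)[OF sys] j(1)] by (simp_all add: x_def)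
  have Ax: "A n x = complex_of_real s *\<^sub>C u j"
    using singular_system_vector[OF sys j(1)] by (simp add: x_def s_def)
  have Ax_mem: "A n x \<in> X n"
    using bounded_op_onD(1)[OF section_op x(1)] .
  have "norm (u j) = 1"
    by (rule norm_orthonormal_basis[OF singular_systemD(2)[OF sys] j(1)])
  then have Ax_norm: "norm (A n x) = s"
    using s by (simp add: Ax norm_scaleC)
  have "A' n (u j) = complex_of_real s *\<^sub>C x"
    using singular_system_vector[OF singular_system_adjoint[OF sys section_adj] j(1)]
    by (simp add: x_def s_def)
  moreover have "A' n (c *\<^sub>C y) = c *\<^sub>C A' n y" for c y
    by (simp add: finite_section_def bounded_op_onD(3)[OF P_op] bounded_op_onD(3)[OF S])
  ultimately have AAx: "A' n (A n x) = s\<^sup>2 *\<^sub>R x"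
    by (simp add: Ax scaleC_scaleC scaleR_scaleC[where 'a = 'a] power2_eq_square)
  define e where "e = S (T x) - s\<^sup>2 *\<^sub>R x"
  \<comment> \<open>\<open>K * \<delta> n\<close> is the cost of replacing \<open>T x\<close> by
    \<open>A n x\<close> under \<open>S\<close>; \<open>\<epsilon> * \<delta> n\<close> is the cost
    of replacing \<open>S\<close> by \<open>A' n\<close> at \<open>A n x\<close>, a vector of norm
    at most \<epsilon>.\<close>
  define \<eta> where "\<eta> = (K + \<epsilon>) * \<delta> n"
  have \<delta>n: "0 \<le> \<delta> n"
    using \<delta>_nonneg[of n x] x by simp
  have e: "norm e \<le> \<eta>"
  proof -
    have "e = S (T x - A n x) + (S (A n x) - A' n (A n x))"
      by (simp add: e_def S.diff AAx)
    then have "norm e \<le> norm (S (T x - A n x)) + norm (S (A n x) - A' n (A n x))"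
      using norm_triangle_ineq by metis
    also have "norm (S (T x - A n x)) \<le> K * \<delta> n"
      using K[of "T x - A n x"] section_near[OF x(1)] x(2) K0
      by (metis mult.right_neutral mult_left_mono norm_minus_commute order_trans)
    also have "norm (S (A n x) - A' n (A n x)) \<le> \<delta> n * s"
      using dual.section_near[OF Ax_mem] by (simp add: Ax_norm norm_minus_commute)
    also have "\<delta> n * s \<le> \<delta> n * \<epsilon>"
      by (intro mult_left_mono s \<delta>n)
    finally show ?thesis
      by (simp add: \<eta>_def algebra_simps)
  qed
  define p where "p = B (T x)"
  define q where "q = x - p"
  have Tp: "T p = T x" and Tq: "T q = 0"
    by (simp_all add: p_def q_def B' T.diff)
  have pq: "cinner p q = 0"
    by (simp add: p_def q_def cinner_diff_right B'(5) B'(2) T.diff B.diff B.zero)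
  then have qp: "cinner q p = 0"
    by (simp add: cinner_eq_0_commute)
  have xpq: "x = p + q"
    by (simp add: q_def)
  have gap: "0 < d\<^sup>2 - \<epsilon>\<^sup>2"
    using \<epsilon> by (simp add: power_strict_mono)
  have p_le: "(d\<^sup>2 - \<epsilon>\<^sup>2) * norm p \<le> \<eta>"
  proof (cases "p = 0")
    case False
    have "Re (cinner p e) = (norm (T p))\<^sup>2 - s\<^sup>2 * (norm p)\<^sup>2"
      by (simp add: e_def cinner_diff_right cinner_scaleR_right adjD(1)[symmetric] Tp[symmetric]
          power2_norm_eq_Re_cinner del: Tp) (simp add: xpq cinner_add_right pq)
    moreover have "(d * norm p)\<^sup>2 \<le> (norm (T p))\<^sup>2"
      using d[of x] \<epsilon> unfolding p_def[symmetric] Tp by (intro power_mono) auto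
    moreover have "s\<^sup>2 * (norm p)\<^sup>2 \<le> \<epsilon>\<^sup>2 * (norm p)\<^sup>2"
      using s by (intro mult_right_mono power_mono) auto
    moreover have "Re (cinner p e) \<le> norm p * \<eta>"
      using Re_cinner_le[of p e] mult_left_mono[OF e, of "norm p"] by simp
    ultimately have "(d\<^sup>2 - \<epsilon>\<^sup>2) * (norm p)\<^sup>2 \<le> norm p * \<eta>"
      by (simp add: power_mult_distrib left_diff_distrib)
    then show ?thesis
      using False by (simp add: power2_eq_square mult_ac)
  qed (use K0 \<epsilon> \<delta>n in \<open>simp add: \<eta>_def\<close>)
  have q_le: "s\<^sup>2 * norm q \<le> \<eta>"
  proof (cases "q = 0")
    case False
    have "Re (cinner q e) = - (s\<^sup>2 * (norm q)\<^sup>2)"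
      by (simp add: e_def cinner_diff_right cinner_scaleR_right adjD(1)[symmetric] Tq
          power2_norm_eq_Re_cinner) (simp add: xpq cinner_add_right qp)
    moreover have "- Re (cinner q e) \<le> norm q * \<eta>"
      using Re_cinner_le[of q "- e"] mult_left_mono[OF e, of "norm q"] by simp
    ultimately have "s\<^sup>2 * (norm q)\<^sup>2 \<le> norm q * \<eta>"
      by simp
    then show ?thesis
      using False by (simp add: power2_eq_square mult_ac)
  qed (use K0 \<epsilon> \<delta>n in \<open>simp add: \<eta>_def\<close>)
  \<comment> \<open>In the factor
    \<open>1 + \<epsilon>\<^sup>2 / (d\<^sup>2 - \<epsilon>\<^sup>2)\<close> the \<open>1\<close>
    comes from the kernel component \<open>q\<close> and the fraction from \<open>p\<close>.\<close>
  have "s\<^sup>2 = s\<^sup>2 * norm (p + q)"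
    using x(2) by (simp add: xpq[symmetric])
  also have "\<dots> \<le> s\<^sup>2 * (norm p + norm q)"
    by (intro mult_left_mono norm_triangle_ineq) auto
  also have "\<dots> = s\<^sup>2 * norm p + s\<^sup>2 * norm q"
    by (simp add: distrib_left)
  also have "s\<^sup>2 * norm p \<le> \<epsilon>\<^sup>2 * norm p"
    using s by (intro mult_right_mono power_mono) auto
  also have "norm p \<le> \<eta> / (d\<^sup>2 - \<epsilon>\<^sup>2)"
    using p_le gap by (simp add: field_simps)
  finally have "s\<^sup>2 \<le> \<epsilon>\<^sup>2 * (\<eta> / (d\<^sup>2 - \<epsilon>\<^sup>2)) + \<eta>"
    using q_le by (simp add: mult_left_mono)
  also have "\<dots> = (K + \<epsilon>) * (1 + \<epsilon>\<^sup>2 / (d\<^sup>2 - \<epsilon>\<^sup>2)) * \<delta> n"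
    by (simp add: \<eta>_def algebra_simps)
  finally show ?thesis
    by (simp add: s_def)
qed

text \<open>In the common singular bases the error has the entries \<open>- l j\<close> for
  \<open>l j \<le> \<epsilon>\<close> and \<open>0\<close> otherwise, so the estimate for a single
  small singular value bounds its norm, with a rate of the order of the square root of
  \<delta>.\<close>

lemma regularization_error:
  assumes B: "is_mp_inverse_on UNIV T B" and d: "\<And>w. d * norm (B (T w)) \<le> norm (T w)"
    and \<epsilon>: "0 < \<epsilon>" "\<epsilon> < d"
  shows "(\<lambda>n. onorm_on (X n) (\<lambda>x. R \<epsilon> n x - A n x)) \<longlonglongrightarrow> 0"
proof -
  obtain K where K: "K > 0" "\<And>x. norm (S x) \<le> K * norm x"
    using bounded_op_on_bound[OF S] by (metis UNIV_I)
  define C where "C = (K + \<epsilon>) * (1 + \<epsilon>\<^sup>2 / (d\<^sup>2 - \<epsilon>\<^sup>2))"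
  have near: "norm (R \<epsilon> n x - A n x) \<le> sqrt \<bar>C * \<delta> n\<bar> * norm x" if x: "x \<in> X n" for n x
  proof -
    obtain k v u l where sys: "singular_system (X n) k v u l (A n)" and l: "\<And>j. j < k \<Longrightarrow> 0 \<le> l j"
      and R: "singular_system (X n) k v u (\<lambda>j. if l j \<le> \<epsilon> then 0 else l j) (R \<epsilon> n)"
      by (rule regularized_section_singular_system[where n = n and \<epsilon> = \<epsilon>]) (rule that; assumption)
    have "l j \<le> sqrt \<bar>C * \<delta> n\<bar>" if "j < k" "l j \<le> \<epsilon>" for j
    proof (rule real_le_rsqrt)
      show "(l j)\<^sup>2 \<le> \<bar>C * \<delta> n\<bar>"
        using small_singular_value[OF B d \<epsilon> K(2) sys that(1) l[OF that(1)] that(2)]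
        unfolding C_def by linarith
    qed
    then show ?thesis
      by (intro singular_system_norm_le[OF singular_system_diff[OF R sys] x]) (use l in auto)
  qed
  show ?thesis
  proof (rule Lim_null_comparison)
    have "onorm_on (X n) (\<lambda>x. R \<epsilon> n x - A n x) \<in> {0..sqrt \<bar>C * \<delta> n\<bar>}" for n
      using onorm_on_bounds(2,3)[OF near zero_mem] by simp
    then show "\<forall>\<^sub>F n in sequentially. norm (onorm_on (X n) (\<lambda>x. R \<epsilon> n x - A n x)) \<le> sqrt \<bar>C * \<delta> n\<bar>"
      by (intro always_eventually allI) simp
    have "(\<lambda>n. sqrt \<bar>C * \<delta> n\<bar>) \<longlonglongrightarrow> sqrt \<bar>C * 0\<bar>"
      by (intro tendsto_intros \<delta>_lim)
    then show "(\<lambda>n. sqrt \<bar>C * \<delta> n\<bar>) \<longlonglongrightarrow> 0"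
      by simp
  qed
qed

text \<open>Collects what a vanishing regularization error provides, for the criterion and for the
  solutions alike. The adjoints \<open>R'\<close> arise by exchanging the singular bases, which also
  gives them the lower bound on their ranges.\<close>

lemma regularized_sections_converge:
  assumes err: "(\<lambda>n. onorm_on (X n) (\<lambda>x. R \<epsilon> n x - A n x)) \<longlonglongrightarrow> 0" and \<epsilon>: "0 < \<epsilon>"
  obtains R' \<rho> where "\<And>n. is_adjoint_on (X n) (R \<epsilon> n) (R' n)"
    "\<And>n y. y \<in> X n \<Longrightarrow> \<epsilon> * norm (R' n y) \<le> norm (R \<epsilon> n (R' n y))"
    "\<rho> \<longlonglongrightarrow> 0" "\<And>n x. x \<in> X n \<Longrightarrow> norm (R \<epsilon> n x - A n x) \<le> \<rho> n * norm x"
    "\<And>y. (\<lambda>n. R' n (P n y)) \<longlonglongrightarrow> S y" "\<And>x. (\<lambda>n. R \<epsilon> n (P n x)) \<longlonglongrightarrow> T x"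
proof -
  interpret dual: asymptotically_commuting S T P \<delta>
    by (rule dual)
  define \<rho> where "\<rho> n = onorm_on (X n) (\<lambda>x. R \<epsilon> n x - A n x)" for n
  have \<rho>: "norm (R \<epsilon> n x - A n x) \<le> \<rho> n * norm x" if x: "x \<in> X n" for n x
  proof -
    obtain k v u l where sys: "singular_system (X n) k v u l (A n)"
      and R: "singular_system (X n) k v u (\<lambda>j. if l j \<le> \<epsilon> then 0 else l j) (R \<epsilon> n)"
      by (rule regularized_section_singular_system[where n = n and \<epsilon> = \<epsilon>]) (rule that; assumption)
    obtain K where "\<And>x. x \<in> X n \<Longrightarrow> norm (R \<epsilon> n x - A n x) \<le> K * norm x"
      by (rule bounded_op_on_bound[OF singular_system_bounded_op_on[OF singular_system_diff[OF R sys]]])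
        (rule that; assumption)
    then show ?thesis
      unfolding \<rho>_def by (rule onorm_on_bounds(1)[OF _ zero_mem x])
  qed
  have "\<exists>R'. is_adjoint_on (X n) (R \<epsilon> n) R' \<and> (\<forall>y\<in>X n. \<epsilon> * norm (R' y) \<le> norm (R \<epsilon> n (R' y)))" for n
  proof -
    obtain k v u l where R: "singular_system (X n) k v u (\<lambda>j. if l j \<le> \<epsilon> then 0 else l j) (R \<epsilon> n)"
      by (rule regularized_section_singular_system[where n = n and \<epsilon> = \<epsilon>]) (rule that; assumption)
    note R' = singular_system_diag[OF singular_systemD(2,1)[OF R], of "\<lambda>j. if l j \<le> \<epsilon> then 0 else l j"]
    note adj' = singular_system_is_adjoint[OF R R']
    show ?thesis
      using adj' singular_system_adjoint_bounded_below[OF R adj'] \<epsilon> by fastforce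
  qed
  then obtain R' where R': "\<And>n. is_adjoint_on (X n) (R \<epsilon> n) (R' n)"
    "\<And>n y. y \<in> X n \<Longrightarrow> \<epsilon> * norm (R' n y) \<le> norm (R \<epsilon> n (R' n y))"
    by metis
  have R'_mem: "R' n y \<in> X n" if "y \<in> X n" for n y
    using R'(1)[of n] that unfolding is_adjoint_on_def by blast
  \<comment> \<open>\<open>R' n - A' n\<close> is the adjoint of \<open>R \<epsilon> n - A n\<close>
    on \<open>X n\<close>, so the bound \<rho> is inherited.\<close>
  have R'_near: "norm (R' n y - A' n y) \<le> \<rho> n * norm y" if y: "y \<in> X n" for n y
  proof (cases "R' n y - A' n y = 0")
    case True
    then show ?thesis
      using order_trans[OF norm_ge_zero \<rho>[OF y]] by simp
  next
    case False
    define z where "z = R' n y - A' n y"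
    have A'_mem: "A' n y \<in> X n"
      by (rule bounded_op_onD(1)[OF dual.section_op y])
    have z: "z \<in> X n"
      using R'_mem[OF y] A'_mem by (simp add: z_def mem_X P.diff)
    have "cinner z z = cinner (R \<epsilon> n z - A n z) y"
      by (subst (2) z_def) (simp add: cinner_diff_right cinner_diff_left
          is_adjoint_on_cinner[OF R'(1) z y] is_adjoint_on_cinner[OF section_adj z y])
    then have "(norm z)\<^sup>2 \<le> norm (R \<epsilon> n z - A n z) * norm y"
      using Re_cinner_le by (simp add: power2_norm_eq_Re_cinner)
    also have "\<dots> \<le> (\<rho> n * norm z) * norm y"
      by (intro mult_right_mono \<rho>[OF z]) auto
    finally show ?thesis
      using False by (simp add: z_def[symmetric] power2_eq_square mult_ac)
  qed
  have \<rho>_lim: "\<rho> \<longlonglongrightarrow> 0"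
    using err by (simp add: \<rho>_def[abs_def])
  have lim: "(\<lambda>n. D n (P n x)) \<longlonglongrightarrow> L"
    if near: "\<And>n x. x \<in> X n \<Longrightarrow> norm (D n x - E n x) \<le> \<rho> n * norm x" and E: "(\<lambda>n. E n (P n x)) \<longlonglongrightarrow> L"
    for D E :: "nat \<Rightarrow> 'a \<Rightarrow> 'a" and x L
  proof -
    have "(\<lambda>n. D n (P n x) - E n (P n x)) \<longlonglongrightarrow> 0"
    proof (rule Lim_null_comparison)
      show "\<forall>\<^sub>F n in sequentially. norm (D n (P n x) - E n (P n x)) \<le> \<rho> n * norm (P n x)"
        by (intro always_eventually allI near P_mem)
      show "(\<lambda>n. \<rho> n * norm (P n x)) \<longlonglongrightarrow> 0"
        using tendsto_mult[OF \<rho>_lim tendsto_norm[OF P_lim[of x]]] by simp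
    qed
    from tendsto_add[OF this E] show ?thesis
      by simp
  qed
  show thesis
  proof (rule that[OF R' \<rho>_lim \<rho>])
    show "(\<lambda>n. R' n (P n y)) \<longlonglongrightarrow> S y" for y
      by (rule lim[OF R'_near dual.section_lim])
    show "(\<lambda>n. R \<epsilon> n (P n x)) \<longlonglongrightarrow> T x" for x
      by (rule lim[OF \<rho> section_lim])
  qed
qed

lemma stably_regularizable_iff: "stably_regularizable P T \<longleftrightarrow> mp_invertible_on UNIV T"
proof
  assume "stably_regularizable P T"
  then obtain \<epsilon> where \<epsilon>: "0 < \<epsilon>" and err: "(\<lambda>n. onorm_on (X n) (\<lambda>x. R \<epsilon> n x - A n x)) \<longlonglongrightarrow> 0"
    unfolding stably_regularizable_def by blast
  obtain R' \<rho> where R': "\<And>n. is_adjoint_on (X n) (R \<epsilon> n) (R' n)"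
    "\<And>n y. y \<in> X n \<Longrightarrow> \<epsilon> * norm (R' n y) \<le> norm (R \<epsilon> n (R' n y))"
    and \<rho>: "\<rho> \<longlonglongrightarrow> 0" "\<And>n x. x \<in> X n \<Longrightarrow> norm (R \<epsilon> n x - A n x) \<le> \<rho> n * norm x"
    and R'_lim: "\<And>y. (\<lambda>n. R' n (P n y)) \<longlonglongrightarrow> S y"
    by (rule regularized_sections_converge[OF err \<epsilon>]) (rule that; assumption)
  have "\<epsilon> * norm (S y) \<le> norm (T (S y))" for y
  proof -
    \<comment> \<open>These vectors approximate \<open>S y\<close> from within the ranges of the
      adjoints, where the regularized sections obey the bound \<epsilon>.\<close>
    define r where "r n = R' n (P n y)" for n
    have r_mem: "r n \<in> X n" for n
      using R'(1)[of n] P_mem[of n y] unfolding r_def is_adjoint_on_def by blast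
    have r_lim: "r \<longlonglongrightarrow> S y"
      using R'_lim[of y] by (simp add: r_def[abs_def])
    have "(\<lambda>n. R \<epsilon> n (r n) - T (r n)) \<longlonglongrightarrow> 0"
    proof (rule Lim_null_comparison)
      have "norm (R \<epsilon> n (r n) - T (r n)) \<le> (\<rho> n + \<delta> n) * norm (r n)" for n
      proof -
        have "norm (R \<epsilon> n (r n) - T (r n)) \<le> norm (R \<epsilon> n (r n) - A n (r n)) + norm (A n (r n) - T (r n))"
          using norm_triangle_ineq[of "R \<epsilon> n (r n) - A n (r n)" "A n (r n) - T (r n)"] by simp
        also have "\<dots> \<le> \<rho> n * norm (r n) + \<delta> n * norm (r n)"
          by (intro add_mono \<rho>(2) section_near r_mem)
        finally show ?thesis
          by (simp add: distrib_right)
      qed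
      then show "\<forall>\<^sub>F n in sequentially. norm (R \<epsilon> n (r n) - T (r n)) \<le> (\<rho> n + \<delta> n) * norm (r n)"
        by simp
      show "(\<lambda>n. (\<rho> n + \<delta> n) * norm (r n)) \<longlonglongrightarrow> 0"
        using tendsto_mult[OF tendsto_add[OF \<rho>(1) \<delta>_lim] tendsto_norm[OF r_lim]] by simp
    qed
    from tendsto_add[OF this T.tendsto[OF r_lim]] have "(\<lambda>n. R \<epsilon> n (r n)) \<longlonglongrightarrow> T (S y)"
      by simp
    then show ?thesis
      using R'(2)[OF P_mem]
      by (intro LIMSEQ_le[OF tendsto_mult_left[OF tendsto_norm[OF r_lim]] tendsto_norm])
        (auto simp: r_def)
  qed
  then show "mp_invertible_on UNIV T"
    by (rule mp_invertible_if_bounded_below[OF T adj \<epsilon>])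
next
  assume "mp_invertible_on UNIV T"
  then obtain B where B: "is_mp_inverse_on UNIV T B"
    unfolding mp_invertible_on_def by blast
  obtain K where K: "K > 0" "\<And>x. norm (B x) \<le> K * norm x"
    using bounded_op_on_bound[OF mp_inverse_UNIV_D(1)[OF B]] by (metis UNIV_I)
  \<comment> \<open>\<open>inverse K\<close> is a lower bound for \<open>T\<close> off its kernel;
    any positive number strictly below it would do.\<close>
  define \<epsilon> where "\<epsilon> = inverse K / 2"
  have \<epsilon>: "0 < \<epsilon>" "\<epsilon> < inverse K"
    using K by (simp_all add: \<epsilon>_def)
  have "inverse K * norm (B (T w)) \<le> norm (T w)" for w
    using K(1) K(2)[of "T w"] by (simp add: field_simps)
  then have "(\<lambda>n. onorm_on (X n) (\<lambda>x. R \<epsilon> n x - A n x)) \<longlonglongrightarrow> 0"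
    by (rule regularization_error[OF B _ \<epsilon>])
  moreover have "onorm_on (X n) (mp_inverse_on (X n) (R \<epsilon> n)) \<le> inverse \<epsilon>" for n
    by (rule onorm_on_bounds(3)[OF regularized_section_mp_inverse_norm_le[OF \<epsilon>(1)] zero_mem])
      (use \<epsilon> in auto)
  then have "bdd_above (range (\<lambda>n. onorm_on (X n) (mp_inverse_on (X n) (R \<epsilon> n))))"
    by (intro bdd_aboveI[of _ "inverse \<epsilon>"]) auto
  ultimately show "stably_regularizable P T"
    unfolding stably_regularizable_def using \<epsilon>(1) by blast
qed

text \<open>The solution \<open>x\<close> has the form \<open>S z\<close>, and \<open>y\<close>
  differs from \<open>T x\<close> by a vector \<open>y'\<close> with \<open>S y' = 0\<close>. Hence
  \<open>P n x\<close> is close to the range of \<open>R' n\<close>, where \<open>D n\<close>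
  inverts \<open>R \<epsilon> n\<close> from the left, and \<open>D n\<close> is small on
  \<open>P n y'\<close> because it factors through \<open>R' n\<close>.\<close>

lemma regularized_solutions_converge:
  assumes B: "is_mp_inverse_on UNIV T B" and \<epsilon>: "0 < \<epsilon>"
    and err: "(\<lambda>n. onorm_on (X n) (\<lambda>x. R \<epsilon> n x - A n x)) \<longlonglongrightarrow> 0"
  shows "(\<lambda>n. mp_inverse_on (X n) (R \<epsilon> n) (P n y)) \<longlonglongrightarrow> B y"
proof -
  note B' = mp_inverse_UNIV_D[OF B]
  obtain R' \<rho> where R': "\<And>n. is_adjoint_on (X n) (R \<epsilon> n) (R' n)"
    "\<And>n y. y \<in> X n \<Longrightarrow> \<epsilon> * norm (R' n y) \<le> norm (R \<epsilon> n (R' n y))"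
    and R'_lim: "\<And>y. (\<lambda>n. R' n (P n y)) \<longlonglongrightarrow> S y" and R_lim: "\<And>x. (\<lambda>n. R \<epsilon> n (P n x)) \<longlonglongrightarrow> T x"
    by (rule regularized_sections_converge[OF err \<epsilon>]) (rule that; assumption)
  define D where "D n = mp_inverse_on (X n) (R \<epsilon> n)" for n
  have D: "is_mp_inverse_on (X n) (R \<epsilon> n) (D n)" for n
    unfolding D_def by (rule regularized_section_mp_inverse)
  have D_norm: "norm (D n w) \<le> inverse \<epsilon> * norm w" if "w \<in> X n" for n w
    unfolding D_def by (rule regularized_section_mp_inverse_norm_le[OF \<epsilon> that])
  have D_diff: "D n (a - b) = D n a - D n b" if "a \<in> X n" "b \<in> X n" for n a b
    using D[of n] bounded_op_on_diff[OF _ orthonormal_basis_ofD(4)] basis_exists[of n] that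
    unfolding is_mp_inverse_on_def by metis
  have R_op: "bounded_op_on (X n) (R \<epsilon> n)" for n
  proof -
    obtain k v u l where "singular_system (X n) k v u (\<lambda>j. if l j \<le> \<epsilon> then 0 else l j) (R \<epsilon> n)"
      by (rule regularized_section_singular_system[where n = n and \<epsilon> = \<epsilon>]) (rule that; assumption)
    then show ?thesis
      by (rule singular_system_bounded_op_on)
  qed
  have R_diff: "R \<epsilon> n (a - b) = R \<epsilon> n a - R \<epsilon> n b" if "a \<in> X n" "b \<in> X n" for n a b
    using bounded_op_on_diff[OF R_op orthonormal_basis_ofD(4)] basis_exists[of n] that by metis
  have R_mem: "R \<epsilon> n w \<in> X n" if "w \<in> X n" for n w
    using bounded_op_onD(1)[OF R_op that] .
  have R'_mem: "R' n w \<in> X n" if "w \<in> X n" for n w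
    using R'(1)[of n] that unfolding is_adjoint_on_def by blast
  have X_diff: "a - b \<in> X n" if "a \<in> X n" "b \<in> X n" for n a b
    using that by (simp add: mem_X P.diff)
  \<comment> \<open>As operators, \<open>D n\<close> equals \<open>D n\<close> times its adjoint
    times \<open>R' n\<close>; each of the first two factors contributes
    \<open>inverse \<epsilon>\<close>.\<close>
  have D_R': "norm (D n w) \<le> inverse \<epsilon> * (inverse \<epsilon> * norm (R' n w))" if w: "w \<in> X n" for n w
  proof -
    note Dw = is_mp_inverse_onD[OF D w]
    define p where "p = R \<epsilon> n (D n w)"
    have Dp: "norm (D n w) \<le> inverse \<epsilon> * norm p"
      using D_norm[OF Dw(3)] by (simp add: Dw(2) p_def)
    have "norm p \<le> inverse \<epsilon> * norm (R' n w)"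
    proof (cases "p = 0")
      case False
      have "cinner p p = cinner w p"
        using Dw(6)[OF Dw(3)] by (simp add: p_def Dw(2))
      also have "\<dots> = cnj (cinner (D n w) (R' n w))"
        using R'(1)[of n] Dw(5) w unfolding p_def is_adjoint_on_def by (metis cinner_commute)
      finally have "(norm p)\<^sup>2 = Re (cinner (D n w) (R' n w))"
        by (simp add: power2_norm_eq_Re_cinner)
      also have "\<dots> \<le> norm (D n w) * norm (R' n w)"
        by (rule Re_cinner_le)
      also have "\<dots> \<le> (inverse \<epsilon> * norm p) * norm (R' n w)"
        by (intro mult_right_mono Dp) auto
      finally show ?thesis
        using False by (simp add: power2_eq_square mult_ac)
    qed (use \<epsilon> in simp)
    then show ?thesis
      using Dp \<epsilon> by (meson inverse_nonnegative_iff_nonnegative less_imp_le mult_left_mono order_trans)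
  qed
  \<comment> \<open>\<open>D n\<close> after \<open>R \<epsilon> n\<close> is the orthogonal
    projection onto the range of \<open>R' n\<close>.\<close>
  have DRR': "D n (R \<epsilon> n (R' n a)) = R' n a" if a: "a \<in> X n" for n a
  proof -
    note m = R'_mem[OF a]
    define b where "b = D n (R \<epsilon> n (R' n a)) - R' n a"
    have b: "b \<in> X n"
      unfolding b_def by (intro X_diff is_mp_inverse_onD(4)[OF D m] m)
    have "cinner (D n (R \<epsilon> n (R' n a))) b = cinner (R' n a) (D n (R \<epsilon> n b))"
      by (rule is_mp_inverse_onD(7)[OF D m b])
    also have "\<dots> = cinner a (R \<epsilon> n (D n (R \<epsilon> n b)))"
      using R'(1)[of n] a is_mp_inverse_onD(4)[OF D b] unfolding is_adjoint_on_def by (metis cinner_commute)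
    also have "\<dots> = cinner a (R \<epsilon> n b)"
      by (simp add: is_mp_inverse_onD(1)[OF D b])
    also have "\<dots> = cinner (R' n a) b"
      using R'(1)[of n] a b unfolding is_adjoint_on_def by (metis cinner_commute)
    finally have "cinner b b = 0"
      by (subst b_def) (simp add: cinner_diff_left)
    then show ?thesis
      by (simp add: cinner_self b_def)
  qed
  define x where "x = B y"
  obtain BS where BS: "is_adjoint_on UNIV B BS"
    using adjoint_exists[OF B'(1)] by blast
  \<comment> \<open>\<open>S\<close> after the adjoint of \<open>B\<close> is the adjoint of
    \<open>B T\<close>, hence \<open>B T\<close> itself, which fixes \<open>x = B y\<close>.\<close>
  define z where "z = BS x"
  have Sz: "S z = x"
  proof (rule cinner_eqI)
    fix w
    have "cinner w (S z) = cinner (B (T w)) x"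
      by (simp add: z_def adjD(1)[symmetric] is_adjoint_UNIV_D(1)[OF BS])
    then show "cinner w (S z) = cinner w x"
      by (simp add: B'(5) B'(3) x_def)
  qed
  define y' where "y' = y - T x"
  have Sy': "S y' = 0"
  proof (rule cinner_eqI)
    fix w
    have "cinner (T w) (T (B y)) = cinner (T w) y"
      by (simp add: B'(4)[symmetric] B'(2))
    then show "cinner w (S y') = cinner w 0"
      by (simp add: y'_def x_def adjD(1)[symmetric] cinner_diff_right)
  qed
  \<comment> \<open>The three errors vanish in the limit: \<open>e1\<close> by strong convergence at
    \<open>x\<close>, \<open>e2\<close> because \<open>S y' = 0\<close>, and \<open>e3\<close>
    because \<open>S z = x\<close>.\<close>
  define e1 where "e1 n = P n (T x) - R \<epsilon> n (P n x)" for n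
  define e2 where "e2 n = R' n (P n y')" for n
  define e3 where "e3 n = P n x - R' n (P n z)" for n
  have e_mem: "e1 n \<in> X n" "e3 n \<in> X n" for n
    unfolding e1_def e3_def by (intro X_diff R_mem R'_mem P_mem)+
  have bound: "norm (D n (P n y) - P n x)
      \<le> inverse \<epsilon> * norm (e1 n) + inverse \<epsilon> * (inverse \<epsilon> * norm (e2 n)) + 2 * norm (e3 n)" for n
  proof -
    note DR_mem = is_mp_inverse_onD(4)[OF D]
    have "P n (T x) = P n y - P n y'"
      by (simp add: y'_def P.diff)
    then have "D n (e1 n) = D n (P n y) - D n (P n y') - D n (R \<epsilon> n (P n x))"
      unfolding e1_def by (simp add: D_diff X_diff R_mem)
    moreover have "D n (R \<epsilon> n (e3 n)) = D n (R \<epsilon> n (P n x)) - R' n (P n z)"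
      unfolding e3_def by (simp add: R_diff R'_mem D_diff R_mem DRR')
    ultimately have eq: "D n (P n y) - P n x = D n (e1 n) + D n (P n y') + (D n (R \<epsilon> n (e3 n)) - e3 n)"
      by (simp add: e3_def)
    have "norm (D n (P n y) - P n x)
        \<le> norm (D n (e1 n)) + norm (D n (P n y')) + (norm (D n (R \<epsilon> n (e3 n))) + norm (e3 n))"
      unfolding eq using norm_triangle_ineq[of "D n (e1 n) + D n (P n y')" "D n (R \<epsilon> n (e3 n)) - e3 n"]
        norm_triangle_ineq[of "D n (e1 n)" "D n (P n y')"]
        norm_triangle_ineq4[of "D n (R \<epsilon> n (e3 n))" "e3 n"] by linarith
    moreover have "norm (D n (R \<epsilon> n (e3 n))) \<le> norm (e3 n)"
      using is_mp_inverse_onD(7)[OF D e_mem(2) DR_mem[OF e_mem(2)]]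
      by (intro projection_norm_le) (simp add: is_mp_inverse_onD(1)[OF D e_mem(2)])
    ultimately show ?thesis
      using D_norm[OF e_mem(1), of n] D_R'[OF P_mem[of n y']] by (simp add: e2_def)
  qed
  have "(\<lambda>n. D n (P n y) - P n x) \<longlonglongrightarrow> 0"
  proof (rule Lim_null_comparison[OF always_eventually[OF allI[OF bound]]])
    have e1: "e1 \<longlonglongrightarrow> 0" and e2: "e2 \<longlonglongrightarrow> 0" and e3: "e3 \<longlonglongrightarrow> 0"
      using tendsto_diff[OF P_lim[of "T x"] R_lim[of x]] R'_lim[of y']
        tendsto_diff[OF P_lim[of x] R'_lim[of z]]
      by (simp_all add: e1_def[abs_def] e2_def[abs_def] e3_def[abs_def] Sy' Sz)
    have "(\<lambda>n. inverse \<epsilon> * norm (e1 n) + inverse \<epsilon> * (inverse \<epsilon> * norm (e2 n)) + 2 * norm (e3 n))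
        \<longlonglongrightarrow> inverse \<epsilon> * norm (0::'a) + inverse \<epsilon> * (inverse \<epsilon> * norm (0::'a)) + 2 * norm (0::'a)"
      by (intro tendsto_intros e1 e2 e3)
    then show "(\<lambda>n. inverse \<epsilon> * norm (e1 n) + inverse \<epsilon> * (inverse \<epsilon> * norm (e2 n)) + 2 * norm (e3 n))
        \<longlonglongrightarrow> 0"
      by simp
  qed
  from tendsto_add[OF this P_lim[of x]] show ?thesis
    by (simp add: D_def x_def)
qed

end

theorem theorem3p3:
  fixes T :: "'a::complex_hilbert \<Rightarrow> 'a"
    and P :: "nat \<Rightarrow> 'a \<Rightarrow> 'a"
  assumes "separable_space (euclidean :: 'a topology)"
    and "quasidiagonal T"
    and "filtration P"
    and "(\<lambda>n. onorm (commutator (P n) T)) \<longlonglongrightarrow> 0"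
  shows "(stable_seq P T \<longleftrightarrow> invertible_op T) \<and>
         (applicable P T \<longleftrightarrow> invertible_op T) \<and>
         (stably_regularizable P T \<longleftrightarrow> mp_invertible_on UNIV T) \<and>
         (mp_invertible_on UNIV T \<longleftrightarrow> closed (range T)) \<and>
         (\<forall>\<epsilon> y. closed (range T) \<and> 0 < \<epsilon> \<and>
           ereal \<epsilon> < Inf {ereal l | l. 0 < l \<and>
                            complex_of_real (l\<^sup>2) \<in> op_spectrum (\<lambda>x. adjoint_op T (T x))} \<longrightarrow>
           (\<lambda>n. norm (least_square_solution_on (range (P n)) (regularized_section P T \<epsilon> n) (P n y)
                      - least_square_solution_on UNIV T y)) \<longlonglongrightarrow> 0)"
proof -
  have T: "bounded_op T"
    using assms(2) by (simp add: quasidiagonal_def)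
  obtain S where adj: "is_adjoint_on UNIV T S"
    using adjoint_exists[OF T] by blast
  interpret asymptotically_commuting T S P "\<lambda>n. onorm (commutator (P n) T)"
  proof
    show "norm (P n (T x) - T (P n x)) \<le> onorm (commutator (P n) T) * norm x" for n x
    proof -
      have P: "bounded_linear (P n)"
        using assms(3) unfolding filtration_def finite_rank_projection_def
        by (blast intro: bounded_op_imp_bounded_linear)
      note T' = bounded_op_imp_bounded_linear[OF T]
      have "bounded_linear (\<lambda>x. P n (T x) - T (P n x))"
        by (intro bounded_linear_sub bounded_linear_compose[OF P T'] bounded_linear_compose[OF T' P])
      then show ?thesis
        using onorm[of "commutator (P n) T" x] by (simp add: commutator_def[abs_def])
    qed
  qed (use T adj assms in auto)
  have "(\<lambda>n. norm (least_square_solution_on (range (P n)) (regularized_section P T \<epsilon> n) (P n y)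
      - least_square_solution_on UNIV T y)) \<longlonglongrightarrow> 0"
    if "closed (range T)" and \<epsilon>: "0 < \<epsilon>" and gap: "ereal \<epsilon> < Inf {ereal l | l. 0 < l \<and>
      complex_of_real (l\<^sup>2) \<in> op_spectrum (\<lambda>x. adjoint_op T (T x))}" for \<epsilon> y
  proof -
    have "mp_invertible_on UNIV T"
      using that mp_invertible_iff_closed_range[OF T] by simp
    then have B: "is_mp_inverse_on UNIV T (mp_inverse_on UNIV T)"
      unfolding mp_invertible_on_def mp_inverse_on_def by (rule someI_ex)
    \<comment> \<open>The spectral gap enters only here, as a lower bound for \<open>T\<close> off
      its kernel that is strictly larger than \<epsilon>.\<close>
    obtain d where d: "\<epsilon> < d" "\<And>w. d * norm (mp_inverse_on UNIV T (T w)) \<le> norm (T w)"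
      by (rule mp_inverse_bounded_below_spectrum[OF T adj B gap[unfolded adjoint_op_eqI[OF adj]]])
        (rule that; assumption)
    have "(\<lambda>n. mp_inverse_on (X n) (regularized_section P T \<epsilon> n) (P n y)) \<longlonglongrightarrow> mp_inverse_on UNIV T y"
      by (rule regularized_solutions_converge[OF B \<epsilon> regularization_error[OF B d(2) \<epsilon> d(1)]])
    then show ?thesis
      unfolding least_square_solution_on_def by (intro tendsto_norm_zero LIM_zero)
  qed
  then show ?thesis
    using stable_iff applicable_iff stably_regularizable_iff mp_invertible_iff_closed_range[OF T]
    by blast
qed

end
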